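(* Suppose that the linear Kakeya set conjecture holds in $\mathbb{R}^N$ for all dimensions $N$. Fix $n\geq 3$, compact balls $W,Y\subset\mathbb{R}^{n-1}$ and a compact interval $I\subset\mathbb{R}$, and let $Q=W\times I\times Y$, with $\mathbf H\subset C^\infty(Q;\mathbb{R}^{n-1})$ the set of maps satisfying H\"ormander's conditions and $\mathbf B\subset\mathbf H$ the set of maps satisfying Bourgain's condition. Then there is a dense set $\mathbf P\subset\mathbf H$ such that, for each $X\in\mathbf P$, every $X$-Kakeya set has Hausdorff dimension $n$. Moreover, $\mathbf B$ is a closed nowhere dense subset of $\mathbf H$. Consequently $\mathbf P\setminus\mathbf B$ is dense in $\mathbf H$, and for each $X\in\mathbf P\setminus\mathbf B$, every $X$-Kakeya set has Hausdorff dimension $n$, whereas the critical estimate $$\|\mathcal K_\delta^{X}f\|_{L^n(Y)}\lesssim_\varepsilon\delta^{-\varepsilon}\|f\|_{L^n(\mathbb{R}^n)}$$ fails; that is, it is not true that for every $\varepsilon>0$ there is a constant $C(\varepsilon)$ such that $\|\mathcal K_\delta^{X}f\|_{L^n(Y)}\leq C(\varepsilon)\delta^{-\varepsilon}\|f\|_{L^n(\mathbb{R}^n)}$ for all $0<\delta<1$ and all $f\in L^n(\mathbb{R}^n)$.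
   Context: Linear Kakeya set conjecture in $\mathbb{R}^N$: every compact subset of $\mathbb{R}^N$ containing a line segment in each direction has Hausdorff dimension $N$. Balls and intervals are nondegenerate (positive radius/length). $C^\infty(Q;\mathbb{R}^{n-1})$ (maps smooth up to the boundary of $Q$) has the Fr\'echet topology induced by the norms $\|X\|_{C^r(Q)}=\max_{|\alpha|\leq r}\|\partial^\alpha X\|_{L^\infty(Q)}$, $r\ge 0$. Points of $Q$ are written $(w,t;y)$ with $w\in W$, $t\in I$, $y\in Y$; $\nabla_wX$ and $\nabla_yX$ are the $(n-1)\times(n-1)$ Jacobian matrices in $w$ and $y$. H\"ormander's conditions: $X\in\mathbf H$ iff $\det\nabla_wX\neq0$ and $\det\partial_t[(\nabla_wX)^{-1}\nabla_yX]\neq0$ everywhere on $Q$. $\mathbf H$ carries the subspace topology. Bourgain's condition: $X\in\mathbf H$ belongs to $\mathbf B$ iff there is a scalar function $\lambda(w,t;y)$ on $Q$ with $\partial_t^2((\nabla_wX)^{-1}\nabla_yX)=\lambda\,\partial_t((\nabla_wX)^{-1}\nabla_yX)$ on $Q$. For $X\in\mathbf H$ and $(y,w)\in Y\times W$, let $\gamma_{y,w}=\{(X(w,t;y),t):t\in I\}\subset\mathbb{R}^n$. An $X$-Kakeya set is a compact set $K\subset\mathbb{R}^n$ such that for each $y\in Y$ there is $w(y)\in W$ with $\gamma_{y,w(y)}\subset K$. Curved Kakeya maximal function: $\mathcal K_\delta^Xf(y)=\sup_{w\in W}\frac{1}{|N_\delta(\gamma_{y,w})|}\int_{N_\delta(\gamma_{y,w})}|f|$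 for $y\in Y$, where $N_\delta$ denotes the $\delta$-neighborhood. *)

theory Defs
  imports "HOL-Analysis.Analysis"
begin

section \<open>Hausdorff dimension\<close>

text \<open>The distance is a parameter because the linear Kakeya conjecture is needed in
  Euclidean spaces of every dimension \<open>N\<close> simultaneously, which cannot be quantified over as types.\<close>

definition ediam :: "('a \<Rightarrow> 'a \<Rightarrow> real) \<Rightarrow> 'a set \<Rightarrow> ennreal" where
  "ediam d U = (SUP x\<in>U. SUP y\<in>U. ennreal (d x y))"

definition hausdorff_content :: "('a \<Rightarrow> 'a \<Rightarrow> real) \<Rightarrow> real \<Rightarrow> real \<Rightarrow> 'a set \<Rightarrow> ennreal" where
  "hausdorff_content d s \<delta> S =
     (INF U\<in>{U :: nat \<Rightarrow> 'a set. S \<subseteq> (\<Union>i. U i) \<and> (\<forall>i. ediam d (U i) \<le> ennreal \<delta>)}.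
        \<Sum>i. ennreal (enn2real (ediam d (U i)) powr s))"

definition hausdorff_measure :: "('a \<Rightarrow> 'a \<Rightarrow> real) \<Rightarrow> real \<Rightarrow> 'a set \<Rightarrow> ennreal" where
  "hausdorff_measure d s S = (SUP \<delta>\<in>{0<..}. hausdorff_content d s \<delta> S)"

text \<open>Only \<open>s > 0\<close> is used, since \<open>0 powr 0 = 0\<close> would spoil the counting measure; the infimum is
  the same. The empty set has dimension \<open>0\<close>.\<close>

definition hausdorff_dim :: "('a \<Rightarrow> 'a \<Rightarrow> real) \<Rightarrow> 'a set \<Rightarrow> ereal" where
  "hausdorff_dim d S = Inf (ereal ` {s. 0 < s \<and> hausdorff_measure d s S = 0})"


section \<open>The linear Kakeya set conjecture\<close>

text \<open>\<open>\<real>\<^sup>N\<close> is \<^const>\<open>Euclidean_space\<close> \<open>N\<close>: the sequences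
  vanishing from index \<open>N\<close> on.\<close>

definition euclid_dist :: "nat \<Rightarrow> (nat \<Rightarrow> real) \<Rightarrow> (nat \<Rightarrow> real) \<Rightarrow> real" where
  "euclid_dist N x y = L2_set (\<lambda>i. x i - y i) {..<N}"

definition contains_segment_in_each_direction :: "nat \<Rightarrow> (nat \<Rightarrow> real) set \<Rightarrow> bool" where
  "contains_segment_in_each_direction N K \<longleftrightarrow>
     (\<forall>e \<in> topspace (Euclidean_space N). L2_set e {..<N} = 1 \<longrightarrow>
        (\<exists>a \<in> topspace (Euclidean_space N). \<exists>l>0. \<forall>s\<in>{0..l}. (\<lambda>i. a i + s * e i) \<in> K))"

definition linear_kakeya_conjecture :: "nat \<Rightarrow> bool" where
  "linear_kakeya_conjecture N \<longleftrightarrow>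
     (\<forall>K. compactin (Euclidean_space N) K \<and> contains_segment_in_each_direction N K
        \<longrightarrow> hausdorff_dim (euclid_dist N) K = ereal (real N))"


section \<open>Smooth maps on a compact domain\<close>

text \<open>Partial derivatives on \<open>Q\<close> are values of the Frechet derivative relative to \<open>Q\<close>, which is
  unique when \<open>Q\<close> is convex with nonempty interior. (Limits along coordinate lines
  inside \<open>Q\<close> would not do: at some boundary points of a ball such a line meets the ball in one
  point.)\<close>

definition pderiv_on ::
  "'a::real_normed_vector set \<Rightarrow> 'a \<Rightarrow> ('a \<Rightarrow> 'b::real_normed_vector) \<Rightarrow> 'a \<Rightarrow> 'b" where
  "pderiv_on Q b f = (\<lambda>q. frechet_derivative f (at q within Q) b)"

text \<open>Multi-indices are given as lists of coordinate directions; for smooth maps the order in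
  the list is immaterial.\<close>

primrec pderivs_on ::
  "'a::real_normed_vector set \<Rightarrow> 'a list \<Rightarrow> ('a \<Rightarrow> 'b::real_normed_vector) \<Rightarrow> 'a \<Rightarrow> 'b" where
  "pderivs_on Q [] f = f"
| "pderivs_on Q (b # bs) f = pderiv_on Q b (pderivs_on Q bs f)"

text \<open>Maps on \<open>Q\<close> are represented by extensional functions.\<close>

definition C_infty :: "'a::euclidean_space set \<Rightarrow> ('a \<Rightarrow> 'b::real_normed_vector) set" where
  "C_infty Q = {X \<in> extensional Q.
     \<forall>bs. set bs \<subseteq> Basis \<longrightarrow> pderivs_on Q bs X differentiable_on Q}"

text \<open>All derivatives involved are continuous, so for \<open>Q\<close> the closure of its interior
  the \<open>L\<^sup>\<infinity>\<close> norm is the supremum.\<close>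

definition C_norm :: "'a::euclidean_space set \<Rightarrow> nat \<Rightarrow> ('a \<Rightarrow> 'b::real_normed_vector) \<Rightarrow> real" where
  "C_norm Q r X =
     Max ((\<lambda>bs. SUP q\<in>Q. norm (pderivs_on Q bs X q)) ` {bs. set bs \<subseteq> Basis \<and> length bs \<le> r})"

definition C_infty_topology ::
  "'a::euclidean_space set \<Rightarrow> ('a \<Rightarrow> 'b::real_normed_vector) topology" where
  "C_infty_topology Q = topology_generated_by
     {{Z \<in> C_infty Q. C_norm Q r (\<lambda>q. Z q - X q) < \<epsilon>} | X r \<epsilon>. X \<in> C_infty Q \<and> 0 < \<epsilon>}"


section \<open>Hoermander's and Bourgain's conditions\<close>

text \<open>With \<open>n = CARD('m) + 1\<close>, points \<open>(w,t;y)\<close> are triples \<open>(w,t,y)\<close>, and \<open>\<real>\<^sup>n\<close> is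
  \<open>real^'m \<times> real\<close>, whose product norm and Lebesgue measure are the Euclidean ones.\<close>

type_synonym 'm pt = "(real ^ 'm) \<times> real \<times> (real ^ 'm)"

definition grad_w :: "('m::finite) pt set \<Rightarrow> ('m pt \<Rightarrow> real ^ 'm) \<Rightarrow> 'm pt \<Rightarrow> real ^ 'm ^ 'm" where
  "grad_w Q X q = (\<chi> i j. pderiv_on Q (axis j 1, 0, 0) X q $ i)"

definition grad_y :: "('m::finite) pt set \<Rightarrow> ('m pt \<Rightarrow> real ^ 'm) \<Rightarrow> 'm pt \<Rightarrow> real ^ 'm ^ 'm" where
  "grad_y Q X q = (\<chi> i j. pderiv_on Q (0, 0, axis j 1) X q $ i)"

definition deriv_t ::
  "('m::finite) pt set \<Rightarrow> ('m pt \<Rightarrow> 'b::real_normed_vector) \<Rightarrow> 'm pt \<Rightarrow> 'b" where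
  "deriv_t Q = pderiv_on Q (0, 1, 0)"

definition curv_matrix ::
  "('m::finite) pt set \<Rightarrow> ('m pt \<Rightarrow> real ^ 'm) \<Rightarrow> 'm pt \<Rightarrow> real ^ 'm ^ 'm" where
  "curv_matrix Q X q = matrix_inv (grad_w Q X q) ** grad_y Q X q"

definition hormander :: "('m::finite) pt set \<Rightarrow> ('m pt \<Rightarrow> real ^ 'm) set" where
  "hormander Q = {X \<in> C_infty Q. \<forall>q\<in>Q.
     det (grad_w Q X q) \<noteq> 0 \<and> det (deriv_t Q (curv_matrix Q X) q) \<noteq> 0}"

definition hormander_topology :: "('m::finite) pt set \<Rightarrow> ('m pt \<Rightarrow> real ^ 'm) topology" where
  "hormander_topology Q = subtopology (C_infty_topology Q) (hormander Q)"

definition bourgain :: "('m::finite) pt set \<Rightarrow> ('m pt \<Rightarrow> real ^ 'm) set" where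
  "bourgain Q = {X \<in> hormander Q. \<exists>lam :: 'm pt \<Rightarrow> real. \<forall>q\<in>Q.
     deriv_t Q (deriv_t Q (curv_matrix Q X)) q = lam q *\<^sub>R deriv_t Q (curv_matrix Q X) q}"


section \<open>Curved Kakeya sets and the maximal function\<close>

definition kakeya_curve :: "real set \<Rightarrow> (('m::finite) pt \<Rightarrow> real ^ 'm) \<Rightarrow>
    real ^ 'm \<Rightarrow> real ^ 'm \<Rightarrow> ((real ^ 'm) \<times> real) set" where
  "kakeya_curve I X y w = {(X (w, t, y), t) | t. t \<in> I}"

definition kakeya_set :: "(real ^ 'm) set \<Rightarrow> real set \<Rightarrow> (real ^ 'm) set \<Rightarrow>
    (('m::finite) pt \<Rightarrow> real ^ 'm) \<Rightarrow> ((real ^ 'm) \<times> real) set \<Rightarrow> bool" where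
  "kakeya_set W I Y X K \<longleftrightarrow> compact K \<and> (\<forall>y\<in>Y. \<exists>w\<in>W. kakeya_curve I X y w \<subseteq> K)"

definition nbhd :: "real \<Rightarrow> 'a::metric_space set \<Rightarrow> 'a set" where
  "nbhd \<delta> A = (\<Union>a\<in>A. ball a \<delta>)"

definition kakeya_maximal :: "(real ^ 'm) set \<Rightarrow> real set \<Rightarrow> (('m::finite) pt \<Rightarrow> real ^ 'm) \<Rightarrow>
    real \<Rightarrow> ((real ^ 'm) \<times> real \<Rightarrow> real) \<Rightarrow> real ^ 'm \<Rightarrow> ennreal" where
  "kakeya_maximal W I X \<delta> f y =
     (SUP w\<in>W. (\<integral>\<^sup>+x\<in>nbhd \<delta> (kakeya_curve I X y w). ennreal \<bar>f x\<bar> \<partial>lebesgue)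
                / emeasure lebesgue (nbhd \<delta> (kakeya_curve I X y w)))"

definition Lp_norm :: "'a measure \<Rightarrow> nat \<Rightarrow> ('a \<Rightarrow> ennreal) \<Rightarrow> ennreal" where
  "Lp_norm M p g = (let J = \<integral>\<^sup>+x. g x ^ p \<partial>M in
     if J = \<infinity> then \<infinity> else ennreal (root p (enn2real J)))"

definition in_Lp :: "'a measure \<Rightarrow> nat \<Rightarrow> ('a \<Rightarrow> real) \<Rightarrow> bool" where
  "in_Lp M p f \<longleftrightarrow> f \<in> borel_measurable M \<and> Lp_norm M p (\<lambda>x. ennreal \<bar>f x\<bar>) < \<infinity>"

definition critical_estimate :: "nat \<Rightarrow> (real ^ 'm) set \<Rightarrow> real set \<Rightarrow> (real ^ 'm) set \<Rightarrow>
    (('m::finite) pt \<Rightarrow> real ^ 'm) \<Rightarrow> bool" where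
  "critical_estimate n W I Y X \<longleftrightarrow>
     (\<forall>\<epsilon>>0. \<exists>C>0. \<forall>\<delta> f. 0 < \<delta> \<and> \<delta> < 1 \<and> in_Lp lebesgue n f \<longrightarrow>
        Lp_norm (lebesgue_on Y) n (kakeya_maximal W I X \<delta> f)
          \<le> ennreal (C * \<delta> powr (- \<epsilon>)) * Lp_norm lebesgue n (\<lambda>x. ennreal \<bar>f x\<bar>))"

end

theory Submission
  imports Defs
begin

text \<open>Take for \<open>P\<close> the maps in \<open>H\<close> that are polynomial in \<open>t\<close> with top coefficient \<open>h (y - y\<^sub>0)\<close>,
  \<open>h > 0\<close>. Such a curve is the image of a line of \<open>\<real>\<^sup>N\<close>, \<open>N = (M + 1) (n - 1) + 1\<close>, under the submersion
  \<open>(x\<^sub>0, \<dots>, x\<^sub>M, t) \<mapsto> (\<Sum>\<^sub>j t\<^sup>j x\<^sub>j, t)\<close>: the direction \<open>(v\<^sub>0, \<dots>, v\<^sub>M, 1)\<close> of the line determines \<open>y\<close>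
  through \<open>v\<^sub>M = h (y - y\<^sub>0)\<close>, and its base point absorbs the other coefficients and the remaining \<open>v\<^sub>j\<close>. So
  the preimage of an \<open>X\<close>-Kakeya set contains segments in an open set of directions, finitely many linear
  images of it form a linear Kakeya set, and the codimension of the Kakeya set is preserved.
  Density of \<open>P\<close> holds since a Taylor expansion in \<open>t\<close> whose remainder is built from a Bernstein
  polynomial converges in \<open>C\<^sup>r\<close>.

  If Bourgain's condition fails at an interior point, one can choose \<open>w\<close> affinely in \<open>y\<close> so that the
  curves over a ball of \<open>y\<close> of radius \<open>\<rho>\<^sup>3\<close> stay, for times \<open>|t - t\<^sub>0| \<le> \<rho>\<close>, in a set smaller by a factor \<open>\<rho>\<close> than
  the critical estimate permits; its \<open>\<rho>\<^sup>6\<close>-neighbourhood is the counterexample.\<close>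

section \<open>Differential calculus relative to a convex domain\<close>

text \<open>A Kakeya set may select \<open>w\<close> as a wild function of \<open>y\<close>. The
  lifting argument therefore uses only bounds on the coefficients, never their regularity, and
  recovers \<open>y\<close> from the direction alone. The fibres of the submersion have dimension
  \<open>M m\<close>, and \<open>N - M m = m + 1 = n\<close> is the dimension that must survive,
  where \<open>m = n - 1\<close>. Uniform approximation says nothing about derivatives. Hence
  Bernstein polynomials approximate the \<open>r\<close>-th time derivative and are integrated back
  \<open>r\<close> times; derivatives in \<open>w\<close> and \<open>y\<close> fall on the
  coefficients only. In the counterexample \<open>\<delta> = \<rho>^6\<close> is the common size of
  the errors: quadratic in \<open>y - y\<^sub>0\<close>, or linear in it and cubic in time. A time
  slice then has extent \<open>\<rho>^3\<close> in one direction, \<open>\<rho>^6\<close> in a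
  second and \<open>\<rho>^4\<close> in the other \<open>m - 2\<close>, so the set has measure about
  \<open>\<rho>^(4m+2)\<close>. The maximal function of its indicator is at least about
  \<open>\<rho>\<close> on a ball of measure about \<open>\<rho>^(3m)\<close>, so its
  \<open>n\<close>-th power integrates to at least about \<open>\<rho>^(4m+1)\<close>. The missing
  factor \<open>\<rho>\<close> beats \<open>\<delta>^(-\<epsilon> n)\<close> for small
  \<open>\<epsilon>\<close>.\<close>

lemma has_derivative_unique_within_convex:
  fixes f :: "'a::euclidean_space \<Rightarrow> 'b::real_normed_vector"
  assumes Q: "convex Q" "interior Q \<noteq> {}" "x \<in> Q"
    and 1: "(f has_derivative D) (at x within Q)" and 2: "(f has_derivative D') (at x within Q)"
  shows "D = D'"
proof -
  define E where "E = (\<lambda>v. D v - D' v)"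
  have E: "((\<lambda>_. 0) has_derivative E) (at x within Q)"
    using has_derivative_diff[OF 1 2] unfolding E_def by simp
  then have linE: "linear E" by (simp add: has_derivative_bounded_linear bounded_linear.linear)
  \<comment> \<open>On the segment from \<open>x\<close> to \<open>z\<close> the question is
    one-dimensional, where a derivative is unique even at an endpoint of a closed interval.\<close>
  have zero: "E (z - x) = 0" if z: "z \<in> Q" for z
  proof -
    define p where "p = (\<lambda>s::real. x + s *\<^sub>R (z - x))"
    have p: "(p has_derivative (\<lambda>s. s *\<^sub>R (z - x))) (at 0 within {0..1})"
      unfolding p_def by (auto intro!: derivative_eq_intros)
    have sub: "p ` {0..1} \<subseteq> Q"
      using Q(1,3) z unfolding p_def by (auto simp: convex_alt algebra_simps)
    have "((\<lambda>_. 0) has_derivative E) (at (p 0) within p ` {0..1})"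
      using has_derivative_subset[OF E sub] by (simp add: p_def)
    then have "((\<lambda>_. 0) \<circ> p has_derivative E \<circ> (\<lambda>s. s *\<^sub>R (z - x))) (at 0 within {0..1})"
      using p diff_chain_within by blast
    then have "((\<lambda>_. 0) has_derivative (\<lambda>s. s *\<^sub>R E (z - x))) (at 0 within {0..(1::real)})"
      by (simp add: o_def linear_scale[OF linE])
    then have "((\<lambda>_. 0) has_vector_derivative E (z - x)) (at 0 within {0..(1::real)})"
      by (simp add: has_vector_derivative_def)
    moreover have "((\<lambda>_. 0) has_vector_derivative 0) (at 0 within {0..(1::real)})" by simp
    ultimately show ?thesis
      using vector_derivative_unique_within_closed_interval[of 0 1 0 "\<lambda>_. 0" "E (z - x)" 0] by auto
  qed
  \<comment> \<open>Differences of points of \<open>Q\<close> span the space because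
    \<open>Q\<close> contains a ball: \<open>E\<close> kills both \<open>c - x\<close> and
    \<open>c + (e/2) b - x\<close>.\<close>
  obtain c e where ce: "e > 0" "ball c e \<subseteq> Q" "c \<in> Q"
    using Q(2) by (metis centre_in_ball ex_in_conv mem_interior subset_eq)
  have "E b = 0" if "b \<in> Basis" for b
  proof -
    have "c + (e/2) *\<^sub>R b \<in> Q" using ce that by (intro subsetD[OF ce(2)]) (simp add: dist_norm)
    then have "E (c + (e/2) *\<^sub>R b - x) = 0" by (rule zero)
    moreover have "E (c + (e/2) *\<^sub>R b - x) = E ((c - x) + (e/2) *\<^sub>R b)" by (simp add: algebra_simps)
    moreover have "\<dots> = E (c - x) + (e/2) *\<^sub>R E b"
      by (simp only: linear_add[OF linE] linear_scale[OF linE])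
    ultimately have "E (c - x) + (e/2) *\<^sub>R E b = 0" by simp
    then show ?thesis using zero[OF ce(3)] ce(1) by simp
  qed
  then have "E = (\<lambda>_. 0)"
    using linear_eq_stdbasis[OF linE linear_zero] by blast
  then show ?thesis by (simp add: E_def fun_eq_iff)
qed

text \<open>Counts from one derivative on: \<open>diff_times Q k\<close> means \<open>k + 1\<close>
  times differentiable. Recursion on the derivative applied first lets the closure properties be
  proved by induction on \<open>k\<close> for all functions at once.\<close>

primrec diff_times :: "'a::euclidean_space set \<Rightarrow> nat \<Rightarrow> ('a \<Rightarrow> 'b::real_normed_vector) \<Rightarrow> bool" where
  "diff_times Q 0 f \<longleftrightarrow> f differentiable_on Q"
| "diff_times Q (Suc k) f \<longleftrightarrow> f differentiable_on Q \<and> (\<forall>b\<in>Basis. diff_times Q k (pderiv_on Q b f))"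

definition smooth :: "'a::euclidean_space set \<Rightarrow> ('a \<Rightarrow> 'b::real_normed_vector) \<Rightarrow> bool" where
  "smooth Q f \<longleftrightarrow> (\<forall>k. diff_times Q k f)"

lemma diff_times_D: "diff_times Q k f \<Longrightarrow> f differentiable_on Q"
  by (cases k) auto

lemma diff_times_SucD: "diff_times Q (Suc k) f \<Longrightarrow> diff_times Q k f"
  by (induction k arbitrary: f) auto

lemma smooth_differentiable: "smooth Q f \<Longrightarrow> f differentiable_on Q"
  unfolding smooth_def using diff_times_D by blast

lemma pderivs_on_snoc: "pderivs_on Q (bs @ [b]) f = pderivs_on Q bs (pderiv_on Q b f)"
  by (induction bs) auto

text \<open>\<open>pderivs_on\<close> applies the last entry of the list first, whereas
  \<open>diff_times\<close> peels off the first derivative; lists are therefore split at their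
  end.\<close>

lemma diff_times_iff_pderivs_on:
  "diff_times Q k f \<longleftrightarrow> (\<forall>bs. set bs \<subseteq> Basis \<and> length bs \<le> k \<longrightarrow> pderivs_on Q bs f differentiable_on Q)"
proof (induction k arbitrary: f)
  case (Suc k)
  show ?case
  proof
    assume L: "diff_times Q (Suc k) f"
    show "\<forall>bs. set bs \<subseteq> Basis \<and> length bs \<le> Suc k \<longrightarrow> pderivs_on Q bs f differentiable_on Q"
    proof (intro allI impI)
      fix bs assume bs: "set bs \<subseteq> (Basis::'a set) \<and> length bs \<le> Suc k"
      show "pderivs_on Q bs f differentiable_on Q"
        using L bs Suc by (cases bs rule: rev_cases) (auto simp: pderivs_on_snoc)
    qed
  next
    assume R: "\<forall>bs. set bs \<subseteq> Basis \<and> length bs \<le> Suc k \<longrightarrow> pderivs_on Q bs f differentiable_on Q"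
    have "f differentiable_on Q" using R[rule_format, of "[]"] by simp
    moreover have "pderivs_on Q bs (pderiv_on Q b f) differentiable_on Q"
      if "b \<in> Basis" "set bs \<subseteq> Basis \<and> length bs \<le> k" for b bs
      using R[rule_format, of "bs @ [b]"] that by (simp add: pderivs_on_snoc)
    ultimately show "diff_times Q (Suc k) f" using Suc by auto
  qed
qed auto

lemma smooth_iff_pderivs_on:
  "smooth Q f \<longleftrightarrow> (\<forall>bs. set bs \<subseteq> Basis \<longrightarrow> pderivs_on Q bs f differentiable_on Q)"
  unfolding smooth_def diff_times_iff_pderivs_on by blast

lemma C_infty_iff: "X \<in> C_infty Q \<longleftrightarrow> X \<in> extensional Q \<and> smooth Q X"
  by (simp add: C_infty_def smooth_iff_pderivs_on)

lemma pderiv_on_cong: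
  assumes "\<And>x. x \<in> Q \<Longrightarrow> f x = g x" "x \<in> Q"
  shows "pderiv_on Q v f x = pderiv_on Q v g x"
proof -
  \<comment> \<open>\<open>frechet_derivative\<close> is a Hilbert choice, so equivalent predicates
    give equal values whether or not a derivative exists.\<close>
  have "(f has_derivative D) (at x within Q) \<longleftrightarrow> (g has_derivative D) (at x within Q)" for D
    using assms has_derivative_transform[of x Q f g D] has_derivative_transform[of x Q g f D] by auto
  then show ?thesis unfolding pderiv_on_def frechet_derivative_def by simp
qed

lemma pderivs_on_cong:
  assumes "\<And>x. x \<in> Q \<Longrightarrow> f x = g x" "x \<in> Q"
  shows "pderivs_on Q bs f x = pderivs_on Q bs g x"
  using assms(2) by (induction bs arbitrary: x) (auto simp: assms(1) intro: pderiv_on_cong)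

lemma differentiable_on_cong:
  assumes "\<And>x. x \<in> Q \<Longrightarrow> f x = g x"
  shows "f differentiable_on Q \<longleftrightarrow> g differentiable_on Q"
proof -
  have "(f has_derivative D) (at x within Q) \<longleftrightarrow> (g has_derivative D) (at x within Q)" if "x \<in> Q" for x D
    using assms that has_derivative_transform[of x Q f g D] has_derivative_transform[of x Q g f D] by auto
  then show ?thesis unfolding differentiable_on_def differentiable_def by blast
qed

lemma diff_times_cong:
  assumes "\<And>x. x \<in> Q \<Longrightarrow> f x = g x"
  shows "diff_times Q k f \<longleftrightarrow> diff_times Q k g"
  using assms
proof (induction k arbitrary: f g)
  case 0
  then show ?case unfolding diff_times.simps by (rule differentiable_on_cong)
next
  case (Suc k)
  have "diff_times Q k (pderiv_on Q b f) \<longleftrightarrow> diff_times Q k (pderiv_on Q b g)" for b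
    by (rule Suc.IH, rule pderiv_on_cong) (use Suc.prems in auto)
  moreover have "f differentiable_on Q \<longleftrightarrow> g differentiable_on Q"
    using Suc.prems by (rule differentiable_on_cong)
  ultimately show ?case by (simp only: diff_times.simps)
qed

lemma smooth_cong:
  assumes "\<And>x. x \<in> Q \<Longrightarrow> f x = g x"
  shows "smooth Q f \<longleftrightarrow> smooth Q g"
  by (simp only: smooth_def diff_times_cong[OF assms])

text \<open>Convexity with nonempty interior makes relative derivatives unique; compactness bounds
  smooth functions and makes them uniformly continuous.\<close>

locale smooth_domain =
  fixes Q :: "'a::euclidean_space set"
  assumes convex: "convex Q" and interior: "interior Q \<noteq> {}" and compact: "compact Q"
begin

lemma pderiv_on_eq:
  "(f has_derivative D) (at x within Q) \<Longrightarrow> x \<in> Q \<Longrightarrow> pderiv_on Q v f x = D v"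
  unfolding pderiv_on_def
  using has_derivative_unique_within_convex[OF convex interior, of x f "frechet_derivative f (at x within Q)" D]
    frechet_derivative_works[of f "at x within Q"] differentiableI[of f D "at x within Q"] by simp

lemma pderiv_on_works:
  "f differentiable_on Q \<Longrightarrow> x \<in> Q \<Longrightarrow> (f has_derivative (\<lambda>v. pderiv_on Q v f x)) (at x within Q)"
  unfolding pderiv_on_def differentiable_on_def frechet_derivative_works by auto

lemma pderiv_on_basis:
  assumes "f differentiable_on Q" "x \<in> Q"
  shows "pderiv_on Q v f x = (\<Sum>b\<in>Basis. (v \<bullet> b) *\<^sub>R pderiv_on Q b f x)"
proof -
  interpret linear "\<lambda>v. pderiv_on Q v f x"
    using pderiv_on_works[OF assms] has_derivative_bounded_linear bounded_linear.linear by blast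
  show ?thesis
    by (subst euclidean_representation[of v, symmetric]) (simp add: sum scale)
qed

lemma diff_times_const: "diff_times Q k (\<lambda>_. c)"
proof (induction k arbitrary: c)
  case (Suc k)
  have "pderiv_on Q b (\<lambda>_. c) x = 0" if "x \<in> Q" for b x
    using that by (intro pderiv_on_eq) auto
  then have "diff_times Q k (pderiv_on Q b (\<lambda>_. c))" for b
    using Suc[of 0] diff_times_cong[of Q "pderiv_on Q b (\<lambda>_. c)" "\<lambda>_. 0" k] by simp
  then show ?case by simp
qed auto

lemma smooth_const: "smooth Q (\<lambda>_. c)"
  unfolding smooth_def using diff_times_const by blast

lemma pderiv_on_add:
  assumes "f differentiable_on Q" "g differentiable_on Q" "x \<in> Q"
  shows "pderiv_on Q v (\<lambda>x. f x + g x) x = pderiv_on Q v f x + pderiv_on Q v g x"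
  by (rule pderiv_on_eq[OF has_derivative_add]) (auto intro: pderiv_on_works assms)

text \<open>Pattern for all closure rules: the derivative formula holds only on \<open>Q\<close>, so
  \<open>diff_times_cong\<close> replaces the derivative by its formula before the induction
  hypothesis applies.\<close>

lemma diff_times_add:
  "diff_times Q k f \<Longrightarrow> diff_times Q k g \<Longrightarrow> diff_times Q k (\<lambda>x. f x + g x)"
proof (induction k arbitrary: f g)
  case 0
  then show ?case by (auto intro: differentiable_on_add)
next
  case (Suc k)
  have d: "f differentiable_on Q" "g differentiable_on Q" using Suc.prems by auto
  have "diff_times Q k (pderiv_on Q b (\<lambda>x. f x + g x))" if "b \<in> Basis" for b
    using Suc.IH[of "pderiv_on Q b f" "pderiv_on Q b g"] Suc.prems that
      diff_times_cong[of Q "pderiv_on Q b (\<lambda>x. f x + g x)" "\<lambda>x. pderiv_on Q b f x + pderiv_on Q b g x" k]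
      pderiv_on_add[OF d] by simp
  with d show ?case by (auto intro: differentiable_on_add)
qed

lemma smooth_add: "smooth Q f \<Longrightarrow> smooth Q g \<Longrightarrow> smooth Q (\<lambda>x. f x + g x)"
  unfolding smooth_def using diff_times_add by blast

lemma smooth_sum: "(\<And>i. i \<in> A \<Longrightarrow> smooth Q (f i)) \<Longrightarrow> smooth Q (\<lambda>x. \<Sum>i\<in>A. f i x)"
  by (induction A rule: infinite_finite_induct) (auto intro: smooth_add smooth_const)

lemma pderiv_on_linear:
  assumes "bounded_linear l" "f differentiable_on Q" "x \<in> Q"
  shows "pderiv_on Q v (\<lambda>x. l (f x)) x = l (pderiv_on Q v f x)"
  by (rule pderiv_on_eq[OF bounded_linear.has_derivative[OF assms(1)]]) (auto intro: pderiv_on_works assms)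

lemma differentiable_on_linear:
  assumes "bounded_linear l" "f differentiable_on Q"
  shows "(\<lambda>x. l (f x)) differentiable_on Q"
  using assms bounded_linear.has_derivative unfolding differentiable_on_def differentiable_def by blast

lemma diff_times_linear:
  assumes "bounded_linear l"
  shows "diff_times Q k f \<Longrightarrow> diff_times Q k (\<lambda>x. l (f x))"
proof (induction k arbitrary: f)
  case 0
  then show ?case using differentiable_on_linear[OF assms] by auto
next
  case (Suc k)
  have d: "f differentiable_on Q" using Suc.prems by auto
  have "diff_times Q k (pderiv_on Q b (\<lambda>x. l (f x)))" if "b \<in> Basis" for b
    using Suc.IH[of "pderiv_on Q b f"] Suc.prems that
      diff_times_cong[of Q "pderiv_on Q b (\<lambda>x. l (f x))" "\<lambda>x. l (pderiv_on Q b f x)" k]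
      pderiv_on_linear[OF assms d] by simp
  with d show ?case using differentiable_on_linear[OF assms] by auto
qed

lemma smooth_linear: "bounded_linear l \<Longrightarrow> smooth Q f \<Longrightarrow> smooth Q (\<lambda>x. l (f x))"
  unfolding smooth_def using diff_times_linear by blast

lemma pderiv_on_bilinear:
  assumes "bounded_bilinear p" "f differentiable_on Q" "g differentiable_on Q" "x \<in> Q"
  shows "pderiv_on Q v (\<lambda>x. p (f x) (g x)) x = p (f x) (pderiv_on Q v g x) + p (pderiv_on Q v f x) (g x)"
  by (rule pderiv_on_eq[OF bounded_bilinear.FDERIV[OF assms(1)]]) (auto intro: pderiv_on_works assms)

lemma differentiable_on_bilinear:
  assumes "bounded_bilinear p" "f differentiable_on Q" "g differentiable_on Q"
  shows "(\<lambda>x. p (f x) (g x)) differentiable_on Q"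
proof (unfold differentiable_on_def, intro ballI)
  fix x assume "x \<in> Q"
  then show "(\<lambda>x. p (f x) (g x)) differentiable at x within Q"
    using bounded_bilinear.FDERIV[OF assms(1) pderiv_on_works[OF assms(2)] pderiv_on_works[OF assms(3)]]
    by (blast intro: differentiableI)
qed

lemma diff_times_bilinear:
  assumes "bounded_bilinear p"
  shows "diff_times Q k f \<Longrightarrow> diff_times Q k g \<Longrightarrow> diff_times Q k (\<lambda>x. p (f x) (g x))"
proof (induction k arbitrary: f g)
  case 0
  then show ?case using differentiable_on_bilinear[OF assms] by simp
next
  case (Suc k)
  have d: "f differentiable_on Q" "g differentiable_on Q" using Suc.prems by auto
  have d': "(\<lambda>x. p (f x) (g x)) differentiable_on Q"
    using differentiable_on_bilinear[OF assms d] .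
  have k: "diff_times Q k f" "diff_times Q k g" using Suc.prems diff_times_SucD by auto
  have "diff_times Q k (pderiv_on Q b (\<lambda>x. p (f x) (g x)))" if b: "b \<in> Basis" for b
  proof -
    have "diff_times Q k (\<lambda>x. p (f x) (pderiv_on Q b g x) + p (pderiv_on Q b f x) (g x))"
      using Suc.IH k Suc.prems b by (intro diff_times_add) auto
    then show ?thesis
      by (subst diff_times_cong[OF pderiv_on_bilinear[OF assms d]])
  qed
  with d' show ?case by auto
qed

lemma smooth_bilinear:
  "bounded_bilinear p \<Longrightarrow> smooth Q f \<Longrightarrow> smooth Q g \<Longrightarrow> smooth Q (\<lambda>x. p (f x) (g x))"
  unfolding smooth_def using diff_times_bilinear by blast

lemmas smooth_scaleR = smooth_bilinear[OF bounded_bilinear_scaleR]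
lemmas smooth_mult = smooth_bilinear[OF bounded_bilinear_mult]

lemma smooth_scaleR_const: "smooth Q f \<Longrightarrow> smooth Q (\<lambda>x. c *\<^sub>R f x)"
  by (rule smooth_scaleR[OF smooth_const])

lemma smooth_diff: "smooth Q f \<Longrightarrow> smooth Q g \<Longrightarrow> smooth Q (\<lambda>x. f x - g x)"
  using smooth_add[of f "\<lambda>x. (-1) *\<^sub>R g x"] smooth_scaleR_const[of g "-1"] by simp

lemma smooth_power: "smooth Q f \<Longrightarrow> smooth Q (\<lambda>x. f x ^ n :: real)"
  by (induction n) (auto intro: smooth_const smooth_mult)

lemma smooth_prod: "(\<And>i. i \<in> A \<Longrightarrow> smooth Q (f i)) \<Longrightarrow> smooth Q (\<lambda>x. \<Prod>i\<in>A. f i x :: real)"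
  by (induction A rule: infinite_finite_induct) (auto intro: smooth_mult smooth_const)

lemma smooth_bounded_linear: "bounded_linear l \<Longrightarrow> smooth Q l"
  unfolding smooth_def
proof
  fix k assume l: "bounded_linear l"
  have d: "l differentiable_on Q" using l bounded_linear_imp_differentiable_on by blast
  show "diff_times Q k l"
  proof (cases k)
    case (Suc k')
    have "pderiv_on Q b l x = l b" if "x \<in> Q" for b x
      using that l by (intro pderiv_on_eq bounded_linear_imp_has_derivative)
    then have "diff_times Q k' (pderiv_on Q b l)" for b
      using diff_times_const[of k' "l b"] diff_times_cong[of Q "pderiv_on Q b l" "\<lambda>_. l b" k'] by simp
    with Suc d show ?thesis by simp
  qed (use d in auto)
qed

text \<open>The definition speaks of basis directions only; by linearity of the derivative a general
  direction gives a finite combination of those.\<close>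

lemma diff_times_pderiv_on:
  assumes "diff_times Q (Suc k) f" shows "diff_times Q k (pderiv_on Q v f)"
proof -
  have 1: "diff_times Q k (\<lambda>x. (v \<bullet> b) *\<^sub>R pderiv_on Q b f x)" if "b \<in> Basis" for b
    using diff_times_linear[OF bounded_linear_scaleR_right, of k "pderiv_on Q b f" "v \<bullet> b"] assms that by simp
  have "diff_times Q k (\<lambda>x. \<Sum>b\<in>A. (v \<bullet> b) *\<^sub>R pderiv_on Q b f x)" if "A \<subseteq> Basis" for A
    using finite_subset[OF that finite_Basis] that
  proof (induction A rule: finite_induct)
    case (insert b A)
    then show ?case using diff_times_add[OF 1[of b] insert.IH] by simp
  qed (simp add: diff_times_const)
  moreover have "f differentiable_on Q" using assms by simp
  ultimately show ?thesis
    by (subst diff_times_cong[OF pderiv_on_basis]) auto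
qed

lemma smooth_pderiv_on: "smooth Q f \<Longrightarrow> smooth Q (pderiv_on Q v f)"
  unfolding smooth_def using diff_times_pderiv_on by blast

lemma smooth_pderivs_on: "smooth Q f \<Longrightarrow> smooth Q (pderivs_on Q bs f)"
  by (induction bs) (auto intro: smooth_pderiv_on)

lemma has_derivative_affine_comp:
  assumes A: "bounded_linear A" "\<And>x. x \<in> Q \<Longrightarrow> A x + c \<in> Q" and f: "f differentiable_on Q" and x: "x \<in> Q"
  shows "((\<lambda>x. f (A x + c)) has_derivative (\<lambda>v. pderiv_on Q (A v) f (A x + c))) (at x within Q)"
proof -
  have "((\<lambda>x. A x + c) has_derivative A) (at x within Q)"
    using has_derivative_add_const[OF bounded_linear_imp_has_derivative[OF A(1)]] .
  moreover have "(f has_derivative (\<lambda>v. pderiv_on Q v f (A x + c))) (at (A x + c) within (\<lambda>x. A x + c) ` Q)"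
    by (rule has_derivative_subset[OF pderiv_on_works[OF f]]) (use A x in auto)
  ultimately show ?thesis using diff_chain_within[of "\<lambda>x. A x + c" A x Q f] by (simp add: o_def)
qed

lemma pderiv_on_affine_comp:
  assumes "bounded_linear A" "\<And>x. x \<in> Q \<Longrightarrow> A x + c \<in> Q" "f differentiable_on Q" "x \<in> Q"
  shows "pderiv_on Q v (\<lambda>x. f (A x + c)) x = pderiv_on Q (A v) f (A x + c)"
  using pderiv_on_eq[OF has_derivative_affine_comp] assms by blast

text \<open>The derivative of the composite in direction \<open>b\<close> is the composite with the
  derivative of \<open>f\<close> in direction \<open>A b\<close>, which need not be a basis vector.
  So the induction ranges over all smooth \<open>f\<close>. The map may be degenerate, as it is when
  \<open>t\<close> is frozen.\<close>

lemma smooth_affine_comp: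
  assumes A: "bounded_linear A" "\<And>x. x \<in> Q \<Longrightarrow> A x + c \<in> Q" and f: "smooth Q f"
  shows "smooth Q (\<lambda>x. f (A x + c))"
proof -
  have diff: "(\<lambda>x. f (A x + c)) differentiable_on Q" if "f differentiable_on Q" for f :: "'a \<Rightarrow> 'b"
    using has_derivative_affine_comp[OF A that] unfolding differentiable_on_def differentiable_def by blast
  have "diff_times Q k (\<lambda>x. f (A x + c))" if "smooth Q f" for f :: "'a \<Rightarrow> 'b" and k
    using that
  proof (induction k arbitrary: f)
    case (Suc k)
    have "diff_times Q k (pderiv_on Q b (\<lambda>x. f (A x + c)))" for b
      by (subst diff_times_cong[OF pderiv_on_affine_comp[OF A]])
        (use Suc in \<open>auto intro: smooth_pderiv_on smooth_differentiable\<close>)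
    then show ?case using diff Suc.prems smooth_differentiable by auto
  qed (use diff smooth_differentiable in auto)
  with f show ?thesis unfolding smooth_def by blast
qed

lemma smooth_continuous_on: "smooth Q f \<Longrightarrow> continuous_on Q f"
  using smooth_differentiable differentiable_imp_continuous_on by blast

lemma smooth_bounded:
  assumes "smooth Q f" obtains B where "B > 0" "\<And>x. x \<in> Q \<Longrightarrow> norm (f x) \<le> B"
proof -
  have "bounded (f ` Q)"
    using compact_imp_bounded[OF compact_continuous_image[OF smooth_continuous_on[OF assms] compact]] .
  then show ?thesis using that unfolding bounded_pos by (metis imageI)
qed

lemma pderiv_on_minus_eq:
  assumes "smooth Q f" "smooth Q g" "x \<in> Q"
  shows "pderiv_on Q v (\<lambda>x. f x - g x) x = pderiv_on Q v f x - pderiv_on Q v g x"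
  by (rule pderiv_on_eq[OF has_derivative_diff]) (auto intro: pderiv_on_works smooth_differentiable assms)

lemma pderivs_on_diff:
  assumes "smooth Q f" "smooth Q g" "x \<in> Q"
  shows "pderivs_on Q bs (\<lambda>x. f x - g x) x = pderivs_on Q bs f x - pderivs_on Q bs g x"
  using assms(3)
proof (induction bs arbitrary: x)
  case (Cons b bs)
  show ?case unfolding pderivs_on.simps
    by (subst pderiv_on_cong[OF Cons.IH]) (use Cons assms in \<open>auto intro!: pderiv_on_minus_eq smooth_pderivs_on\<close>)
qed auto

lemma pderivs_on_linear:
  assumes "smooth Q f" "bounded_linear l" "x \<in> Q"
  shows "pderivs_on Q bs (\<lambda>x. l (f x)) x = l (pderivs_on Q bs f x)"
  using assms(3)
proof (induction bs arbitrary: x)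
  case (Cons b bs)
  show ?case unfolding pderivs_on.simps
    by (subst pderiv_on_cong[OF Cons.IH])
      (use Cons assms in \<open>auto intro!: pderiv_on_linear smooth_pderivs_on smooth_differentiable\<close>)
qed auto

text \<open>The derivative of \<open>1 / g\<close> is a product of \<open>1 / g\<close> twice with a
  derivative of \<open>g\<close>, so smoothness of order \<open>k\<close> of \<open>1 / g\<close>
  itself yields order \<open>k + 1\<close>.\<close>

lemma smooth_real_inverse:
  fixes g :: "'a \<Rightarrow> real"
  assumes g: "smooth Q g" and nz: "\<And>x. x \<in> Q \<Longrightarrow> g x \<noteq> 0"
  shows "smooth Q (\<lambda>x. inverse (g x))"
proof -
  have d: "((\<lambda>x. inverse (g x)) has_derivative (\<lambda>v. - (inverse (g x) * pderiv_on Q v g x * inverse (g x)))) (at x within Q)"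
    if "x \<in> Q" for x
    by (rule Deriv.has_derivative_inverse) (use that nz g in \<open>auto intro: pderiv_on_works smooth_differentiable\<close>)
  have diff: "(\<lambda>x. inverse (g x)) differentiable_on Q"
    using d unfolding differentiable_on_def differentiable_def by blast
  have "diff_times Q k (\<lambda>x. inverse (g x))" for k
  proof (induction k)
    case (Suc k)
    have "diff_times Q k (pderiv_on Q b (\<lambda>x. inverse (g x)))" if "b \<in> Basis" for b
    proof -
      have p: "diff_times Q k (pderiv_on Q b g)"
        using smooth_pderiv_on[OF g, of b] by (simp add: smooth_def)
      have "diff_times Q k (\<lambda>x. - (inverse (g x) * pderiv_on Q b g x * inverse (g x)))"
        by (intro diff_times_linear[OF bounded_linear_minus[OF bounded_linear_ident]]
            diff_times_bilinear[OF bounded_bilinear_mult] Suc p)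
      then show ?thesis by (simp only: diff_times_cong[OF pderiv_on_eq[OF d]])
    qed
    with diff show ?case by simp
  qed (use diff in auto)
  then show ?thesis unfolding smooth_def by blast
qed

end

section \<open>Symmetry of mixed derivatives and the topology on smooth maps\<close>

context smooth_domain
begin

lemma line_has_derivative:
  fixes g :: "'a \<Rightarrow> real"
  assumes "smooth Q g" "x + s *\<^sub>R v \<in> interior Q"
  shows "((\<lambda>s. g (x + s *\<^sub>R v)) has_field_derivative pderiv_on Q v g (x + s *\<^sub>R v)) (at s)"
proof -
  have Q: "x + s *\<^sub>R v \<in> Q" using assms(2) interior_subset by blast
  have 1: "(g has_derivative (\<lambda>u. pderiv_on Q u g (x + s *\<^sub>R v))) (at (x + s *\<^sub>R v))"
    using pderiv_on_works[OF smooth_differentiable[OF assms(1)] Q] at_within_interior[OF assms(2)] by simp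
  have 2: "((\<lambda>s. x + s *\<^sub>R v) has_derivative (\<lambda>h. h *\<^sub>R v)) (at s)"
    by (auto intro!: derivative_eq_intros)
  interpret bounded_linear "\<lambda>u. pderiv_on Q u g (x + s *\<^sub>R v)"
    using 1 has_derivative_bounded_linear by blast
  show ?thesis
    using has_derivative_compose[OF 2 1] by (simp add: has_field_derivative_def scaleR mult_commute_abs)
qed

text \<open>Two applications of the mean value theorem, first along \<open>u\<close> to the
  difference in direction \<open>v\<close>, then along \<open>v\<close>. The slack \<open>d\<close>
  keeps the closed parallelogram inside the open ball.\<close>

lemma second_difference_mean_value:
  fixes g :: "'a \<Rightarrow> real"
  assumes g: "smooth Q g" and h: "h > 0" and ball: "ball x (h * (norm u + norm v) + d) \<subseteq> interior Q" "d > 0"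
  shows "\<exists>z. dist x z \<le> h * (norm u + norm v) \<and>
    g (x + h *\<^sub>R u + h *\<^sub>R v) - g (x + h *\<^sub>R u) - g (x + h *\<^sub>R v) + g x = h\<^sup>2 * pderiv_on Q v (pderiv_on Q u g) z"
proof -
  have dist: "dist x (x + s *\<^sub>R u + t *\<^sub>R v) \<le> h * (norm u + norm v)" if "0 \<le> s" "s \<le> h" "0 \<le> t" "t \<le> h" for s t
  proof -
    have "norm (s *\<^sub>R u + t *\<^sub>R v) \<le> s * norm u + t * norm v"
      using that by (metis abs_of_nonneg norm_scaleR norm_triangle_ineq)
    also have "\<dots> \<le> h * norm u + h * norm v" using that by (intro add_mono mult_right_mono) auto
    finally show ?thesis by (simp add: dist_norm algebra_simps norm_minus_commute)
  qed
  have inQ: "x + s *\<^sub>R u + t *\<^sub>R v \<in> interior Q" if "0 \<le> s" "s \<le> h" "0 \<le> t" "t \<le> h" for s t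
    using dist[OF that] ball by (intro subsetD[OF ball(1)]) simp
  define \<phi> where "\<phi> s = g ((x + h *\<^sub>R v) + s *\<^sub>R u) - g (x + s *\<^sub>R u)" for s
  have "\<exists>s. 0 < s \<and> s < h \<and> \<phi> h - \<phi> 0 = (h - 0) * (pderiv_on Q u g ((x + h *\<^sub>R v) + s *\<^sub>R u) - pderiv_on Q u g (x + s *\<^sub>R u))"
    unfolding \<phi>_def
  proof (intro MVT2 h DERIV_diff line_has_derivative g)
    fix s assume s: "0 \<le> s" "s \<le> h"
    show "x + h *\<^sub>R v + s *\<^sub>R u \<in> interior Q" using inQ[OF s, of h] h by (simp add: algebra_simps)
    show "x + s *\<^sub>R u \<in> interior Q" using inQ[OF s, of 0] h by simp
  qed
  then obtain s where s: "0 < s" "s < h" 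
    "\<phi> h - \<phi> 0 = h * (pderiv_on Q u g ((x + h *\<^sub>R v) + s *\<^sub>R u) - pderiv_on Q u g (x + s *\<^sub>R u))" by auto
  have "\<exists>t. 0 < t \<and> t < h \<and> pderiv_on Q u g ((x + s *\<^sub>R u) + h *\<^sub>R v) - pderiv_on Q u g ((x + s *\<^sub>R u) + 0 *\<^sub>R v)
     = (h - 0) * pderiv_on Q v (pderiv_on Q u g) ((x + s *\<^sub>R u) + t *\<^sub>R v)"
  proof (intro MVT2 h line_has_derivative smooth_pderiv_on g)
    fix t assume t: "0 \<le> t" "t \<le> h"
    show "x + s *\<^sub>R u + t *\<^sub>R v \<in> interior Q" using inQ s t by simp
  qed
  then obtain t where t: "0 < t" "t < h" 
    "pderiv_on Q u g (x + h *\<^sub>R v + s *\<^sub>R u) - pderiv_on Q u g (x + s *\<^sub>R u)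
     = h * pderiv_on Q v (pderiv_on Q u g) (x + s *\<^sub>R u + t *\<^sub>R v)" by (auto simp: algebra_simps)
  have "g (x + h *\<^sub>R u + h *\<^sub>R v) - g (x + h *\<^sub>R u) - g (x + h *\<^sub>R v) + g x = \<phi> h - \<phi> 0"
    by (simp add: \<phi>_def algebra_simps)
  also have "\<dots> = h\<^sup>2 * pderiv_on Q v (pderiv_on Q u g) (x + s *\<^sub>R u + t *\<^sub>R v)"
    unfolding s(3) t(3) by (simp add: power2_eq_square)
  finally show ?thesis using dist[of s t] s t by (intro exI[of _ "x + s *\<^sub>R u + t *\<^sub>R v"]) auto
qed

text \<open>The second difference is symmetric in \<open>u\<close> and \<open>v\<close>, so each
  mixed derivative takes the same value at some point near \<open>x\<close>; continuity excludes a
  gap at \<open>x\<close>. The choice of \<open>h\<close> keeps both points within \<open>d\<close>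
  of \<open>x\<close>.\<close>

lemma pderiv_on_commute_real_interior:
  fixes g :: "'a \<Rightarrow> real"
  assumes g: "smooth Q g" and x: "x \<in> interior Q"
  shows "pderiv_on Q u (pderiv_on Q v g) x = pderiv_on Q v (pderiv_on Q u g) x" (is "?p x = ?q x")
proof (rule ccontr)
  assume neq: "?p x \<noteq> ?q x"
  define e where "e = \<bar>?p x - ?q x\<bar> / 2"
  have e: "e > 0" using neq unfolding e_def by simp
  have xQ: "x \<in> Q" using x interior_subset by blast
  have "continuous_on Q ?p" "continuous_on Q ?q"
    using g by (auto intro!: smooth_continuous_on smooth_pderiv_on)
  then obtain d1 d2 where d: "d1 > 0" "\<And>z. z \<in> Q \<Longrightarrow> dist z x < d1 \<Longrightarrow> dist (?p z) (?p x) < e"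
    "d2 > 0" "\<And>z. z \<in> Q \<Longrightarrow> dist z x < d2 \<Longrightarrow> dist (?q z) (?q x) < e"
    unfolding continuous_on_iff using e xQ by metis
  obtain d3 where d3: "d3 > 0" "ball x d3 \<subseteq> interior Q"
    using x open_contains_ball open_interior by blast
  define d where "d = min d1 (min d2 d3) / 2"
  have d0: "d > 0" "d < d1" "d < d2" "2 * d \<le> d3" unfolding d_def using d d3 by auto
  define h where "h = d / (norm u + norm v + 1)"
  have h: "h > 0" unfolding h_def using d0 by (simp add: add_nonneg_pos)
  have hd: "h * (norm u + norm v) \<le> d" 
  proof -
    have "0 < norm u + norm v + 1" by (simp add: add_nonneg_pos)
    then show ?thesis unfolding h_def using d0 by (simp add: pos_divide_le_eq algebra_simps)
  qed
  have ball: "ball x (h * (norm u + norm v) + d) \<subseteq> interior Q"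
    using hd d0 d3(2) by (smt (verit) mem_ball subset_iff)
  obtain z where z: "dist x z \<le> h * (norm u + norm v)"
    "g (x + h *\<^sub>R u + h *\<^sub>R v) - g (x + h *\<^sub>R u) - g (x + h *\<^sub>R v) + g x = h\<^sup>2 * ?q z"
    using second_difference_mean_value[OF g h ball d0(1)] by blast
  have ball': "ball x (h * (norm v + norm u) + d) \<subseteq> interior Q" using ball by (simp add: add.commute)
  obtain z' where z': "dist x z' \<le> h * (norm v + norm u)"
    "g (x + h *\<^sub>R v + h *\<^sub>R u) - g (x + h *\<^sub>R v) - g (x + h *\<^sub>R u) + g x = h\<^sup>2 * ?p z'"
    using second_difference_mean_value[OF g h ball' d0(1)] by blast
  have "h\<^sup>2 * ?q z = h\<^sup>2 * ?p z'"
    using z(2) z'(2) by (simp add: algebra_simps)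
  then have "?q z = ?p z'" using h by simp
  have "z \<in> Q" "z' \<in> Q"
    using z(1) z'(1) d0 by (auto intro!: subsetD[OF interior_subset[of Q]] subsetD[OF ball] simp: add.commute)
  moreover have "dist z x < d2" "dist z' x < d1" using z(1) z'(1) hd d0 by (auto simp: dist_commute add.commute)
  ultimately have "dist (?p z') (?p x) < e" "dist (?q z) (?q x) < e" using d by auto
  then show False using \<open>?q z = ?p z'\<close> unfolding e_def dist_real_def
    by (simp add: abs_if field_simps split: if_splits)
qed

text \<open>Vector values reduce to real ones by pairing with a fixed vector, boundary points to
  interior ones by continuity, the interior being dense in a convex body.\<close>

lemma pderiv_on_commute:
  fixes f :: "'a \<Rightarrow> 'b::real_inner"
  assumes f: "smooth Q f" and x: "x \<in> Q"
  shows "pderiv_on Q u (pderiv_on Q v f) x = pderiv_on Q v (pderiv_on Q u f) x" (is "?p x = ?q x")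
proof -
  have int: "?p z = ?q z" if z: "z \<in> interior Q" for z
  proof -
    have zQ: "z \<in> Q" using z interior_subset by blast
    have "c \<bullet> ?p z = c \<bullet> ?q z" for c
    proof -
      have sm: "smooth Q (\<lambda>x. c \<bullet> f x)" by (rule smooth_linear[OF bounded_linear_inner_right f])
      have 1: "pderiv_on Q a (\<lambda>x. c \<bullet> f x) y = c \<bullet> pderiv_on Q a f y" if "y \<in> Q" for a y
        by (rule pderiv_on_linear[OF bounded_linear_inner_right smooth_differentiable[OF f] that])
      have "pderiv_on Q a (pderiv_on Q a' (\<lambda>x. c \<bullet> f x)) z = c \<bullet> pderiv_on Q a (pderiv_on Q a' f) z" for a a'
        by (subst pderiv_on_cong[OF 1])
          (auto intro!: zQ pderiv_on_linear bounded_linear_inner_right smooth_differentiable smooth_pderiv_on f)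
      then show ?thesis using pderiv_on_commute_real_interior[OF sm z, of u v] by metis
    qed
    then show ?thesis using vector_eq_ldot by blast
  qed
  have "x \<in> closure (interior Q)"
    using convex_closure_interior[OF convex interior] x closure_subset by blast
  then obtain xs where xs: "\<And>n. xs n \<in> interior Q" "xs \<longlonglongrightarrow> x" unfolding closure_sequential by blast
  have "xs n \<in> Q" for n using xs(1) interior_subset by blast
  moreover have "continuous_on Q ?p" "continuous_on Q ?q"
    using f by (auto intro!: smooth_continuous_on smooth_pderiv_on)
  ultimately have "(\<lambda>n. ?p (xs n)) \<longlonglongrightarrow> ?p x" "(\<lambda>n. ?q (xs n)) \<longlonglongrightarrow> ?q x"
    using x xs(2) unfolding continuous_on_sequentially o_def by auto
  then show ?thesis using int[OF xs(1)] LIMSEQ_unique by simp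
qed

section \<open>The \<open>C^r\<close> norms and the Frechet topology\<close>

lemma C_norm_ge:
  assumes "smooth Q f" "set bs \<subseteq> Basis" "length bs \<le> r" "x \<in> Q"
  shows "norm (pderivs_on Q bs f x) \<le> C_norm Q r f"
proof -
  obtain B where B: "\<And>x. x \<in> Q \<Longrightarrow> norm (pderivs_on Q bs f x) \<le> B"
    using smooth_bounded[OF smooth_pderivs_on[OF assms(1)]] by metis
  have "norm (pderivs_on Q bs f x) \<le> (SUP q\<in>Q. norm (pderivs_on Q bs f q))"
    using B assms(4) by (intro cSUP_upper bdd_aboveI) auto
  also have "\<dots> \<le> C_norm Q r f"
    unfolding C_norm_def by (rule Max_ge) (use assms finite_lists_length_le[of Basis r] in auto)
  finally show ?thesis .
qed

lemma C_norm_le: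
  assumes "\<And>bs x. set bs \<subseteq> Basis \<Longrightarrow> length bs \<le> r \<Longrightarrow> x \<in> Q \<Longrightarrow> norm (pderivs_on Q bs f x) \<le> c"
  shows "C_norm Q r f \<le> c"
proof -
  have "Q \<noteq> {}" using interior by auto
  have fin: "finite {bs. set bs \<subseteq> (Basis::'a set) \<and> length bs \<le> r}" using finite_lists_length_le[of Basis r] by auto
  have ne: "{bs. set bs \<subseteq> (Basis::'a set) \<and> length bs \<le> r} \<noteq> {}" by (intro ex_in_conv[THEN iffD1] exI[of _ "[]"]) simp
  then show ?thesis
    unfolding C_norm_def using fin ne assms \<open>Q \<noteq> {}\<close>
    by (subst Max_le_iff) (auto intro!: cSUP_least)
qed

lemma C_norm_triangle:
  assumes "smooth Q f" "smooth Q g" "smooth Q h"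
  shows "C_norm Q r (\<lambda>x. f x - h x) \<le> C_norm Q r (\<lambda>x. f x - g x) + C_norm Q r (\<lambda>x. g x - h x)"
proof (rule C_norm_le)
  fix bs :: "'a list" and x assume *: "set bs \<subseteq> Basis" "length bs \<le> r" "x \<in> Q"
  have "norm (pderivs_on Q bs (\<lambda>x. f x - h x) x)
    = norm (pderivs_on Q bs (\<lambda>x. f x - g x) x + pderivs_on Q bs (\<lambda>x. g x - h x) x)"
    using assms * by (simp add: pderivs_on_diff)
  also have "\<dots> \<le> C_norm Q r (\<lambda>x. f x - g x) + C_norm Q r (\<lambda>x. g x - h x)"
    using assms * by (intro norm_triangle_le add_mono C_norm_ge smooth_diff) auto
  finally show "norm (pderivs_on Q bs (\<lambda>x. f x - h x) x) \<le> \<dots>" .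
qed

text \<open>The generating balls have arbitrary centres. A ball can be recentred at any of its
  points by the triangle inequality, and since the norms increase with \<open>r\<close>, a finite
  intersection contains a single ball.\<close>

lemma openin_C_infty_topology_D:
  assumes "openin (C_infty_topology Q) U" "X \<in> U"
  shows "X \<in> C_infty Q \<and> (\<exists>r \<epsilon>. \<epsilon> > 0 \<and> (\<forall>Z\<in>C_infty Q. C_norm Q r (\<lambda>q. Z q - X q) < \<epsilon> \<longrightarrow> Z \<in> U))"
proof -
  have "generate_topology_on {{Z \<in> C_infty Q. C_norm Q r (\<lambda>q. Z q - X q) < \<epsilon>} | X r \<epsilon>. X \<in> C_infty Q \<and> 0 < \<epsilon>} U"
    using assms(1) unfolding C_infty_topology_def openin_topology_generated_by_iff .
  then show ?thesis using assms(2)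
  proof (induction arbitrary: X rule: generate_topology_on.induct)
    case (Int a b)
    obtain r1 e1 where 1: "e1 > 0" "\<And>Z. Z\<in>C_infty Q \<Longrightarrow> C_norm Q r1 (\<lambda>q. Z q - X q) < e1 \<Longrightarrow> Z \<in> a"
      and X: "X \<in> C_infty Q" using Int by (metis IntD1)
    obtain r2 e2 where 2: "e2 > 0" "\<And>Z. Z\<in>C_infty Q \<Longrightarrow> C_norm Q r2 (\<lambda>q. Z q - X q) < e2 \<Longrightarrow> Z \<in> b"
      using Int by (metis IntD2)
    have mono: "C_norm Q r (\<lambda>q. Z q - X q) \<le> C_norm Q (max r1 r2) (\<lambda>q. Z q - X q)"
      if "r \<le> max r1 r2" "Z \<in> C_infty Q" for r and Z :: "'a \<Rightarrow> 'b"
      by (rule C_norm_le, rule C_norm_ge) (use that X in \<open>auto intro!: smooth_diff simp: C_infty_iff\<close>)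
    have "\<forall>Z\<in>C_infty Q. C_norm Q (max r1 r2) (\<lambda>q. Z q - X q) < min e1 e2 \<longrightarrow> Z \<in> a \<inter> b"
      using 1 2 mono[of r1] mono[of r2] by fastforce
    moreover have "min e1 e2 > 0" using 1(1) 2(1) by simp
    ultimately show ?case using X by blast
  next
    case (UN K)
    then show ?case by (meson UnionE UnionI)
  next
    case (Basis s)
    then obtain X0 r \<epsilon> where s: "s = {Z \<in> C_infty Q. C_norm Q r (\<lambda>q. Z q - X0 q) < \<epsilon>}" "X0 \<in> C_infty Q" "\<epsilon> > 0" by blast
    define e where "e = \<epsilon> - C_norm Q r (\<lambda>q. X q - X0 q)"
    have X: "X \<in> C_infty Q" "e > 0" using Basis s unfolding e_def by auto
    have "Z \<in> s" if "Z \<in> C_infty Q" "C_norm Q r (\<lambda>q. Z q - X q) < e" for Z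
      using C_norm_triangle[of Z X X0 r] that s X unfolding e_def s(1) by (auto simp: C_infty_iff)
    then show ?case using X by blast
  qed auto
qed

lemma openin_C_infty_ball:
  "X \<in> C_infty Q \<Longrightarrow> \<epsilon> > 0 \<Longrightarrow> openin (C_infty_topology Q) {Z \<in> C_infty Q. C_norm Q r (\<lambda>q. Z q - X q) < \<epsilon>}"
  unfolding C_infty_topology_def by (rule topology_generated_by_Basis) blast

lemma C_norm_zero_less: "0 < \<epsilon> \<Longrightarrow> C_norm Q r (\<lambda>q. X q - X q) < \<epsilon>"
proof -
  assume "0 < \<epsilon>"
  have "pderivs_on Q bs (\<lambda>_. 0 :: 'b) x = 0" if "x \<in> Q" for bs x
    using that pderivs_on_linear[OF smooth_const[of "0::'b"] bounded_linear_zero, of x bs] by simp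
  then have "C_norm Q r (\<lambda>_. 0 :: 'b) \<le> \<epsilon> / 2" using \<open>0 < \<epsilon>\<close> by (intro C_norm_le) simp
  then show ?thesis using \<open>0 < \<epsilon>\<close> by simp
qed

lemma openin_C_infty_topology_iff:
  "openin (C_infty_topology Q) U \<longleftrightarrow> U \<subseteq> C_infty Q \<and>
     (\<forall>X\<in>U. \<exists>r \<epsilon>. \<epsilon> > 0 \<and> (\<forall>Z\<in>C_infty Q. C_norm Q r (\<lambda>q. Z q - X q) < \<epsilon> \<longrightarrow> Z \<in> U))"
proof
  assume "openin (C_infty_topology Q) U"
  then show "U \<subseteq> C_infty Q \<and>
     (\<forall>X\<in>U. \<exists>r \<epsilon>. \<epsilon> > 0 \<and> (\<forall>Z\<in>C_infty Q. C_norm Q r (\<lambda>q. Z q - X q) < \<epsilon> \<longrightarrow> Z \<in> U))"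
    using openin_C_infty_topology_D by blast
next
  assume R: "U \<subseteq> C_infty Q \<and>
     (\<forall>X\<in>U. \<exists>r \<epsilon>. \<epsilon> > 0 \<and> (\<forall>Z\<in>C_infty Q. C_norm Q r (\<lambda>q. Z q - X q) < \<epsilon> \<longrightarrow> Z \<in> U))"
  show "openin (C_infty_topology Q) U"
  proof (subst openin_subopen, intro ballI)
    fix X assume X: "X \<in> U"
    then obtain r \<epsilon> where *: "\<epsilon> > 0" "\<forall>Z\<in>C_infty Q. C_norm Q r (\<lambda>q. Z q - X q) < \<epsilon> \<longrightarrow> Z \<in> U" using R by blast
    show "\<exists>T. openin (C_infty_topology Q) T \<and> X \<in> T \<and> T \<subseteq> U"
      using openin_C_infty_ball[of X \<epsilon> r] * X R C_norm_zero_less[OF *(1)]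
      by (intro exI[of _ "{Z \<in> C_infty Q. C_norm Q r (\<lambda>q. Z q - X q) < \<epsilon>}"]) auto
  qed
qed

lemma topspace_C_infty_topology: "topspace (C_infty_topology Q) = C_infty Q"
proof -
  have "openin (C_infty_topology Q) (C_infty Q)"
    unfolding openin_C_infty_topology_iff by (intro conjI subset_refl ballI exI[of _ 0] exI[of _ 1]) auto
  moreover have "topspace (C_infty_topology Q) \<subseteq> C_infty Q"
    using openin_C_infty_topology_iff[THEN iffD1, OF openin_topspace] by (rule conjunct1)
  ultimately show ?thesis using openin_subset by (intro antisym)
qed

end

section \<open>Matrix-valued maps and the curvature matrix\<close>

lemma matrix_inv_works:
  fixes A :: "real^'n^'n"
  assumes "det A \<noteq> 0"
  shows "A ** matrix_inv A = mat 1" "matrix_inv A ** A = mat 1"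
proof -
  have "\<exists>B. A ** B = mat 1 \<and> B ** A = mat 1"
    using assms invertible_det_nz[of A] unfolding invertible_def by blast
  then show "A ** matrix_inv A = mat 1" "matrix_inv A ** A = mat 1"
    unfolding matrix_inv_def by (metis (mono_tags, lifting) someI_ex)+
qed

lemma matrix_inv_unique_solution:
  fixes A :: "real^'n^'n"
  assumes "det A \<noteq> 0" "A ** C = B"
  shows "C = matrix_inv A ** B"
  using assms matrix_inv_works(2)[OF assms(1)] by (metis matrix_mul_assoc matrix_mul_lid)

text \<open>Cramer's rule exhibits the entries of the inverse as quotients of determinants;
  continuity and smoothness of \<open>matrix_inv\<close> both come from this form.\<close>

lemma matrix_inv_cramer:
  fixes A :: "real^'n^'n"
  assumes "det A \<noteq> 0"
  shows "matrix_inv A $ k $ l = det (\<chi> i j. if j = k then axis l 1 $ i else A $ i $ j) / det A"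
proof -
  have col: "(B *v axis l 1) $ i = B $ i $ l" for B :: "real^'n^'n" and i
    unfolding matrix_vector_mult_def axis_def
    by (simp add: if_distrib cong: if_cong)
  have "A *v (matrix_inv A *v axis l 1) = axis l 1"
    by (simp add: matrix_vector_mul_assoc matrix_inv_works(1)[OF assms])
  then have eq: "matrix_inv A *v axis l 1 = (\<chi> k. det (\<chi> i j. if j = k then axis l 1 $ i else A $ i $ j) / det A)"
    using cramer[OF assms] by blast
  have "matrix_inv A $ k $ l = (matrix_inv A *v axis l 1) $ k" by (simp only: col)
  then show ?thesis by (simp only: eq vec_lambda_beta)
qed

lemma bounded_bilinear_matrix_mult: "bounded_bilinear ((**) :: real^'n^'m \<Rightarrow> real^'p^'n \<Rightarrow> real^'p^'m)"
  unfolding bilinear_conv_bounded_bilinear[symmetric] bilinear_def linear_iff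
  by (auto simp: matrix_matrix_mult_def vec_eq_iff distrib_right distrib_left sum.distrib sum_distrib_left mult_ac)

lemmas continuous_on_matrix_mult [continuous_intros] =
  bounded_bilinear.continuous_on[OF bounded_bilinear_matrix_mult]

lemma continuous_on_det [continuous_intros]:
  fixes f :: "'a::topological_space \<Rightarrow> real^'n^'n"
  shows "continuous_on S f \<Longrightarrow> continuous_on S (\<lambda>x. det (f x))"
  unfolding det_def by (intro continuous_intros)

lemma continuous_on_matrix_entries:
  fixes f :: "'a::topological_space \<Rightarrow> real^'n^'m"
  assumes "\<And>i j. continuous_on S (\<lambda>x. f x $ i $ j)"
  shows "continuous_on S f"
proof -
  have "continuous_on S (\<lambda>x. \<chi> i. \<chi> j. f x $ i $ j)" by (intro continuous_on_vec_lambda assms)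
  then show ?thesis by simp
qed

lemma continuous_on_matrix_inv [continuous_intros]:
  fixes f :: "'a::topological_space \<Rightarrow> real^'n^'n"
  assumes f: "continuous_on S f" and nz: "\<And>x. x \<in> S \<Longrightarrow> det (f x) \<noteq> 0"
  shows "continuous_on S (\<lambda>x. matrix_inv (f x))"
proof (rule continuous_on_matrix_entries)
  fix k l :: 'n
  have "continuous_on S (\<lambda>x. (\<chi> i j. if j = k then axis l 1 $ i else f x $ i $ j) $ i $ j)" for i j
    by (cases "j = k") (auto intro!: continuous_intros f)
  then have "continuous_on S (\<lambda>x. det (\<chi> i j. if j = k then axis l 1 $ i else f x $ i $ j) / det (f x))"
    using nz by (intro continuous_on_divide continuous_on_det continuous_on_matrix_entries f) auto
  then show "continuous_on S (\<lambda>x. matrix_inv (f x) $ k $ l)"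
    by (rule continuous_on_eq) (simp add: matrix_inv_cramer nz)
qed

definition unit_matrix :: "'n \<Rightarrow> 'n \<Rightarrow> real^'n^'n" where
  "unit_matrix i j = (\<chi> k l. if k = i \<and> l = j then 1 else 0)"

lemma matrix_unit_sum: "(A::real^'n^'n) = (\<Sum>i\<in>UNIV. \<Sum>j\<in>UNIV. A $ i $ j *\<^sub>R unit_matrix i j)"
proof -
  have "(\<Sum>i\<in>UNIV. \<Sum>j\<in>UNIV. A $ i $ j * (if k = i \<and> l = j then 1 else 0)) = A $ k $ l" for k l
  proof -
    have "(\<Sum>j\<in>UNIV. A $ i $ j * (if k = i \<and> l = j then 1 else 0)) = (if k = i then A $ i $ l else 0)" for i
      by (cases "k = i") (auto simp: if_distrib cong: if_cong)
    then show ?thesis by simp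
  qed
  then show ?thesis by (simp add: vec_eq_iff unit_matrix_def)
qed

text \<open>Places a vector into column \<open>j\<close>. Jacobians become sums of bounded linear
  images of derivative vectors, so every rule for linear maps carries over to them.\<close>

definition column_matrix :: "'m \<Rightarrow> real^'n \<Rightarrow> real^'m^'n" where
  "column_matrix j v = (\<chi> i k. if k = j then v $ i else 0)"

lemma bounded_linear_column_matrix: "bounded_linear (column_matrix j :: real^'n::finite \<Rightarrow> real^'m::finite^'n)"
  unfolding linear_conv_bounded_linear[symmetric] linear_iff
  by (auto simp: column_matrix_def vec_eq_iff)

lemma column_matrix_sum: "(\<chi> i j. f j $ i) = (\<Sum>j\<in>UNIV. column_matrix j (f j))"
  by (simp add: vec_eq_iff column_matrix_def if_distrib cong: if_cong)

context smooth_domain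
begin

lemma smooth_component: "smooth Q f \<Longrightarrow> smooth Q (\<lambda>x. f x $ i)"
  by (rule smooth_linear[OF bounded_linear_vec_nth])

lemma smooth_matrix_entries:
  fixes f :: "'a \<Rightarrow> real^'n^'n"
  assumes "\<And>i j. smooth Q (\<lambda>x. f x $ i $ j)"
  shows "smooth Q f"
proof -
  have "smooth Q (\<lambda>x. \<Sum>i\<in>UNIV. \<Sum>j\<in>UNIV. f x $ i $ j *\<^sub>R unit_matrix i j)"
    by (intro smooth_sum smooth_scaleR smooth_const assms)
  then show ?thesis by (simp only: matrix_unit_sum[symmetric])
qed

lemma smooth_det:
  fixes f :: "'a \<Rightarrow> real^'n^'n"
  assumes "\<And>i j. smooth Q (\<lambda>x. f x $ i $ j)"
  shows "smooth Q (\<lambda>x. det (f x))"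
  unfolding det_def by (intro smooth_sum smooth_mult smooth_const smooth_prod assms)

lemma smooth_matrix_inv:
  fixes f :: "'a \<Rightarrow> real^'n^'n"
  assumes f: "smooth Q f" and nz: "\<And>x. x \<in> Q \<Longrightarrow> det (f x) \<noteq> 0"
  shows "smooth Q (\<lambda>x. matrix_inv (f x))"
proof (rule smooth_matrix_entries)
  fix k l :: 'n
  have e: "smooth Q (\<lambda>x. f x $ i $ j)" for i j by (intro smooth_component f)
  have "smooth Q (\<lambda>x. (\<chi> i j. if j = k then axis l 1 $ i else f x $ i $ j) $ i $ j)" for i j
    using e by (cases "j = k") (auto intro: smooth_const)
  then have "smooth Q (\<lambda>x. det (\<chi> i j. if j = k then axis l 1 $ i else f x $ i $ j) * inverse (det (f x)))"
    using nz e by (intro smooth_mult smooth_real_inverse smooth_det)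
  then show "smooth Q (\<lambda>x. matrix_inv (f x) $ k $ l)"
    by (subst smooth_cong) (auto simp: matrix_inv_cramer nz divide_inverse)
qed

lemma pderiv_on_sum:
  "(\<And>i. i \<in> A \<Longrightarrow> smooth Q (f i)) \<Longrightarrow> x \<in> Q \<Longrightarrow> pderiv_on Q v (\<lambda>x. \<Sum>i\<in>A. f i x) x = (\<Sum>i\<in>A. pderiv_on Q v (f i) x)"
  by (rule pderiv_on_eq[OF has_derivative_sum]) (auto intro: pderiv_on_works smooth_differentiable)

end

text \<open>The \<open>k\<close>-th time derivative of the Jacobian in the directions
  \<open>e\<close>. The head of a derivative list is applied last, so the time derivatives come
  after the one in direction \<open>e j\<close>.\<close>

definition jacobian :: "'m::finite pt set \<Rightarrow> ('m \<Rightarrow> 'm pt) \<Rightarrow> nat \<Rightarrow> ('m pt \<Rightarrow> real^'m) \<Rightarrow> 'm pt \<Rightarrow> real^'m^'m" where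
  "jacobian Q e k X q = (\<Sum>j\<in>UNIV. column_matrix j (pderivs_on Q (replicate k (0, 1, 0) @ [e j]) X q))"

abbreviation "dir_w \<equiv> \<lambda>j. (axis j 1, 0, 0)"
abbreviation "dir_y \<equiv> \<lambda>j. (0, 0, axis j 1)"

lemma grad_w_jacobian: "grad_w Q X = jacobian Q dir_w 0 X"
  unfolding grad_w_def jacobian_def by (simp add: fun_eq_iff column_matrix_sum)

lemma grad_y_jacobian: "grad_y Q X = jacobian Q dir_y 0 X"
  unfolding grad_y_def jacobian_def by (simp add: fun_eq_iff column_matrix_sum)

lemma dir_Basis [simp]: "(axis j 1, 0, 0) \<in> (Basis :: 'm::finite pt set)" "(0, 0, axis j 1) \<in> (Basis :: 'm pt set)" "(0, 1, 0) \<in> (Basis :: 'm pt set)"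
  by (auto simp: Basis_prod_def Basis_vec_def image_iff zero_prod_def)

text \<open>With \<open>A\<close>, \<open>B\<close> the Jacobians in \<open>w\<close> and
  \<open>y\<close> and \<open>A1\<close>, \<open>B1\<close>, \<open>A2\<close>, \<open>B2\<close>
  their time derivatives, \<open>curv0\<close>, \<open>curv1\<close>, \<open>curv2\<close> are the
  curvature matrix and its first two time derivatives. Being explicit functions of finitely many
  matrices, they are continuous where \<open>det A\<close> is nonzero.\<close>

definition curv0 :: "real^'m^'m \<Rightarrow> real^'m^'m \<Rightarrow> real^'m^'m" where
  "curv0 A B = matrix_inv A ** B"

definition curv1 :: "real^'m^'m \<Rightarrow> real^'m^'m \<Rightarrow> real^'m^'m \<Rightarrow> real^'m^'m \<Rightarrow> real^'m^'m" where
  "curv1 A B A1 B1 = matrix_inv A ** (B1 - A1 ** curv0 A B)"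

definition curv2 :: "real^'m^'m \<Rightarrow> real^'m^'m \<Rightarrow> real^'m^'m \<Rightarrow> real^'m^'m \<Rightarrow> real^'m^'m \<Rightarrow> real^'m^'m \<Rightarrow> real^'m^'m" where
  "curv2 A B A1 B1 A2 B2 = matrix_inv A ** (B2 - 2 *\<^sub>R (A1 ** curv1 A B A1 B1) - A2 ** curv0 A B)"

locale pt_domain = smooth_domain Q for Q :: "'m::finite pt set"
begin

lemma smooth_jacobian: "smooth Q X \<Longrightarrow> smooth Q (jacobian Q e k X)"
  unfolding jacobian_def
  by (intro smooth_sum smooth_linear[OF bounded_linear_column_matrix] smooth_pderivs_on)

lemma deriv_t_jacobian:
  assumes "smooth Q X" "q \<in> Q"
  shows "deriv_t Q (jacobian Q e k X) q = jacobian Q e (Suc k) X q"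
proof -
  have s: "smooth Q (pderivs_on Q (replicate k (0, 1, 0) @ [e j]) X)" for j
    using assms by (intro smooth_pderivs_on)
  have "pderiv_on Q (0, 1, 0) (\<lambda>q. column_matrix j (pderivs_on Q (replicate k (0, 1, 0) @ [e j]) X q)) q
    = column_matrix j (pderivs_on Q (replicate (Suc k) (0, 1, 0) @ [e j]) X q)" for j
    unfolding replicate_Suc append_Cons pderivs_on.simps
    by (rule pderiv_on_linear[OF bounded_linear_column_matrix smooth_differentiable[OF s] assms(2)])
  then show ?thesis
    unfolding deriv_t_def jacobian_def
    by (subst pderiv_on_sum) (auto intro!: smooth_linear[OF bounded_linear_column_matrix] s assms simp del: replicate_Suc)
qed

lemma jacobian_diff:
  assumes "smooth Q X" "smooth Q Z" "q \<in> Q"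
  shows "jacobian Q e k (\<lambda>q. Z q - X q) q = jacobian Q e k Z q - jacobian Q e k X q"
  unfolding jacobian_def sum_subtractf[symmetric]
  using assms by (simp add: pderivs_on_diff bounded_linear.linear[OF bounded_linear_column_matrix] linear_diff del: pderivs_on.simps)

text \<open>The entries are derivatives of order \<open>k + 1\<close>, whence
  \<open>Suc k \<le> r\<close>. This is why order \<open>2\<close> controls Hoermander's condition
  and order \<open>3\<close> Bourgain's.\<close>

lemma jacobian_close:
  assumes e: "\<And>j. e j \<in> Basis"
  obtains K where "K > 0" "\<And>X Z q k r. smooth Q X \<Longrightarrow> smooth Q Z \<Longrightarrow> q \<in> Q \<Longrightarrow> Suc k \<le> r \<Longrightarrow>
    dist (jacobian Q e k Z q) (jacobian Q e k X q) \<le> K * C_norm Q r (\<lambda>q. Z q - X q)"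
proof -
  obtain K where K: "\<And>j. K j > 0" "\<And>j v. norm (column_matrix j v :: real^'m^'m) \<le> norm v * K j"
    using bounded_linear.pos_bounded[OF bounded_linear_column_matrix] by metis
  show ?thesis
  proof (rule that)
    show "(\<Sum>j\<in>UNIV. K j) > 0" using K(1) by (intro sum_pos) auto
    fix X Z :: "'m pt \<Rightarrow> real^'m" and q k r assume *: "smooth Q X" "smooth Q Z" "q \<in> Q" "Suc k \<le> r"
    have s: "smooth Q (\<lambda>q. Z q - X q)" using * by (intro smooth_diff)
    have "norm (column_matrix j (pderivs_on Q (replicate k (0, 1, 0) @ [e j]) (\<lambda>q. Z q - X q) q) :: real^'m^'m)
      \<le> K j * C_norm Q r (\<lambda>q. Z q - X q)" for j
    proof -
      have "norm (pderivs_on Q (replicate k (0, 1, 0) @ [e j]) (\<lambda>q. Z q - X q) q) \<le> C_norm Q r (\<lambda>q. Z q - X q)"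
        using * e by (intro C_norm_ge s) auto
      then have "norm (pderivs_on Q (replicate k (0, 1, 0) @ [e j]) (\<lambda>q. Z q - X q) q) * K j \<le> C_norm Q r (\<lambda>q. Z q - X q) * K j"
        using K(1)[of j] by (intro mult_right_mono) auto
      then show ?thesis using order_trans[OF K(2)] by (simp only: mult.commute)
    qed
    then show "dist (jacobian Q e k Z q) (jacobian Q e k X q) \<le> (\<Sum>j\<in>UNIV. K j) * C_norm Q r (\<lambda>q. Z q - X q)"
      unfolding dist_norm jacobian_diff[OF *(1-3), symmetric] sum_distrib_right
      unfolding jacobian_def by (intro sum_norm_le)
  qed
qed

text \<open>Differentiating \<open>A 0 ** C = B 0\<close> once and twice in time and solving for the
  derivative of \<open>C\<close> avoids a formula for the derivative of
  \<open>matrix_inv\<close>.\<close>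

lemma curv_eqs:
  assumes X: "smooth Q X" and nz: "\<And>q. q \<in> Q \<Longrightarrow> det (grad_w Q X q) \<noteq> 0"
  defines "A \<equiv> \<lambda>k. jacobian Q dir_w k X" and "B \<equiv> \<lambda>k. jacobian Q dir_y k X"
  shows "smooth Q (curv_matrix Q X)"
    "smooth Q (deriv_t Q (curv_matrix Q X))"
    "smooth Q (deriv_t Q (deriv_t Q (curv_matrix Q X)))"
    "q \<in> Q \<Longrightarrow> curv_matrix Q X q = curv0 (A 0 q) (B 0 q)"
    "q \<in> Q \<Longrightarrow> deriv_t Q (curv_matrix Q X) q = curv1 (A 0 q) (B 0 q) (A 1 q) (B 1 q)"
    "q \<in> Q \<Longrightarrow> deriv_t Q (deriv_t Q (curv_matrix Q X)) q = curv2 (A 0 q) (B 0 q) (A 1 q) (B 1 q) (A 2 q) (B 2 q)"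
proof -
  let ?C = "curv_matrix Q X"
  have nz': "\<And>q. q \<in> Q \<Longrightarrow> det (A 0 q) \<noteq> 0" using nz by (simp add: A_def grad_w_jacobian)
  have sA: "smooth Q (A k)" and sB: "smooth Q (B k)" for k
    unfolding A_def B_def by (auto intro: smooth_jacobian X)
  show sC: "smooth Q ?C"
    unfolding curv_matrix_def grad_w_jacobian grad_y_jacobian
    using nz by (intro smooth_bilinear[OF bounded_bilinear_matrix_mult] smooth_matrix_inv smooth_jacobian X)
       (simp add: grad_w_jacobian)
  show sC1: "smooth Q (deriv_t Q ?C)" using smooth_pderiv_on[OF sC] unfolding deriv_t_def .
  show sC2: "smooth Q (deriv_t Q (deriv_t Q ?C))" using smooth_pderiv_on[OF sC1] unfolding deriv_t_def .
  have d: "deriv_t Q (A k) q = A (Suc k) q" "deriv_t Q (B k) q = B (Suc k) q" if "q \<in> Q" for k q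
    unfolding A_def B_def using deriv_t_jacobian X that by blast+
  have prod: "deriv_t Q (\<lambda>q. F q ** G q) q = F q ** deriv_t Q G q + deriv_t Q F q ** G q"
    if "smooth Q F" "smooth Q G" "q \<in> Q" for F G :: "'m pt \<Rightarrow> real^'m^'m" and q
    unfolding deriv_t_def
    by (rule pderiv_on_bilinear[OF bounded_bilinear_matrix_mult]) (auto intro: smooth_differentiable that)
  show c0: "?C q = curv0 (A 0 q) (B 0 q)" if "q \<in> Q" for q
    unfolding curv_matrix_def curv0_def A_def B_def grad_w_jacobian grad_y_jacobian ..
  have AC: "A 0 q ** ?C q = B 0 q" if "q \<in> Q" for q
    unfolding c0[OF that] curv0_def by (simp add: matrix_mul_assoc matrix_inv_works nz' that)
  have AC1: "A 0 q ** deriv_t Q ?C q + A 1 q ** ?C q = B 1 q" if q: "q \<in> Q" for q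
  proof -
    have "deriv_t Q (\<lambda>q. A 0 q ** ?C q) q = deriv_t Q (B 0) q"
      unfolding deriv_t_def by (rule pderiv_on_cong[OF AC q])
    then show ?thesis using prod[OF sA sC q, of 0] d[OF q] by simp
  qed
  show c1: "deriv_t Q ?C q = curv1 (A 0 q) (B 0 q) (A 1 q) (B 1 q)" if "q \<in> Q" for q
    unfolding curv1_def c0[OF that, symmetric]
    using AC1[OF that] by (intro matrix_inv_unique_solution nz' that) (simp add: algebra_simps)
  have AC2: "(A 0 q ** deriv_t Q (deriv_t Q ?C) q + A 1 q ** deriv_t Q ?C q) + (A 1 q ** deriv_t Q ?C q + A 2 q ** ?C q) = B 2 q"
    if q: "q \<in> Q" for q
  proof -
    have "deriv_t Q (\<lambda>q. A 0 q ** deriv_t Q ?C q + A 1 q ** ?C q) q = deriv_t Q (B 1) q"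
      unfolding deriv_t_def by (rule pderiv_on_cong[OF AC1[unfolded deriv_t_def] q])
    moreover have "deriv_t Q (\<lambda>q. A 0 q ** deriv_t Q ?C q + A 1 q ** ?C q) q
      = deriv_t Q (\<lambda>q. A 0 q ** deriv_t Q ?C q) q + deriv_t Q (\<lambda>q. A 1 q ** ?C q) q"
      unfolding deriv_t_def
      by (rule pderiv_on_add)
        (auto intro!: q smooth_differentiable smooth_bilinear[OF bounded_bilinear_matrix_mult] sA sC sC1[unfolded deriv_t_def])
    ultimately show ?thesis using prod[OF sA sC1 q, of 0] prod[OF sA sC q, of 1] d[OF q, of 0] d[OF q, of 1]
      by (simp add: numeral_2_eq_2)
  qed
  show "deriv_t Q (deriv_t Q ?C) q = curv2 (A 0 q) (B 0 q) (A 1 q) (B 1 q) (A 2 q) (B 2 q)" if "q \<in> Q" for q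
    unfolding curv2_def c0[OF that, symmetric] c1[OF that, symmetric]
    using AC2[OF that] by (intro matrix_inv_unique_solution nz' that) (simp add: algebra_simps scaleR_2)
qed

end

section \<open>Stability of Hoermander's and Bourgain's conditions\<close>

context smooth_domain
begin

lemma C_norm_cong: "(\<And>x. x \<in> Q \<Longrightarrow> f x = g x) \<Longrightarrow> C_norm Q r f = C_norm Q r g"
  unfolding C_norm_def using pderivs_on_cong[of Q f g] by (simp cong: SUP_cong)

lemma C_norm_scaleR_le:
  assumes "smooth Q f" shows "C_norm Q r (\<lambda>q. s *\<^sub>R f q) \<le> \<bar>s\<bar> * C_norm Q r f"
  by (rule C_norm_le)
    (auto simp: pderivs_on_linear[OF assms bounded_linear_scaleR_right] intro!: mult_left_mono C_norm_ge assms)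

lemma small_perturbation:
  assumes X: "X \<in> C_infty Q" and h: "smooth Q h" and \<epsilon>: "\<epsilon> > 0"
  obtains s where "s > 0" "restrict (\<lambda>q. X q + s *\<^sub>R h q) Q \<in> C_infty Q"
    "C_norm Q r (\<lambda>q. restrict (\<lambda>q. X q + s *\<^sub>R h q) Q q - X q) < \<epsilon>"
proof
  define s where "s = \<epsilon> / (\<bar>C_norm Q r h\<bar> + 1)"
  show s: "s > 0" using \<epsilon> unfolding s_def by (simp add: add_nonneg_pos)
  let ?Z = "restrict (\<lambda>q. X q + s *\<^sub>R h q) Q"
  have "smooth Q (\<lambda>q. X q + s *\<^sub>R h q)"
    using X by (intro smooth_add smooth_scaleR_const h) (simp add: C_infty_iff)
  then have "smooth Q ?Z" by (simp only: smooth_cong[of Q ?Z "\<lambda>q. X q + s *\<^sub>R h q"] restrict_apply' cong: if_cong)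
  then show "?Z \<in> C_infty Q" by (simp add: C_infty_iff)
  have "C_norm Q r (\<lambda>q. ?Z q - X q) = C_norm Q r (\<lambda>q. s *\<^sub>R h q)"
    by (rule C_norm_cong) simp
  also have "\<dots> \<le> \<bar>s\<bar> * C_norm Q r h" by (rule C_norm_scaleR_le[OF h])
  also have "\<dots> \<le> s * \<bar>C_norm Q r h\<bar>" using s by (simp add: mult_left_mono)
  also have "\<dots> < \<epsilon>" using \<epsilon> unfolding s_def by (simp add: field_simps)
  finally show "C_norm Q r (\<lambda>q. ?Z q - X q) < \<epsilon>" .
qed

end

text \<open>This is \<open>|u|^2\<close> times the component of \<open>v\<close> orthogonal to
  \<open>u\<close>. It turns the existence of the factor in Bourgain's condition into the vanishing
  of a continuous function.\<close>

definition parallel_defect :: "'a::real_inner \<Rightarrow> 'a \<Rightarrow> 'a" where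
  "parallel_defect u v = (u \<bullet> u) *\<^sub>R v - (u \<bullet> v) *\<^sub>R u"

lemma parallel_defect_eq_0:
  assumes "u \<noteq> 0" shows "parallel_defect u v = 0 \<longleftrightarrow> (\<exists>l. v = l *\<^sub>R u)"
proof
  assume "parallel_defect u v = 0"
  then have "(u \<bullet> u) *\<^sub>R v = (u \<bullet> v) *\<^sub>R u" by (simp add: parallel_defect_def)
  then have "v = ((u \<bullet> v) / (u \<bullet> u)) *\<^sub>R u"
    using assms by (metis divideR_right inner_eq_zero_iff scaleR_scaleR divide_inverse_commute)
  then show "\<exists>l. v = l *\<^sub>R u" by blast
qed (auto simp: parallel_defect_def)

lemma dist_Pair_le: "dist (a, b) (c, d) \<le> dist a c + dist b d"
  unfolding dist_Pair_Pair using sqrt_sum_squares_le_sum_abs[of "dist a c" "dist b d"] by simp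

lemma det_nonzero_imp_nonzero: "det (A::real^'n^'n) \<noteq> 0 \<Longrightarrow> A \<noteq> 0"
  using det_0[where 'a=real and 'n='n] by auto

text \<open>\<open>curv2\<close> is affine in its last argument, so a perturbation seen only by the
  second time derivative of the \<open>y\<close>-Jacobian has an explicit effect.\<close>

lemma curv2_add:
  "curv2 A B A1 B1 A2 (B2 + s *\<^sub>R V) = curv2 A B A1 B1 A2 B2 + s *\<^sub>R (matrix_inv A ** V)"
proof -
  have "B2 + s *\<^sub>R V - P - R = (B2 - P - R) + s *\<^sub>R V" for P R by simp
  then show ?thesis
    by (simp only: curv2_def matrix_add_ldistrib matrix_scalar_ac scalar_matrix_assoc[symmetric])
qed

lemma continuous_on_curv:
  fixes A :: "'a::topological_space \<Rightarrow> real^'m^'m"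
  assumes "continuous_on S A" "continuous_on S B" "continuous_on S A1" "continuous_on S B1"
    and "\<And>x. x \<in> S \<Longrightarrow> det (A x) \<noteq> 0"
  shows "continuous_on S (\<lambda>x. curv1 (A x) (B x) (A1 x) (B1 x))"
    "continuous_on S A2 \<Longrightarrow> continuous_on S B2 \<Longrightarrow> continuous_on S (\<lambda>x. curv2 (A x) (B x) (A1 x) (B1 x) (A2 x) (B2 x))"
  using assms unfolding curv2_def curv1_def curv0_def by (auto intro!: continuous_intros)

context pt_domain
begin

lemma hormanderD:
  assumes "X \<in> hormander Q"
  shows "smooth Q X" "\<And>q. q \<in> Q \<Longrightarrow> det (grad_w Q X q) \<noteq> 0"
    "\<And>q. q \<in> Q \<Longrightarrow> det (jacobian Q dir_w 0 X q) \<noteq> 0"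
    "\<And>q. q \<in> Q \<Longrightarrow> det (deriv_t Q (curv_matrix Q X) q) \<noteq> 0"
  using assms unfolding hormander_def by (auto simp: C_infty_iff grad_w_jacobian)

lemma hormander_curv:
  assumes "X \<in> hormander Q" "q \<in> Q"
  shows "deriv_t Q (curv_matrix Q X) q = curv1 (jacobian Q dir_w 0 X q) (jacobian Q dir_y 0 X q)
      (jacobian Q dir_w 1 X q) (jacobian Q dir_y 1 X q)"
    "deriv_t Q (deriv_t Q (curv_matrix Q X)) q = curv2 (jacobian Q dir_w 0 X q) (jacobian Q dir_y 0 X q)
      (jacobian Q dir_w 1 X q) (jacobian Q dir_y 1 X q) (jacobian Q dir_w 2 X q) (jacobian Q dir_y 2 X q)"
  using assms curv_eqs(5,6)[OF hormanderD(1,2)[OF assms(1)]] by blast+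

lemma jacobians_close:
  obtains K where "K > 0" "\<And>X Z q k r. smooth Q X \<Longrightarrow> smooth Q Z \<Longrightarrow> q \<in> Q \<Longrightarrow> Suc k \<le> r \<Longrightarrow>
    dist (jacobian Q dir_w k Z q) (jacobian Q dir_w k X q) \<le> K * C_norm Q r (\<lambda>q. Z q - X q) \<and>
    dist (jacobian Q dir_y k Z q) (jacobian Q dir_y k X q) \<le> K * C_norm Q r (\<lambda>q. Z q - X q)"
proof -
  obtain K1 where K1: "K1 > 0" "\<And>X Z q k r. smooth Q X \<Longrightarrow> smooth Q Z \<Longrightarrow> q \<in> Q \<Longrightarrow> Suc k \<le> r \<Longrightarrow>
    dist (jacobian Q dir_w k Z q) (jacobian Q dir_w k X q) \<le> K1 * C_norm Q r (\<lambda>q. Z q - X q)"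
    by (rule jacobian_close[of dir_w]) auto
  obtain K2 where K2: "K2 > 0" "\<And>X Z q k r. smooth Q X \<Longrightarrow> smooth Q Z \<Longrightarrow> q \<in> Q \<Longrightarrow> Suc k \<le> r \<Longrightarrow>
    dist (jacobian Q dir_y k Z q) (jacobian Q dir_y k X q) \<le> K2 * C_norm Q r (\<lambda>q. Z q - X q)"
    by (rule jacobian_close[of dir_y]) auto
  show ?thesis
  proof (rule that[of "max K1 K2"])
    fix X Z :: "'m pt \<Rightarrow> real^'m" and q k r assume *: "smooth Q X" "smooth Q Z" "q \<in> Q" "Suc k \<le> r"
    have "0 \<le> C_norm Q r (\<lambda>q. Z q - X q)"
      by (rule order_trans[OF norm_ge_zero C_norm_ge[OF smooth_diff[OF *(2,1)], of "[]" r q]]) (use *(3) in auto)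
    then have "K1 * C_norm Q r (\<lambda>q. Z q - X q) \<le> max K1 K2 * C_norm Q r (\<lambda>q. Z q - X q)"
      "K2 * C_norm Q r (\<lambda>q. Z q - X q) \<le> max K1 K2 * C_norm Q r (\<lambda>q. Z q - X q)"
      by (auto intro!: mult_right_mono)
    then show "dist (jacobian Q dir_w k Z q) (jacobian Q dir_w k X q) \<le> max K1 K2 * C_norm Q r (\<lambda>q. Z q - X q) \<and>
    dist (jacobian Q dir_y k Z q) (jacobian Q dir_y k X q) \<le> max K1 K2 * C_norm Q r (\<lambda>q. Z q - X q)"
      using K1(2)[OF *] K2(2)[OF *] by linarith
  qed (use K1 in auto)
qed

text \<open>The four relevant Jacobians map the compact \<open>Q\<close> into the open set where
  both determinants are nonzero, hence with a uniform margin \<open>e\<close>. Four matrices share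
  that margin, which gives \<open>e / (4 * K)\<close>.\<close>

lemma hormander_nbhd:
  assumes X: "X \<in> hormander Q"
  obtains \<epsilon> where "\<epsilon> > 0" "\<And>Z. Z \<in> C_infty Q \<Longrightarrow> C_norm Q 2 (\<lambda>q. Z q - X q) < \<epsilon> \<Longrightarrow> Z \<in> hormander Q"
proof -
  let ?J = "\<lambda>X q. (jacobian Q dir_w 0 X q, jacobian Q dir_y 0 X q, jacobian Q dir_w 1 X q, jacobian Q dir_y 1 X q)"
  let ?F = "\<lambda>p :: (real^'m^'m) \<times> (real^'m^'m) \<times> (real^'m^'m) \<times> (real^'m^'m).
    det (curv1 (fst p) (fst (snd p)) (fst (snd (snd p))) (snd (snd (snd p))))"
  let ?U = "{p :: (real^'m^'m) \<times> (real^'m^'m) \<times> (real^'m^'m) \<times> (real^'m^'m). det (fst p) \<noteq> 0}"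
  let ?O = "{p \<in> ?U. ?F p \<in> - {0}}"
  have U: "open ?U" by (intro open_Collect_neq continuous_intros)
  have "continuous_on ?U ?F" by (intro continuous_intros continuous_on_curv) auto
  then have "open (?U \<inter> ?F -` (- {0}))"
    by (rule continuous_open_preimage[OF _ U]) (simp add: open_Compl)
  then have O: "open ?O" by (simp add: vimage_def Int_def)
  note H = hormanderD[OF X]
  have "continuous_on Q (?J X)"
    by (intro continuous_on_Pair smooth_continuous_on smooth_jacobian H)
  then have "compact (?J X ` Q)" using compact compact_continuous_image by blast
  moreover have "?J X ` Q \<subseteq> ?O"
    using H(3,4) by (auto simp: curv_eqs(5)[OF H(1,2)])
  ultimately obtain e where e: "e > 0" "(\<Union>p\<in>?J X ` Q. ball p e) \<subseteq> ?O"
    using compact_subset_open_imp_ball_epsilon_subset[OF _ O] by blast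
  obtain K where K: "K > 0" "\<And>X Z q k r. smooth Q X \<Longrightarrow> smooth Q Z \<Longrightarrow> q \<in> Q \<Longrightarrow> Suc k \<le> r \<Longrightarrow>
    dist (jacobian Q dir_w k Z q) (jacobian Q dir_w k X q) \<le> K * C_norm Q r (\<lambda>q. Z q - X q) \<and>
    dist (jacobian Q dir_y k Z q) (jacobian Q dir_y k X q) \<le> K * C_norm Q r (\<lambda>q. Z q - X q)"
    using jacobians_close by blast
  show ?thesis
  proof (rule that[of "e / (4 * K)"])
    show "e / (4 * K) > 0" using e K by simp
    fix Z assume Z: "Z \<in> C_infty Q" "C_norm Q 2 (\<lambda>q. Z q - X q) < e / (4 * K)"
    have sZ: "smooth Q Z" using Z by (simp add: C_infty_iff)
    have KN: "K * C_norm Q 2 (\<lambda>q. Z q - X q) < e / 4" using Z(2) K(1) by (simp add: field_simps)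
    have inO: "?J Z q \<in> ?O" if q: "q \<in> Q" for q
    proof -
      have "dist (?J Z q) (?J X q) \<le> dist (jacobian Q dir_w 0 Z q) (jacobian Q dir_w 0 X q)
         + (dist (jacobian Q dir_y 0 Z q) (jacobian Q dir_y 0 X q)
         + (dist (jacobian Q dir_w 1 Z q) (jacobian Q dir_w 1 X q)
         + dist (jacobian Q dir_y 1 Z q) (jacobian Q dir_y 1 X q)))"
        by (intro order_trans[OF dist_Pair_le] add_mono order_refl)
      also have "\<dots> < e" using K(2)[OF H(1) sZ q, of 0 2] K(2)[OF H(1) sZ q, of 1 2] KN by simp
      finally have "?J Z q \<in> ball (?J X q) e" by (simp only: mem_ball dist_commute)
      then show ?thesis using q by (intro subsetD[OF e(2)] UN_I[of "?J X q"] imageI)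
    qed
    then have nz: "det (grad_w Q Z q) \<noteq> 0" if "q \<in> Q" for q using that by (auto simp: grad_w_jacobian)
    moreover have "det (deriv_t Q (curv_matrix Q Z) q) \<noteq> 0" if "q \<in> Q" for q
      using inO[OF that] by (simp add: curv_eqs(5)[OF sZ nz that])
    ultimately show "Z \<in> hormander Q" unfolding hormander_def using Z(1) by blast
  qed
qed

lemma bourgain_iff:
  assumes X: "X \<in> hormander Q"
  shows "X \<in> bourgain Q \<longleftrightarrow>
    (\<forall>q\<in>Q. parallel_defect (deriv_t Q (curv_matrix Q X) q) (deriv_t Q (deriv_t Q (curv_matrix Q X)) q) = 0)"
proof -
  have "deriv_t Q (curv_matrix Q X) q \<noteq> 0" if "q \<in> Q" for q
    using hormanderD(4)[OF X that] det_nonzero_imp_nonzero by blast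
  then have "(\<forall>q\<in>Q. parallel_defect (deriv_t Q (curv_matrix Q X) q) (deriv_t Q (deriv_t Q (curv_matrix Q X)) q) = 0)
    \<longleftrightarrow> (\<forall>q\<in>Q. \<exists>l. deriv_t Q (deriv_t Q (curv_matrix Q X)) q = l *\<^sub>R deriv_t Q (curv_matrix Q X) q)"
    by (simp add: parallel_defect_eq_0)
  also have "\<dots> \<longleftrightarrow> (\<exists>lam. \<forall>q\<in>Q. deriv_t Q (deriv_t Q (curv_matrix Q X)) q = lam q *\<^sub>R deriv_t Q (curv_matrix Q X) q)"
    by (rule bchoice_iff)
  finally show ?thesis using X unfolding bourgain_def by blast
qed

text \<open>Failure at one point suffices, so the margin is taken around the six Jacobians at that
  point. A nearby map outside \<open>hormander Q\<close> is outside \<open>bourgain Q\<close> by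
  definition.\<close>

lemma bourgain_nbhd:
  assumes X: "X \<in> hormander Q" "X \<notin> bourgain Q"
  obtains \<epsilon> where "\<epsilon> > 0" "\<And>Z. Z \<in> C_infty Q \<Longrightarrow> C_norm Q 3 (\<lambda>q. Z q - X q) < \<epsilon> \<Longrightarrow> Z \<notin> bourgain Q"
proof -
  let ?J = "\<lambda>X q. ((jacobian Q dir_w 0 X q, jacobian Q dir_y 0 X q), (jacobian Q dir_w 1 X q, jacobian Q dir_y 1 X q),
    jacobian Q dir_w 2 X q, jacobian Q dir_y 2 X q)"
  let ?F1 = "\<lambda>p :: ((real^'m^'m) \<times> (real^'m^'m)) \<times> ((real^'m^'m) \<times> (real^'m^'m)) \<times> (real^'m^'m) \<times> (real^'m^'m).
    curv1 (fst (fst p)) (snd (fst p)) (fst (fst (snd p))) (snd (fst (snd p)))"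
  let ?F2 = "\<lambda>p :: ((real^'m^'m) \<times> (real^'m^'m)) \<times> ((real^'m^'m) \<times> (real^'m^'m)) \<times> (real^'m^'m) \<times> (real^'m^'m).
    curv2 (fst (fst p)) (snd (fst p)) (fst (fst (snd p))) (snd (fst (snd p))) (fst (snd (snd p))) (snd (snd (snd p)))"
  let ?F = "\<lambda>p. parallel_defect (?F1 p) (?F2 p)"
  let ?U = "{p :: ((real^'m^'m) \<times> (real^'m^'m)) \<times> ((real^'m^'m) \<times> (real^'m^'m)) \<times> (real^'m^'m) \<times> (real^'m^'m). det (fst (fst p)) \<noteq> 0}"
  let ?O = "{p \<in> ?U. ?F p \<in> - {0}}"
  have U: "open ?U" by (intro open_Collect_neq continuous_intros)
  have "continuous_on ?U ?F1" "continuous_on ?U ?F2" by (auto intro!: continuous_intros continuous_on_curv)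
  then have "continuous_on ?U ?F" unfolding parallel_defect_def by (intro continuous_intros)
  then have "open (?U \<inter> ?F -` (- {0}))"
    by (rule continuous_open_preimage[OF _ U]) (simp add: open_Compl)
  then have O: "open ?O" by (simp add: vimage_def Int_def)
  have J: "?F (?J X q) = parallel_defect (deriv_t Q (curv_matrix Q X) q) (deriv_t Q (deriv_t Q (curv_matrix Q X)) q)"
    if "X \<in> hormander Q" "q \<in> Q" for X q
    using that(2) by (simp add: curv_eqs(5,6)[OF hormanderD(1,2)[OF that(1)]])
  obtain q where q: "q \<in> Q" "?F (?J X q) \<noteq> 0" using X bourgain_iff J by fastforce
  note H = hormanderD[OF X(1)]
  have "?J X q \<in> ?O" using q H(3)[OF q(1)] by simp
  then obtain e where e: "e > 0" "ball (?J X q) e \<subseteq> ?O" using O open_contains_ball by blast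
  obtain K where K: "K > 0" "\<And>X Z q k r. smooth Q X \<Longrightarrow> smooth Q Z \<Longrightarrow> q \<in> Q \<Longrightarrow> Suc k \<le> r \<Longrightarrow>
    dist (jacobian Q dir_w k Z q) (jacobian Q dir_w k X q) \<le> K * C_norm Q r (\<lambda>q. Z q - X q) \<and>
    dist (jacobian Q dir_y k Z q) (jacobian Q dir_y k X q) \<le> K * C_norm Q r (\<lambda>q. Z q - X q)"
    using jacobians_close by blast
  show ?thesis
  proof (rule that[of "e / (6 * K)"])
    show "e / (6 * K) > 0" using e K by simp
    fix Z assume Z: "Z \<in> C_infty Q" "C_norm Q 3 (\<lambda>q. Z q - X q) < e / (6 * K)"
    have sZ: "smooth Q Z" using Z by (simp add: C_infty_iff)
    have KN: "K * C_norm Q 3 (\<lambda>q. Z q - X q) < e / 6" using Z(2) K(1) by (simp add: field_simps)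
    have "dist (?J Z q) (?J X q) \<le> (dist (jacobian Q dir_w 0 Z q) (jacobian Q dir_w 0 X q)
         + dist (jacobian Q dir_y 0 Z q) (jacobian Q dir_y 0 X q))
         + ((dist (jacobian Q dir_w 1 Z q) (jacobian Q dir_w 1 X q)
         + dist (jacobian Q dir_y 1 Z q) (jacobian Q dir_y 1 X q))
         + (dist (jacobian Q dir_w 2 Z q) (jacobian Q dir_w 2 X q)
         + dist (jacobian Q dir_y 2 Z q) (jacobian Q dir_y 2 X q)))"
      by (intro order_trans[OF dist_Pair_le] add_mono dist_Pair_le)
    also have "\<dots> < e"
      using K(2)[OF H(1) sZ q(1), of 0 3] K(2)[OF H(1) sZ q(1), of 1 3] K(2)[OF H(1) sZ q(1), of 2 3] KN by simp
    finally have "?J Z q \<in> ball (?J X q) e" by (simp only: mem_ball dist_commute)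
    then have "?J Z q \<in> ?O" by (rule subsetD[OF e(2)])
    then show "Z \<notin> bourgain Q" using bourgain_iff[of Z] J[of Z q] q(1) bourgain_def by fastforce
  qed
qed

lemma jacobian_perturbation:
  assumes X: "smooth Q X" and h: "smooth Q h" and q: "q \<in> Q"
  shows "jacobian Q e k (restrict (\<lambda>q. X q + s *\<^sub>R h q) Q) q = jacobian Q e k X q + s *\<^sub>R jacobian Q e k h q"
proof -
  have "pderivs_on Q bs (restrict (\<lambda>q. X q + s *\<^sub>R h q) Q) q = pderivs_on Q bs X q + s *\<^sub>R pderivs_on Q bs h q" for bs
  proof -
    have "pderivs_on Q bs (restrict (\<lambda>q. X q + s *\<^sub>R h q) Q) q = pderivs_on Q bs (\<lambda>q. X q - (- s) *\<^sub>R h q) q"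
      by (rule pderivs_on_cong[OF _ q]) simp
    also have "\<dots> = pderivs_on Q bs X q - pderivs_on Q bs (\<lambda>q. (- s) *\<^sub>R h q) q"
      by (rule pderivs_on_diff[OF X smooth_scaleR_const[OF h] q])
    finally show ?thesis using pderivs_on_linear[OF h bounded_linear_scaleR_right q, of bs "- s"] by simp
  qed
  moreover have "linear (column_matrix j :: real^'m \<Rightarrow> real^'m^'m)" for j
    using bounded_linear_column_matrix bounded_linear.linear by blast
  ultimately show ?thesis
    unfolding jacobian_def by (simp add: linear_add linear_scale sum.distrib scaleR_sum_right)
qed

text \<open>The perturbation \<open>(t - t0)^2 / 2 * V y\<close> has no \<open>w\<close>-Jacobian,
  and its \<open>y\<close>-Jacobian appears at \<open>q0\<close> only after two time derivatives. So
  the first time derivative \<open>C1\<close> of the curvature matrix at \<open>q0\<close> stays,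
  while the second one is shifted in a direction that is not a multiple of
  \<open>C1\<close>.\<close>

lemma not_bourgain_dense:
  assumes X: "X \<in> bourgain Q" and \<epsilon>: "\<epsilon> > 0" and card: "CARD('m) \<ge> 2"
  shows "\<exists>Z\<in>C_infty Q. C_norm Q r (\<lambda>q. Z q - X q) < \<epsilon> \<and> Z \<notin> bourgain Q"
proof -
  have XH: "X \<in> hormander Q" using X by (simp add: bourgain_def)
  note H = hormanderD[OF XH]
  obtain q0 where q0: "q0 \<in> Q" using interior interior_subset by blast
  obtain i0 j0 :: 'm where ij: "i0 \<noteq> j0"
    using card by (metis UNIV_I card_2_iff' card_le_Suc0_iff_eq finite not_less_eq_eq numeral_2_eq_2)
  define t0 where "t0 = fst (snd q0)"
  define A where "A = jacobian Q dir_w 0 X q0"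
  define C1 where "C1 = deriv_t Q (curv_matrix Q X) q0"
  \<comment> \<open>Chosen so that \<open>matrix_inv A ** V\<close> is \<open>C1\<close> times an
    off-diagonal unit matrix; two distinct indices exist because the dimension is at least
    \<open>2\<close>.\<close>
  define V where "V = A ** (C1 ** unit_matrix i0 j0)"
  define h where "h = (\<lambda>q :: 'm pt. ((fst (snd q) - t0)\<^sup>2 / 2) *\<^sub>R (V *v snd (snd q)))"
  have bl: "bounded_linear (\<lambda>q::'m pt. fst (snd q))" "bounded_linear (\<lambda>q::'m pt. snd (snd q))"
    by (auto intro: bounded_linear_intros bounded_linear_compose[OF bounded_linear_fst bounded_linear_snd]
      bounded_linear_compose[OF bounded_linear_snd bounded_linear_snd])
  have sh: "smooth Q h" unfolding h_def
    by (intro smooth_scaleR smooth_linear[OF matrix_vector_mul_bounded_linear] smooth_bounded_linear[OF bl(2)]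
       smooth_linear[OF bounded_linear_divide] smooth_power smooth_diff smooth_bounded_linear[OF bl(1)] smooth_const)
  have mv: "((\<lambda>q. V *v snd (snd q)) has_derivative (\<lambda>v. V *v snd (snd v))) (at q within Q)" for q :: "'m pt"
    by (rule bounded_linear.has_derivative[OF matrix_vector_mul_bounded_linear]) (auto intro!: derivative_eq_intros)
  have dh: "(h has_derivative (\<lambda>v. ((fst (snd q) - t0)\<^sup>2 / 2) *\<^sub>R (V *v snd (snd v))
      + (fst (snd v) * (fst (snd q) - t0)) *\<^sub>R (V *v snd (snd q)))) (at q within Q)" for q
    unfolding h_def by (auto intro!: derivative_eq_intros mv)
  have w0: "pderiv_on Q (dir_w j) h q = 0" if "q \<in> Q" for q j
    using pderiv_on_eq[OF dh that] by simp
  have Jw: "jacobian Q dir_w k h q = 0" if "q \<in> Q" for k q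
  proof -
    have "pderivs_on Q (replicate k (0, 1, 0) @ [dir_w j]) h q = 0" if "q \<in> Q" for j q
    proof -
      have "pderivs_on Q (replicate k (0, 1, 0) @ [dir_w j]) h q = pderivs_on Q (replicate k (0, 1, 0)) (\<lambda>_. 0) q"
        unfolding pderivs_on_snoc by (rule pderivs_on_cong[OF w0 that])
      also have "\<dots> = 0"
        using pderivs_on_linear[OF smooth_const[of "0::real^'m"] bounded_linear_scaleR_right[of 0] that] by simp
      finally show ?thesis .
    qed
    then show ?thesis using that unfolding jacobian_def
      by (simp add: bounded_linear.linear[OF bounded_linear_column_matrix] linear_0)
  qed
  define v where "v j = V *v axis j 1" for j
  have y0: "pderivs_on Q [dir_y j] h q = ((fst (snd q) - t0)\<^sup>2 / 2) *\<^sub>R v j" if "q \<in> Q" for q j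
    using pderiv_on_eq[OF dh that] by (simp add: v_def)
  have d1: "((\<lambda>q. ((fst (snd q) - t0)\<^sup>2 / 2) *\<^sub>R v j) has_derivative (\<lambda>h. (fst (snd h) * (fst (snd q) - t0)) *\<^sub>R v j)) (at q within Q)" for j and q :: "'m pt"
    by (auto intro!: derivative_eq_intros)
  have d2: "((\<lambda>q. (fst (snd q) - t0) *\<^sub>R v j) has_derivative (\<lambda>h. fst (snd h) *\<^sub>R v j)) (at q within Q)" for j and q :: "'m pt"
    by (auto intro!: derivative_eq_intros)
  have y1: "pderivs_on Q [(0,1,0), dir_y j] h q = (fst (snd q) - t0) *\<^sub>R v j" if "q \<in> Q" for q j
    using pderiv_on_cong[OF y0[of _ j] that, where v="(0,1,0)"] pderiv_on_eq[OF d1[of j] that, where v="(0,1,0)"] by simp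
  have y2: "pderivs_on Q [(0,1,0), (0,1,0), dir_y j] h q = v j" if "q \<in> Q" for q j
    using pderiv_on_cong[OF y1[of _ j] that, where v="(0,1,0)"] pderiv_on_eq[OF d2[of j] that, where v="(0,1,0)"] by simp
  have Jy: "jacobian Q dir_y 0 h q0 = 0" "jacobian Q dir_y 1 h q0 = 0" "jacobian Q dir_y 2 h q0 = V"
  proof -
    have z: "column_matrix j (0::real^'m) = (0::real^'m^'m)" for j
      by (simp add: bounded_linear.linear[OF bounded_linear_column_matrix] linear_0)
    have "v j $ i = V $ i $ j" for i j
      unfolding v_def matrix_vector_mult_def axis_def by (simp add: if_distrib cong: if_cong)
    then have "V = (\<chi> i j. v j $ i)" by (simp add: vec_eq_iff)
    then show "jacobian Q dir_y 0 h q0 = 0" "jacobian Q dir_y 1 h q0 = 0" "jacobian Q dir_y 2 h q0 = V"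
      unfolding jacobian_def column_matrix_sum[symmetric]
      using y0[OF q0] y1[OF q0] y2[OF q0] by (simp_all add: numeral_2_eq_2 t0_def vec_eq_iff del: pderivs_on.simps)
  qed
  obtain \<epsilon>' where \<epsilon>': "\<epsilon>' > 0" "\<And>Z. Z \<in> C_infty Q \<Longrightarrow> C_norm Q 2 (\<lambda>q. Z q - X q) < \<epsilon>' \<Longrightarrow> Z \<in> hormander Q"
    using hormander_nbhd[OF XH] by blast
  obtain s where s: "s > 0" "restrict (\<lambda>q. X q + s *\<^sub>R h q) Q \<in> C_infty Q"
    "C_norm Q r (\<lambda>q. restrict (\<lambda>q. X q + s *\<^sub>R h q) Q q - X q) < \<epsilon>"
    using small_perturbation[of X h \<epsilon> r] XH sh \<epsilon> unfolding hormander_def by blast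
  define Z where "Z = restrict (\<lambda>q. X q + s *\<^sub>R h q) Q"
  have "Z \<notin> bourgain Q"
  proof
    assume ZB: "Z \<in> bourgain Q"
    then have ZH: "Z \<in> hormander Q" by (simp add: bourgain_def)
    note HZ = hormanderD[OF ZH]
    have Z1: "deriv_t Q (curv_matrix Q Z) q0 = C1"
      unfolding C1_def hormander_curv(1)[OF ZH q0] hormander_curv(1)[OF XH q0]
      by (simp add: Z_def jacobian_perturbation[OF H(1) sh q0] Jw q0 Jy Jy(2)[simplified])
    have Z2: "deriv_t Q (deriv_t Q (curv_matrix Q Z)) q0 = deriv_t Q (deriv_t Q (curv_matrix Q X)) q0 + s *\<^sub>R (matrix_inv A ** V)"
      unfolding hormander_curv(2)[OF ZH q0] hormander_curv(2)[OF XH q0] A_def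
      by (simp only: Z_def jacobian_perturbation[OF H(1) sh q0] Jw[OF q0] Jy curv2_add scaleR_zero_right add_0_right)
    have AV: "matrix_inv A ** V = C1 ** unit_matrix i0 j0"
      unfolding V_def matrix_mul_assoc using matrix_inv_works(2)[OF H(3)[OF q0]] by (simp add: A_def)
    obtain l1 where l1: "deriv_t Q (deriv_t Q (curv_matrix Q Z)) q0 = l1 *\<^sub>R C1"
      using ZB q0 Z1 unfolding bourgain_def by auto
    obtain l2 where l2: "deriv_t Q (deriv_t Q (curv_matrix Q X)) q0 = l2 *\<^sub>R C1"
      using X q0 unfolding bourgain_def C1_def by auto
    have "s *\<^sub>R (C1 ** unit_matrix i0 j0) = (l1 - l2) *\<^sub>R C1"
      using Z2 l1 l2 AV by (simp add: algebra_simps)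
    \<comment> \<open>Cancelling the invertible \<open>C1\<close> would leave the off-diagonal unit
      matrix equal to a scalar matrix.\<close>
    then have "C1 ** (s *\<^sub>R unit_matrix i0 j0) = C1 ** ((l1 - l2) *\<^sub>R mat 1)"
      by (simp add: matrix_scalar_ac scalar_matrix_assoc[symmetric])
    then have "s *\<^sub>R unit_matrix i0 j0 = (l1 - l2) *\<^sub>R (mat 1 :: real^'m^'m)"
      by (metis H(4)[OF q0, folded C1_def] matrix_inv_unique_solution)
    then have "(s *\<^sub>R unit_matrix i0 j0) $ i0 $ j0 = ((l1 - l2) *\<^sub>R (mat 1 :: real^'m^'m)) $ i0 $ j0" by simp
    then show False using s(1) ij by (simp add: unit_matrix_def mat_def)
  qed
  then show ?thesis using s unfolding Z_def by blast
qed

end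

section \<open>Approximation by maps that are polynomial in time\<close>

text \<open>Bernstein's probabilistic proof made quantitative: the required \<open>n\<close> depends
  only on the bound \<open>M\<close>, the modulus \<open>d\<close> and \<open>e\<close>, so one
  \<open>n\<close> serves all time lines of \<open>Q\<close> simultaneously.\<close>

lemma Bernstein_uniform_bound:
  fixes g :: "real \<Rightarrow> 'b::real_normed_vector"
  assumes M: "\<And>x. x \<in> {0..1} \<Longrightarrow> norm (g x) \<le> M"
    and d: "d > 0" "\<And>x x'. x \<in> {0..1} \<Longrightarrow> x' \<in> {0..1} \<Longrightarrow> \<bar>x' - x\<bar> < d \<Longrightarrow> norm (g x' - g x) \<le> e / 2"
    and e: "e > 0" and n: "4 * M / (e * d\<^sup>2) + 1 \<le> real n" and x: "x \<in> {0..1}"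
  shows "norm ((\<Sum>k\<le>n. Bernstein n k x *\<^sub>R g (k / n)) - g x) \<le> e"
proof -
  have M0: "0 \<le> M" by (rule order_trans[OF norm_ge_zero M[of 0]]) simp
  have "0 \<le> 4 * M / (e * d\<^sup>2)" using M0 e d by simp
  then have n0: "n > 0" using n by (cases n) auto
  \<comment> \<open>The variance of the binomial mean.\<close>
  have sum_bern: "(\<Sum>k\<le>n. (x - k/n)\<^sup>2 * Bernstein n k x) = x * (1 - x) / n"
  proof -
    have *: "\<And>a b x::real. (a - b)\<^sup>2 * x = a * (a - 1) * x + (1 - 2 * b) * a * x + b * b * x"
      by (simp add: algebra_simps power2_eq_square)
    have "(\<Sum>k\<le>n. (k - n * x)\<^sup>2 * Bernstein n k x) = n * x * (1 - x)"
      apply (simp add: * sum.distrib)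
      apply (simp flip: sum_distrib_left add: mult.assoc)
      apply (simp add: algebra_simps power2_eq_square)
      done
    then have "(\<Sum>k\<le>n. (k - n * x)\<^sup>2 * Bernstein n k x)/n^2 = x * (1 - x) / n"
      by (simp add: power2_eq_square)
    then show ?thesis
      using n0 by (simp add: sum_divide_distrib field_split_simps power2_commute)
  qed
  \<comment> \<open>Nodes within \<open>d\<close> of \<open>x\<close> are handled by the modulus of
    continuity; for the others \<open>2 M\<close> is at most \<open>2 M / d^2\<close> times the
    squared distance, as in Chebyshev's inequality.\<close>
  have diff: "norm (g (k/n) - g x) \<le> e/2 + 2 * M / d\<^sup>2 * (x - k/n)\<^sup>2" if k: "k \<le> n" for k
  proof -
    have kn: "real k / real n \<in> {0..1}" using k n0 by auto
    show ?thesis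
    proof (cases "\<bar>real k / real n - x\<bar> < d")
      case True
      then have "norm (g (k/n) - g x) \<le> e / 2" using d(2)[OF x kn] by blast
      moreover have "0 \<le> 2 * M / d\<^sup>2 * (x - k/n)\<^sup>2" using M0 by simp
      ultimately show ?thesis by linarith
    next
      case False
      then have "d\<^sup>2 \<le> \<bar>x - k/n\<bar>\<^sup>2" using d(1) by (intro power_mono) (auto simp: abs_minus_commute)
      then have "d\<^sup>2 \<le> (x - k/n)\<^sup>2" by simp
      then have "1 \<le> (x - k/n)\<^sup>2 / d\<^sup>2" using d(1) by simp
      then have "2 * M * 1 \<le> 2 * M * ((x - k/n)\<^sup>2 / d\<^sup>2)" using M0 by (intro mult_left_mono) auto
      moreover have "norm (g (k/n) - g x) \<le> M + M"
        using M[OF kn] M[OF x] by (intro order_trans[OF norm_triangle_ineq4] add_mono)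
      ultimately show ?thesis using e by simp
    qed
  qed
  have "(\<Sum>k\<le>n. Bernstein n k x *\<^sub>R g (k / n)) - g x = (\<Sum>k\<le>n. Bernstein n k x *\<^sub>R (g (k / n) - g x))"
    by (simp add: scaleR_diff_right sum_subtractf scaleR_sum_left[symmetric])
  also have "norm \<dots> \<le> (\<Sum>k\<le>n. Bernstein n k x * (e/2 + 2 * M / d\<^sup>2 * (x - k/n)\<^sup>2))"
    using diff x by (intro sum_norm_le) (auto simp: Bernstein_nonneg intro!: mult_left_mono)
  also have "\<dots> = e/2 * (\<Sum>k\<le>n. Bernstein n k x) + 2 * M / d\<^sup>2 * (\<Sum>k\<le>n. (x - k/n)\<^sup>2 * Bernstein n k x)"
    by (simp only: distrib_left sum.distrib sum_distrib_left mult_ac)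
  also have "\<dots> = e/2 + 2 * M / d\<^sup>2 * (x * (1 - x) / n)" by (simp add: sum_bern)
  also have "2 * M / d\<^sup>2 * (x * (1 - x) / n) \<le> e / 2"
  proof -
    have "x * (1 - x) \<le> 1 * 1" using x by (intro mult_mono) auto
    then have "2 * M / d\<^sup>2 * (x * (1 - x) / n) \<le> 2 * M / d\<^sup>2 * (1 / n)"
      using M0 by (intro mult_left_mono divide_right_mono) auto
    also have "\<dots> \<le> e / 2"
    proof -
      have "4 * M / (e * d\<^sup>2) \<le> n" using n by simp
      then have "4 * M \<le> n * (e * d\<^sup>2)" using e d(1) by (simp add: pos_divide_le_eq)
      then show ?thesis using n0 d(1) by (simp add: field_simps)
    qed
    finally show ?thesis .
  qed
  finally show ?thesis by simp
qed

definition antideriv :: "real \<Rightarrow> real poly \<Rightarrow> real poly" where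
  "antideriv a p = (SOME q. pderiv q = p \<and> poly q a = 0)"

lemma antideriv: "pderiv (antideriv a p) = p" "poly (antideriv a p) a = 0"
proof -
  have sum: "pderiv (\<Sum>i\<in>A. f i) = (\<Sum>i\<in>A. pderiv (f i))" for A :: "nat set" and f :: "nat \<Rightarrow> real poly"
    by (induction A rule: infinite_finite_induct) (simp_all add: pderiv_add)
  define q where "q = (\<Sum>i\<le>degree p. monom (coeff p i / real (Suc i)) (Suc i))"
  have "pderiv q = (\<Sum>i\<le>degree p. monom (coeff p i) i)"
    unfolding q_def sum by (intro sum.cong) (simp_all add: pderiv_monom del: of_nat_Suc)
  then have "pderiv q = p" by (simp add: poly_as_sum_of_monoms)
  then have "pderiv (q - [:poly q a:]) = p \<and> poly (q - [:poly q a:]) a = 0"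
    by (simp add: pderiv_diff pderiv_pCons)
  then show "pderiv (antideriv a p) = p" "poly (antideriv a p) a = 0"
    unfolding antideriv_def by (metis (mono_tags, lifting) someI)+
qed

text \<open>Rescaled from \<open>{0..1}\<close> to \<open>{a..b}\<close> and kept as a formal
  polynomial, so that it can be integrated repeatedly.\<close>

definition bernstein_poly :: "real \<Rightarrow> real \<Rightarrow> nat \<Rightarrow> nat \<Rightarrow> real poly" where
  "bernstein_poly a b n k = smult (of_nat (n choose k))
     ([:- a / (b - a), 1 / (b - a):] ^ k * [:1 + a / (b - a), - 1 / (b - a):] ^ (n - k))"

lemma poly_bernstein_poly: "poly (bernstein_poly a b n k) t = Bernstein n k ((t - a) / (b - a))"
proof -
  have e: "- a / (b - a) + t * (1 / (b - a)) = (t - a) / (b - a)"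
    "1 + a / (b - a) + t * (- 1 / (b - a)) = 1 - (t - a) / (b - a)"
    by (simp_all add: diff_divide_distrib)
  show ?thesis
    by (simp only: bernstein_poly_def Bernstein_def poly_power poly_smult poly_mult poly_pCons poly_0 mult_zero_right add_0_right e mult.assoc)
qed

abbreviation "dir_t \<equiv> (0, 1, 0)"

locale slab = pt_domain Q for Q :: "'m::finite pt set" +
  fixes W Y :: "(real^'m) set" and a b :: real
  assumes Q_eq: "Q = W \<times> {a..b} \<times> Y" and ab: "a < b"
begin

text \<open>Freezing the time at \<open>c\<close> still yields a function on all of
  \<open>Q\<close>, so the calculus on \<open>Q\<close> applies to the coefficients of the expansion
  unchanged.\<close>

definition slice :: "real \<Rightarrow> ('m pt \<Rightarrow> 'b) \<Rightarrow> 'm pt \<Rightarrow> 'b" where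
  "slice c f q = f (fst q, c, snd (snd q))"

lemma slice_mem: "c \<in> {a..b} \<Longrightarrow> q \<in> Q \<Longrightarrow> (fst q, c, snd (snd q)) \<in> Q"
  by (auto simp: Q_eq)

lemma slice_affine: "slice c f = (\<lambda>q. f ((fst q, 0, snd (snd q)) + (0, c, 0)))"
  by (simp add: slice_def fun_eq_iff)

lemma bounded_linear_slice: "bounded_linear (\<lambda>q :: 'm pt. (fst q, 0 :: real, snd (snd q)))"
  by (intro bounded_linear_Pair bounded_linear_fst bounded_linear_zero bounded_linear_compose[OF bounded_linear_snd bounded_linear_snd])

lemma smooth_slice: "c \<in> {a..b} \<Longrightarrow> smooth Q f \<Longrightarrow> smooth Q (slice c f)"
  unfolding slice_affine by (rule smooth_affine_comp[OF bounded_linear_slice]) (auto simp: slice_mem)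

lemma pderiv_on_slice:
  assumes "c \<in> {a..b}" "smooth Q f" "q \<in> Q"
  shows "pderiv_on Q (u, s, v) (slice c f) q = slice c (pderiv_on Q (u, 0, v) f) q"
  unfolding slice_affine
  by (subst pderiv_on_affine_comp[OF bounded_linear_slice]) (use assms in \<open>auto simp: slice_mem smooth_differentiable\<close>)

definition tpoly :: "real poly \<Rightarrow> 'm pt \<Rightarrow> real" where
  "tpoly p q = poly p (fst (snd q))"

lemma has_derivative_tpoly:
  "(tpoly p has_derivative (\<lambda>v. fst (snd v) * tpoly (pderiv p) q)) (at q within S)"
proof -
  have "(poly p has_derivative (\<lambda>h. h * poly (pderiv p) (fst (snd q)))) (at (fst (snd q)))"
    using poly_DERIV[of p "fst (snd q)"] by (simp add: has_field_derivative_def mult_commute_abs)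
  moreover have "((\<lambda>q. fst (snd q)) has_derivative (\<lambda>q. fst (snd q))) (at q within S)"
    by (auto intro!: derivative_eq_intros)
  ultimately show ?thesis unfolding tpoly_def using has_derivative_compose by fastforce
qed

lemma pderiv_on_tpoly: "q \<in> Q \<Longrightarrow> pderiv_on Q (u, s, v) (tpoly p) q = s * tpoly (pderiv p) q"
  using pderiv_on_eq[OF has_derivative_tpoly] by simp

lemma smooth_tpoly: "smooth Q (tpoly p)"
proof -
  have "smooth Q (\<lambda>q :: 'm pt. fst (snd q))"
    by (intro smooth_bounded_linear bounded_linear_compose[OF bounded_linear_fst bounded_linear_snd])
  then show ?thesis
    unfolding tpoly_def poly_altdef by (intro smooth_sum smooth_mult smooth_const smooth_power)
qed

abbreviation Dt :: "('m pt \<Rightarrow> 'b::real_normed_vector) \<Rightarrow> 'm pt \<Rightarrow> 'b" where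
  "Dt \<equiv> pderiv_on Q dir_t"

lemma smooth_Dt: "smooth Q f \<Longrightarrow> smooth Q ((Dt ^^ k) f)"
  by (induction k) (auto intro: smooth_pderiv_on)

lemma Dt_cong: "(\<And>q. q \<in> Q \<Longrightarrow> f q = g q) \<Longrightarrow> q \<in> Q \<Longrightarrow> (Dt ^^ k) f q = (Dt ^^ k) g q"
  by (induction k arbitrary: q) (auto intro: pderiv_on_cong)

lemma pderiv_on_Dt_commute:
  fixes f :: "'m pt \<Rightarrow> 'b::real_inner"
  assumes f: "smooth Q f" and q: "q \<in> Q"
  shows "pderiv_on Q v ((Dt ^^ k) f) q = (Dt ^^ k) (pderiv_on Q v f) q"
  using q
proof (induction k arbitrary: q)
  case (Suc k)
  have "pderiv_on Q v (Dt ((Dt ^^ k) f)) q = Dt (pderiv_on Q v ((Dt ^^ k) f)) q"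
    by (rule pderiv_on_commute[OF smooth_Dt[OF f] Suc.prems])
  also have "\<dots> = Dt ((Dt ^^ k) (pderiv_on Q v f)) q"
    by (rule pderiv_on_cong[OF Suc.IH Suc.prems])
  finally show ?case by simp
qed simp

definition node :: "nat \<Rightarrow> nat \<Rightarrow> real" where
  "node n k = a + real k / real n * (b - a)"

lemma node_mem: "k \<le> n \<Longrightarrow> node n k \<in> {a..b}"
proof -
  assume "k \<le> n"
  then have "0 \<le> real k / real n" "real k / real n \<le> 1" by (auto simp: divide_le_eq_1)
  then have "0 \<le> real k / real n * (b - a)" "real k / real n * (b - a) \<le> 1 * (b - a)"
    using ab by - ((rule mult_nonneg_nonneg mult_right_mono; simp)+)
  then show ?thesis unfolding node_def by auto
qed

text \<open>The Taylor expansion in \<open>t\<close> of order \<open>r\<close> at \<open>a\<close>, whose remainder is the \<open>r\<close>-fold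
  antiderivative of a Bernstein polynomial for the \<open>r\<close>-th derivative.\<close>

definition approx :: "nat \<Rightarrow> nat \<Rightarrow> ('m pt \<Rightarrow> 'b::real_normed_vector) \<Rightarrow> 'm pt \<Rightarrow> 'b" where
  "approx n r f q = (\<Sum>i<r. tpoly ((antideriv a ^^ i) 1) q *\<^sub>R slice a ((Dt ^^ i) f) q)
     + (\<Sum>k\<le>n. tpoly ((antideriv a ^^ r) (bernstein_poly a b n k)) q *\<^sub>R slice (node n k) ((Dt ^^ r) f) q)"

lemma smooth_approx: "smooth Q f \<Longrightarrow> smooth Q (approx n r f)"
  unfolding approx_def using ab
  by (intro smooth_add smooth_sum smooth_scaleR smooth_tpoly smooth_slice smooth_Dt node_mem) auto

lemma pderiv_on_tpoly_slice:
  assumes "c \<in> {a..b}" "smooth Q f" "q \<in> Q"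
  shows "pderiv_on Q (u, s, v) (\<lambda>q. tpoly p q *\<^sub>R slice c f q) q
    = tpoly p q *\<^sub>R slice c (pderiv_on Q (u, 0, v) f) q + (s * tpoly (pderiv p) q) *\<^sub>R slice c f q"
  using pderiv_on_bilinear[OF bounded_bilinear_scaleR smooth_differentiable[OF smooth_tpoly]
      smooth_differentiable[OF smooth_slice[OF assms(1,2)]] assms(3)]
  by (simp add: pderiv_on_slice[OF assms] pderiv_on_tpoly[OF assms(3)])

lemma pderiv_on_approx_expand:
  assumes f: "smooth Q f" and q: "q \<in> Q"
  shows "pderiv_on Q v (approx n r f) q =
     (\<Sum>i<r. pderiv_on Q v (\<lambda>q. tpoly ((antideriv a ^^ i) 1) q *\<^sub>R slice a ((Dt ^^ i) f) q) q)
     + (\<Sum>k\<le>n. pderiv_on Q v (\<lambda>q. tpoly ((antideriv a ^^ r) (bernstein_poly a b n k)) q *\<^sub>R slice (node n k) ((Dt ^^ r) f) q) q)"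
proof -
  have s1: "smooth Q (\<lambda>q. tpoly ((antideriv a ^^ i) 1) q *\<^sub>R slice a ((Dt ^^ i) f) q)" for i
    using ab by (intro smooth_scaleR smooth_tpoly smooth_slice smooth_Dt f) auto
  have s2: "smooth Q (\<lambda>q. tpoly ((antideriv a ^^ r) (bernstein_poly a b n k)) q *\<^sub>R slice (node n k) ((Dt ^^ r) f) q)"
    if "k \<in> {..n}" for k
    using that by (intro smooth_scaleR smooth_tpoly smooth_slice smooth_Dt f node_mem) auto
  show ?thesis
    unfolding approx_def
    by (simp only: pderiv_on_add[OF smooth_differentiable[OF smooth_sum[OF s1]] smooth_differentiable[OF smooth_sum[OF s2]] q]
      pderiv_on_sum[OF s1 q] pderiv_on_sum[OF s2 q])
qed

text \<open>A direction without time component does not see the polynomial factors; on the slices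
  the derivative commutes with the powers of \<open>Dt\<close> by symmetry of mixed
  derivatives.\<close>

lemma pderiv_on_approx:
  fixes f :: "'m pt \<Rightarrow> 'b::real_inner"
  assumes f: "smooth Q f" and q: "q \<in> Q"
  shows "pderiv_on Q (u, 0, v) (approx n r f) q = approx n r (pderiv_on Q (u, 0, v) f) q"
proof -
  have 1: "pderiv_on Q (u, 0, v) (\<lambda>q. tpoly p q *\<^sub>R slice c ((Dt ^^ i) f) q) q
    = tpoly p q *\<^sub>R slice c ((Dt ^^ i) (pderiv_on Q (u, 0, v) f)) q" if "c \<in> {a..b}" for p c i
  proof -
    have "slice c (pderiv_on Q (u, 0, v) ((Dt ^^ i) f)) q = slice c ((Dt ^^ i) (pderiv_on Q (u, 0, v) f)) q"
      unfolding slice_def by (rule pderiv_on_Dt_commute[OF f slice_mem[OF that q]])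
    then show ?thesis by (simp add: pderiv_on_tpoly_slice[OF that smooth_Dt[OF f] q])
  qed
  show ?thesis
    unfolding pderiv_on_approx_expand[OF f q] unfolding approx_def
    using ab by (intro arg_cong2[where f="(+)"] sum.cong refl 1 node_mem) auto
qed

lemma Dt_tpoly_slice:
  fixes f :: "'m pt \<Rightarrow> 'b::real_normed_vector"
  assumes c: "c \<in> {a..b}" and f: "smooth Q f" and q: "q \<in> Q"
  shows "Dt (\<lambda>q. tpoly p q *\<^sub>R slice c f q) q = tpoly (pderiv p) q *\<^sub>R slice c f q"
proof -
  have "slice c (pderiv_on Q (0, 0, 0) f) q = 0"
    using pderiv_on_basis[OF smooth_differentiable[OF f] slice_mem[OF c q], of "(0, 0, 0)"]
    by (simp add: slice_def zero_prod_def[symmetric])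
  then show ?thesis by (simp add: pderiv_on_tpoly_slice[OF c f q])
qed

text \<open>The time derivative undoes one antiderivative in every term and kills the constant one,
  while \<open>Suc r\<close> derivatives of \<open>f\<close> are \<open>r\<close> derivatives of
  \<open>Dt f\<close>: the expansion drops exactly one order.\<close>

lemma Dt_approx:
  fixes f :: "'m pt \<Rightarrow> 'b::real_normed_vector"
  assumes f: "smooth Q f" and q: "q \<in> Q"
  shows "Dt (approx n (Suc r) f) q = approx n r (Dt f) q"
proof -
  note 1 = Dt_tpoly_slice[OF _ smooth_Dt[OF f] q]
  have aa: "a \<in> {a..b}" using ab by simp
  have sw: "(Dt ^^ Suc i) f = (Dt ^^ i) (Dt f)" for i by (simp only: funpow_Suc_right o_apply)
  have p0: "tpoly (pderiv ((antideriv a ^^ 0) 1)) q = 0" by (simp add: tpoly_def)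
  have pS: "pderiv ((antideriv a ^^ Suc i) p) = (antideriv a ^^ i) p" for i p by (simp add: antideriv)
  have t0: "Dt (\<lambda>q. tpoly ((antideriv a ^^ 0) 1) q *\<^sub>R slice a ((Dt ^^ 0) f) q) q = 0"
    unfolding 1[OF aa] p0 by simp
  have t1: "Dt (\<lambda>q. tpoly ((antideriv a ^^ Suc i) p) q *\<^sub>R slice c ((Dt ^^ Suc j) f) q) q
    = tpoly ((antideriv a ^^ i) p) q *\<^sub>R slice c ((Dt ^^ j) (Dt f)) q" if "c \<in> {a..b}" for c p i j
    using 1[OF that, of "(antideriv a ^^ Suc i) p" "Suc j"] unfolding pS sw .
  show ?thesis
    unfolding pderiv_on_approx_expand[OF f q] unfolding approx_def sum.lessThan_Suc_shift t0 add_0_left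
    by (intro arg_cong2[where f="(+)"] sum.cong refl t1 aa node_mem) auto
qed

lemma approx_initial:
  assumes "q \<in> Q"
  shows "approx n (Suc r) f (fst q, a, snd (snd q)) = f (fst q, a, snd (snd q))"
proof -
  have z: "tpoly ((antideriv a ^^ Suc i) p) (fst q, a, snd (snd q)) = 0" for i p
    by (simp add: tpoly_def antideriv)
  show ?thesis
    unfolding approx_def sum.lessThan_Suc_shift
    by (simp only: z scaleR_zero_left sum.neutral_const) (simp add: tpoly_def slice_def)
qed

text \<open>At order \<open>0\<close> only the Bernstein operator in \<open>t\<close> remains.
  Uniform continuity on the compact \<open>Q\<close> gives a common modulus, divided by
  \<open>b - a\<close> for the rescaled variable.\<close>

lemma uniform_approx_0:
  assumes f: "smooth Q f" and e: "e > 0"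
  shows "\<exists>N. \<forall>n\<ge>N. \<forall>q\<in>Q. norm (approx n 0 f q - f q) \<le> e"
proof -
  obtain M where M: "M > 0" "\<And>q. q \<in> Q \<Longrightarrow> norm (f q) \<le> M" using smooth_bounded[OF f] by blast
  obtain d where d: "d > 0" "\<And>q q'. q \<in> Q \<Longrightarrow> q' \<in> Q \<Longrightarrow> dist q' q < d \<Longrightarrow> dist (f q') (f q) < e / 2"
    by (rule uniformly_continuous_onE[OF compact_uniformly_continuous[OF smooth_continuous_on[OF f] compact], of "e / 2"])
      (use e in auto)
  define d' where "d' = d / (b - a)"
  have d': "d' > 0" using d ab by (simp add: d'_def)
  obtain N where N: "4 * M / (e * d'\<^sup>2) + 1 \<le> real N" using real_arch_simple by blast
  have "norm (approx n 0 f q - f q) \<le> e" if n: "n \<ge> N" and q: "q \<in> Q" for n q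
  proof -
    obtain w t y where qq: "q = (w, t, y)" and t: "t \<in> {a..b}" using q Q_eq by auto
    define g where "g x = f (w, a + x * (b - a), y)" for x
    have mem: "(w, a + x * (b - a), y) \<in> Q" if "x \<in> {0..1}" for x
    proof -
      have "x * (b - a) \<le> 1 * (b - a)" using that ab by (intro mult_right_mono) auto
      moreover have "0 \<le> x * (b - a)" using that ab by simp
      ultimately show ?thesis using q unfolding Q_eq qq by auto
    qed
    define x where "x = (t - a) / (b - a)"
    have x: "x \<in> {0..1}" "a + x * (b - a) = t" using t ab unfolding x_def by (auto simp: field_simps)
    have "norm ((\<Sum>k\<le>n. Bernstein n k x *\<^sub>R g (k / n)) - g x) \<le> e"
    proof (rule Bernstein_uniform_bound[OF _ d' _ e _ x(1)])
      show "norm (g x) \<le> M" if "x \<in> {0..1}" for x unfolding g_def using M(2) mem that by blast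
      show "4 * M / (e * d'\<^sup>2) + 1 \<le> real n" using N n by linarith
      fix x x' :: real assume xx: "x \<in> {0..1}" "x' \<in> {0..1}" "\<bar>x' - x\<bar> < d'"
      have "dist (w, a + x' * (b - a), y) (w, a + x * (b - a), y) = \<bar>x' - x\<bar> * (b - a)"
        using ab by (simp add: dist_Pair_Pair dist_real_def left_diff_distrib[symmetric] abs_mult)
      also have "\<dots> < d" using xx(3) ab unfolding d'_def by (simp add: pos_less_divide_eq)
      finally show "norm (g x' - g x) \<le> e / 2"
        unfolding g_def using d(2)[OF mem[OF xx(1)] mem[OF xx(2)]] by (simp add: dist_norm)
    qed
    moreover have "approx n 0 f q = (\<Sum>k\<le>n. Bernstein n k x *\<^sub>R g (k / n))"
      by (simp add: approx_def tpoly_def slice_def qq poly_bernstein_poly x_def g_def node_def)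
    moreover have "g x = f q" using x(2) by (simp add: g_def qq)
    ultimately show ?thesis by simp
  qed
  then show ?thesis by blast
qed

text \<open>The derivative is bounded only between the two times, so \<open>B\<close> may depend on
  them; the iterated Taylor estimate relies on this.\<close>

lemma dir_t_bound:
  assumes F: "smooth Q F" and B: "\<And>s. s \<in> closed_segment t t' \<Longrightarrow> norm (Dt F (w, s, y)) \<le> B"
    and q: "(w, t, y) \<in> Q" "(w, t', y) \<in> Q"
  shows "norm (F (w, t, y) - F (w, t', y)) \<le> B * \<bar>t - t'\<bar>"
proof -
  define S where "S = closed_segment t t'"
  have "S \<subseteq> {a..b}" unfolding S_def using q by (intro closed_segment_subset) (auto simp: Q_eq)
  then have mem: "(w, s, y) \<in> Q" if "s \<in> S" for s using q that by (auto simp: Q_eq)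
  have "norm (F (w, t, y) - F (w, t', y)) \<le> B * norm (t - t')"
  proof (rule differentiable_bound[of S "\<lambda>s. F (w, s, y)" "\<lambda>s h. h *\<^sub>R Dt F (w, s, y)"])
    fix s assume s: "s \<in> S"
    have 1: "((\<lambda>s. (w, s, y)) has_derivative (\<lambda>h. (0, h, 0))) (at s within S)"
      by (auto intro!: derivative_eq_intros)
    have 2: "(F has_derivative (\<lambda>v. pderiv_on Q v F (w, s, y))) (at (w, s, y) within (\<lambda>s. (w, s, y)) ` S)"
      by (rule has_derivative_subset[OF pderiv_on_works[OF smooth_differentiable[OF F] mem[OF s]]]) (use mem in auto)
    interpret bounded_linear "\<lambda>v. pderiv_on Q v F (w, s, y)" using 2 has_derivative_bounded_linear by blast
    have eq: "(\<lambda>h. pderiv_on Q (0, h, 0) F (w, s, y)) = (\<lambda>h. h *\<^sub>R Dt F (w, s, y))"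
    proof
      fix h show "pderiv_on Q (0, h, 0) F (w, s, y) = h *\<^sub>R Dt F (w, s, y)"
        using scaleR[of h dir_t] by simp
    qed
    show "((\<lambda>s. F (w, s, y)) has_derivative (\<lambda>h. h *\<^sub>R Dt F (w, s, y))) (at s within S)"
      using diff_chain_within[OF 1 2] by (simp only: o_def eq)
    show "onorm (\<lambda>h. h *\<^sub>R Dt F (w, s, y)) \<le> B"
      using B[of s] s S_def by (intro onorm_le) (simp add: mult.commute[of B] mult_left_mono)
  qed (simp_all add: S_def)
  then show ?thesis by simp
qed

text \<open>Each derivative removed is recovered by integration from \<open>t = a\<close>, where the
  expansion of positive order is exact; this costs one factor \<open>b - a\<close>.\<close>

lemma approx_error:
  assumes g: "smooth Q g" and \<eta>: "\<And>q. q \<in> Q \<Longrightarrow> norm (approx n 0 ((Dt ^^ r) g) q - (Dt ^^ r) g q) \<le> \<eta>"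
    and j: "j \<le> r" and q: "q \<in> Q"
  shows "norm (approx n j ((Dt ^^ (r - j)) g) q - (Dt ^^ (r - j)) g q) \<le> \<eta> * (b - a) ^ j"
  using j q
proof (induction j arbitrary: q)
  case 0
  then show ?case using \<eta> by simp
next
  case (Suc j)
  define h where "h = (Dt ^^ (r - Suc j)) g"
  have h: "smooth Q h" unfolding h_def by (rule smooth_Dt[OF g])
  have Dh: "Dt h = (Dt ^^ (r - j)) g" 
  proof -
    have "r - j = Suc (r - Suc j)" using Suc.prems(1) by simp
    then show ?thesis unfolding h_def by (simp only: funpow.simps o_apply)
  qed
  define F where "F q = approx n (Suc j) h q - h q" for q
  have F: "smooth Q F" unfolding F_def by (intro smooth_diff smooth_approx h)
  have "Dt F q = approx n j (Dt h) q - Dt h q" if "q \<in> Q" for q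
    unfolding F_def using pderiv_on_minus_eq[OF smooth_approx[OF h] h that] Dt_approx[OF h that] by simp
  then have DF: "norm (Dt F q) \<le> \<eta> * (b - a) ^ j" if "q \<in> Q" for q
    using Suc that by (simp add: Dh)
  obtain w t y where qq: "q = (w, t, y)" and t: "t \<in> {a..b}" using Suc.prems(2) Q_eq by auto
  have mem: "(w, s, y) \<in> Q" if "s \<in> closed_segment t a" for s
    using that t Suc.prems(2) ab by (auto simp: Q_eq qq closed_segment_eq_real_ivl split: if_splits)
  have q': "(w, a, y) \<in> Q" using Suc.prems(2) ab by (auto simp: Q_eq qq)
  have "F (w, a, y) = 0" unfolding F_def using approx_initial[OF q', of n j h] by simp
  then have "norm (F q) \<le> \<eta> * (b - a) ^ j * \<bar>t - a\<bar>"
    using dir_t_bound[OF F _ Suc.prems(2)[unfolded qq] q', of "\<eta> * (b - a) ^ j"] DF mem by (simp add: qq)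
  also have "\<dots> \<le> \<eta> * (b - a) ^ j * (b - a)"
    using t order_trans[OF norm_ge_zero DF[OF q']] by (intro mult_left_mono) auto
  finally show ?case unfolding F_def h_def by (simp add: mult_ac)
qed

text \<open>Time derivatives are moved to the end, where they are applied last. The resulting
  \<open>k\<close> and \<open>cs\<close> do not depend on \<open>f\<close>, so the same reordering
  serves a map and its approximation.\<close>

lemma pderivs_on_normal_order:
  assumes "set bs \<subseteq> Basis"
  shows "\<exists>k cs. k + length cs = length bs \<and> set cs \<subseteq> Basis - {dir_t} \<and>
    (\<forall>f :: 'm pt \<Rightarrow> 'b::real_inner. smooth Q f \<longrightarrow> (\<forall>q\<in>Q. pderivs_on Q bs f q = (Dt ^^ k) (pderivs_on Q cs f) q))"
  using assms
proof (induction bs)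
  case Nil
  show ?case by (rule exI[of _ 0], rule exI[of _ "[]"]) simp
next
  case (Cons c bs)
  then obtain k cs where IH: "k + length cs = length bs" "set cs \<subseteq> Basis - {dir_t}"
    "\<And>(f :: 'm pt \<Rightarrow> 'b) q. smooth Q f \<Longrightarrow> q\<in>Q \<Longrightarrow> pderivs_on Q bs f q = (Dt ^^ k) (pderivs_on Q cs f) q"
    by auto
  have c: "pderivs_on Q (c # bs) f q = pderiv_on Q c ((Dt ^^ k) (pderivs_on Q cs f)) q"
    if "smooth Q f" "q \<in> Q" for f :: "'m pt \<Rightarrow> 'b" and q
    unfolding pderivs_on.simps by (rule pderiv_on_cong[OF IH(3)]) (use that in auto)
  show ?case
  proof (cases "c = dir_t")
    case True
    then show ?thesis using IH(1,2) c by (intro exI[of _ "Suc k"] exI[of _ cs]) simp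
  next
    case False
    have "pderivs_on Q (c # bs) f q = (Dt ^^ k) (pderivs_on Q (c # cs) f) q"
      if "smooth Q f" "q \<in> Q" for f :: "'m pt \<Rightarrow> 'b" and q
      using c[OF that] pderiv_on_Dt_commute[OF smooth_pderivs_on[OF that(1)] that(2)] by simp
    then show ?thesis using IH(1,2) False Cons.prems by (intro exI[of _ k] exI[of _ "c # cs"]) auto
  qed
qed

lemma Basis_not_dir_t:
  fixes c :: "'m pt"
  assumes "c \<in> Basis" "c \<noteq> dir_t" obtains u v where "c = (u, 0, v)"
  using assms that by (auto simp: Basis_prod_def zero_prod_def)

lemma pderivs_on_approx:
  fixes f :: "'m pt \<Rightarrow> 'b::real_inner"
  assumes "smooth Q f" "set cs \<subseteq> Basis - {dir_t}" "q \<in> Q"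
  shows "pderivs_on Q cs (approx n r f) q = approx n r (pderivs_on Q cs f) q"
  using assms(2,3)
proof (induction cs arbitrary: q)
  case (Cons c cs)
  obtain u v where c: "c = (u, 0, v)" using Cons.prems Basis_not_dir_t[of c] by auto
  have "pderivs_on Q (c # cs) (approx n r f) q = pderiv_on Q c (approx n r (pderivs_on Q cs f)) q"
    unfolding pderivs_on.simps by (rule pderiv_on_cong[OF Cons.IH]) (use Cons in auto)
  also have "\<dots> = approx n r (pderiv_on Q c (pderivs_on Q cs f)) q"
    unfolding c by (rule pderiv_on_approx[OF smooth_pderivs_on[OF assms(1)]]) (use Cons in auto)
  finally show ?case by simp
qed simp

lemma Dt_power_approx:
  assumes "smooth Q f" "q \<in> Q" "k \<le> r"
  shows "(Dt ^^ k) (approx n r f) q = approx n (r - k) ((Dt ^^ k) f) q"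
  using assms(2,3)
proof (induction k arbitrary: q)
  case (Suc k)
  have "(Dt ^^ Suc k) (approx n r f) q = Dt (approx n (r - k) ((Dt ^^ k) f)) q"
    unfolding funpow.simps o_apply by (rule pderiv_on_cong[OF Suc.IH]) (use Suc in auto)
  also have "\<dots> = Dt (approx n (Suc (r - Suc k)) ((Dt ^^ k) f)) q"
    using Suc.prems by (simp add: Suc_diff_Suc)
  finally show ?case using Dt_approx[OF smooth_Dt[OF assms(1)] Suc.prems(1)] by simp
qed simp

theorem approx_converges:
  fixes X :: "'m pt \<Rightarrow> 'b::real_inner"
  assumes X: "smooth Q X" and \<epsilon>: "\<epsilon> > 0"
  obtains n where "C_norm Q r (\<lambda>q. approx n r X q - X q) < \<epsilon>"
proof -
  define L where "L = max 1 (b - a)"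
  have L: "L \<ge> 1" "b - a \<le> L" "b - a \<ge> 0" unfolding L_def using ab by auto
  \<comment> \<open>Absorbs the factors \<open>b - a\<close> from at most \<open>r\<close>
    integrations; \<open>L \<ge> 1\<close> makes \<open>L ^ r\<close> dominate the lower
    powers.\<close>
  define \<eta> where "\<eta> = \<epsilon> / (2 * L ^ r)"
  have Lr: "L ^ r > 0" using L(1) by simp
  have \<eta>: "\<eta> > 0" unfolding \<eta>_def using \<epsilon> Lr by simp
  let ?S = "{cs. set cs \<subseteq> (Basis::'m pt set) \<and> length cs \<le> r}"
  have fin: "finite ?S" using finite_lists_length_le[of Basis r] by auto
  have "\<forall>cs. \<exists>N. \<forall>n\<ge>N. \<forall>q\<in>Q. norm (approx n 0 ((Dt ^^ r) (pderivs_on Q cs X)) q - (Dt ^^ r) (pderivs_on Q cs X) q) \<le> \<eta>"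
    by (intro allI uniform_approx_0 smooth_Dt smooth_pderivs_on X \<eta>)
  then obtain N where N: "\<And>cs n q. n \<ge> N cs \<Longrightarrow> q \<in> Q \<Longrightarrow>
     norm (approx n 0 ((Dt ^^ r) (pderivs_on Q cs X)) q - (Dt ^^ r) (pderivs_on Q cs X) q) \<le> \<eta>" by metis
  \<comment> \<open>Only finitely many lists of spatial derivatives of length at most
    \<open>r\<close> occur, so a common degree exists.\<close>
  define n where "n = Max (N ` ?S)"
  have n: "n \<ge> N cs" if "cs \<in> ?S" for cs unfolding n_def using that fin by (intro Max_ge) auto
  have "norm (pderivs_on Q bs (\<lambda>q. approx n r X q - X q) q) \<le> \<epsilon> / 2"
    if bs: "set bs \<subseteq> Basis" "length bs \<le> r" and q: "q \<in> Q" for bs q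
  proof -
    obtain k cs where k: "k + length cs = length bs" "set cs \<subseteq> Basis - {dir_t}"
      "\<And>f :: 'm pt \<Rightarrow> 'b. smooth Q f \<Longrightarrow> pderivs_on Q bs f q = (Dt ^^ k) (pderivs_on Q cs f) q"
      using pderivs_on_normal_order[OF bs(1), where 'b='b] q by blast
    have kr: "k \<le> r" using k(1) bs by simp
    define g where "g = pderivs_on Q cs X"
    have g: "smooth Q g" unfolding g_def by (rule smooth_pderivs_on[OF X])
    have "pderivs_on Q bs (approx n r X) q = (Dt ^^ k) (pderivs_on Q cs (approx n r X)) q"
      by (rule k(3)[OF smooth_approx[OF X]])
    also have "\<dots> = (Dt ^^ k) (approx n r g) q"
      unfolding g_def by (rule Dt_cong[OF pderivs_on_approx[OF X k(2)] q])
    also have "\<dots> = approx n (r - k) ((Dt ^^ k) g) q"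
      by (rule Dt_power_approx[OF g q kr])
    finally have "pderivs_on Q bs (\<lambda>q. approx n r X q - X q) q = approx n (r - k) ((Dt ^^ k) g) q - (Dt ^^ k) g q"
      using pderivs_on_diff[OF smooth_approx[OF X] X q] k(3)[OF X] by (simp add: g_def)
    also have "norm \<dots> \<le> \<eta> * (b - a) ^ (r - k)"
    proof -
      have "cs \<in> ?S" using k(1,2) bs by auto
      then have "\<And>q. q \<in> Q \<Longrightarrow> norm (approx n 0 ((Dt ^^ r) g) q - (Dt ^^ r) g q) \<le> \<eta>"
        unfolding g_def using N n by blast
      from approx_error[OF g this, of "r - k" q] show ?thesis using kr q by simp
    qed
    also have "\<dots> \<le> \<eta> * L ^ r"
    proof -
      have "(b - a) ^ (r - k) \<le> L ^ (r - k)" using L by (intro power_mono) auto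
      also have "\<dots> \<le> L ^ r" using L by (intro power_increasing) auto
      finally show ?thesis using \<eta> by (intro mult_left_mono) auto
    qed
    also have "\<dots> = \<epsilon> / 2" unfolding \<eta>_def using L(1) by simp
    finally show ?thesis .
  qed
  then have "C_norm Q r (\<lambda>q. approx n r X q - X q) \<le> \<epsilon> / 2" by (rule C_norm_le)
  then show ?thesis using \<epsilon> by (intro that[of n]) linarith
qed

text \<open>The coefficients are arbitrary functions of \<open>w\<close> and \<open>y\<close>. Their
  uniform bound is what later confines the lifted lines to a compact box.\<close>

definition polynomial_in_t :: "nat \<Rightarrow> ('m pt \<Rightarrow> 'b::real_normed_vector) \<Rightarrow> bool" where
  "polynomial_in_t M F \<longleftrightarrow> (\<exists>c B. \<forall>w\<in>W. \<forall>y\<in>Y.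
     (\<forall>t\<in>{a..b}. F (w, t, y) = (\<Sum>j\<le>M. t ^ j *\<^sub>R c j w y)) \<and> (\<forall>j. norm (c j w y :: 'b) \<le> B))"

lemma polynomial_in_t_mono: assumes "polynomial_in_t M F" "M \<le> M'" shows "polynomial_in_t M' F"
proof -
  obtain c B where c: "\<And>w y t. w \<in> W \<Longrightarrow> y \<in> Y \<Longrightarrow> t \<in> {a..b} \<Longrightarrow> F (w, t, y) = (\<Sum>j\<le>M. t ^ j *\<^sub>R c j w y)"
    "\<And>w y j. w \<in> W \<Longrightarrow> y \<in> Y \<Longrightarrow> norm (c j w y) \<le> B"
    using assms(1) unfolding polynomial_in_t_def by metis
  define c' where "c' j w y = (if j \<le> M then c j w y else 0)" for j w y
  have "(\<Sum>j\<le>M'. t ^ j *\<^sub>R c' j w y) = (\<Sum>j\<le>M. t ^ j *\<^sub>R c j w y)" for t w y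
    using assms(2) by (intro sum.mono_neutral_cong_right) (auto simp: c'_def)
  moreover have "norm (c' j w y) \<le> max 0 B" if "w \<in> W" "y \<in> Y" for j w y
    using c(2)[OF that, of j] by (auto simp: c'_def)
  ultimately show ?thesis unfolding polynomial_in_t_def using c(1) by (intro exI[of _ c'] exI[of _ "max 0 B"]) auto
qed

lemma polynomial_in_t_add:
  assumes "polynomial_in_t M F" "polynomial_in_t M G" shows "polynomial_in_t M (\<lambda>q. F q + G q)"
proof -
  obtain c B where c: "\<And>w y t. w \<in> W \<Longrightarrow> y \<in> Y \<Longrightarrow> t \<in> {a..b} \<Longrightarrow> F (w, t, y) = (\<Sum>j\<le>M. t ^ j *\<^sub>R c j w y)"
    "\<And>w y j. w \<in> W \<Longrightarrow> y \<in> Y \<Longrightarrow> norm (c j w y) \<le> B"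
    using assms(1) unfolding polynomial_in_t_def by metis
  obtain c' B' where c': "\<And>w y t. w \<in> W \<Longrightarrow> y \<in> Y \<Longrightarrow> t \<in> {a..b} \<Longrightarrow> G (w, t, y) = (\<Sum>j\<le>M. t ^ j *\<^sub>R c' j w y)"
    "\<And>w y j. w \<in> W \<Longrightarrow> y \<in> Y \<Longrightarrow> norm (c' j w y) \<le> B'"
    using assms(2) unfolding polynomial_in_t_def by metis
  show ?thesis unfolding polynomial_in_t_def
  proof (intro exI ballI conjI allI)
    fix w y t assume "w \<in> W" "y \<in> Y" "t \<in> {a..b}"
    then show "F (w, t, y) + G (w, t, y) = (\<Sum>j\<le>M. t ^ j *\<^sub>R (c j w y + c' j w y))"
      by (simp only: c(1) c'(1) scaleR_add_right sum.distrib)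
  next
    fix w y j assume "w \<in> W" "y \<in> Y"
    then show "norm (c j w y + c' j w y) \<le> B + B'"
      by (intro norm_triangle_le add_mono c(2) c'(2))
  qed
qed

lemma polynomial_in_t_tpoly_slice:
  assumes "c \<in> {a..b}" "smooth Q f" shows "\<exists>M. polynomial_in_t M (\<lambda>q. tpoly p q *\<^sub>R slice c f q)"
proof -
  obtain B where B: "B > 0" "\<And>q. q \<in> Q \<Longrightarrow> norm (f q) \<le> B" using smooth_bounded[OF assms(2)] by blast
  obtain K where K: "\<And>j. j \<le> degree p \<Longrightarrow> \<bar>coeff p j\<bar> \<le> K"
  proof
    fix j assume "j \<le> degree p"
    then show "\<bar>coeff p j\<bar> \<le> Max ((\<lambda>j. \<bar>coeff p j\<bar>) ` {..degree p})" by (intro Max_ge) auto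
  qed
  have "\<bar>coeff p j\<bar> \<le> max K 0" for j using K[of j] by (cases "j \<le> degree p") (auto simp: coeff_eq_0)
  then have "norm (coeff p j *\<^sub>R f (w, c, y)) \<le> max K 0 * B" if "w \<in> W" "y \<in> Y" for j w y
    using B(2)[of "(w, c, y)"] that assms(1) B(1) by (auto simp: Q_eq intro!: mult_mono)
  then have "polynomial_in_t (degree p) (\<lambda>q. tpoly p q *\<^sub>R slice c f q)"
    unfolding polynomial_in_t_def
    by (intro exI[of _ "\<lambda>j w y. coeff p j *\<^sub>R f (w, c, y)"] exI[of _ "max K 0 * B"])
       (auto simp: tpoly_def slice_def poly_altdef scaleR_sum_left mult.commute)
  then show ?thesis ..
qed

lemma polynomial_in_t_sum:
  assumes "finite A" "\<And>i. i \<in> A \<Longrightarrow> \<exists>M. polynomial_in_t M (f i)"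
  shows "\<exists>M. polynomial_in_t M (\<lambda>q. \<Sum>i\<in>A. f i q)"
  using assms
proof (induction A rule: finite_induct)
  case empty
  have "polynomial_in_t 0 (\<lambda>_. 0 :: 'b)" unfolding polynomial_in_t_def
    by (intro exI[of _ "\<lambda>_ _ _. 0"] exI[of _ 0]) auto
  then show ?case by auto
next
  case (insert i A)
  obtain M1 where "polynomial_in_t M1 (f i)" using insert.prems[OF insertI1] by (rule exE)
  moreover have "\<exists>M. polynomial_in_t M (\<lambda>q. \<Sum>i\<in>A. f i q)" by (rule insert.IH, rule insert.prems) simp
  then obtain M2 where "polynomial_in_t M2 (\<lambda>q. \<Sum>i\<in>A. f i q)" by (rule exE)
  ultimately  have "polynomial_in_t (max M1 M2) (\<lambda>q. f i q + (\<Sum>i\<in>A. f i q))"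
    using polynomial_in_t_add polynomial_in_t_mono[OF _ max.cobounded1] polynomial_in_t_mono[OF _ max.cobounded2] by blast
  then show ?case unfolding sum.insert[OF insert.hyps] by (rule exI)
qed

lemma polynomial_in_t_approx:
  assumes f: "smooth Q f" shows "\<exists>M. polynomial_in_t M (approx n r f)"
proof -
  have "\<exists>M. polynomial_in_t M (\<lambda>q. \<Sum>i<r. tpoly ((antideriv a ^^ i) 1) q *\<^sub>R slice a ((Dt ^^ i) f) q)"
    using ab by (intro polynomial_in_t_sum polynomial_in_t_tpoly_slice smooth_Dt f) auto
  moreover have "\<exists>M. polynomial_in_t M (\<lambda>q. \<Sum>k\<le>n. tpoly ((antideriv a ^^ r) (bernstein_poly a b n k)) q *\<^sub>R slice (node n k) ((Dt ^^ r) f) q)"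
    using ab by (intro polynomial_in_t_sum polynomial_in_t_tpoly_slice smooth_Dt f node_mem) auto
  ultimately show ?thesis
  proof (elim exE)
    fix M1 M2 assume M: "polynomial_in_t M1 (\<lambda>q. \<Sum>i<r. tpoly ((antideriv a ^^ i) 1) q *\<^sub>R slice a ((Dt ^^ i) f) q)"
    "polynomial_in_t M2 (\<lambda>q. \<Sum>k\<le>n. tpoly ((antideriv a ^^ r) (bernstein_poly a b n k)) q *\<^sub>R slice (node n k) ((Dt ^^ r) f) q)"
  have "polynomial_in_t (max M1 M2) (approx n r f)"
      unfolding approx_def by (intro polynomial_in_t_add polynomial_in_t_mono[OF M(1)] polynomial_in_t_mono[OF M(2)]) auto
    then show ?thesis by (rule exI)
  qed
qed

end

section \<open>Hausdorff dimension and covers\<close>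

text \<open>A content without restriction on the mesh, with prescribed positive upper bounds
  \<open>r i\<close> in place of diameters. For \<open>s > 0\<close> it has the same null sets as
  the Hausdorff measure, and null sets are all that the dimension sees.\<close>

definition cover_content :: "('a \<Rightarrow> 'a \<Rightarrow> real) \<Rightarrow> real \<Rightarrow> 'a set \<Rightarrow> ennreal" where
  "cover_content d s S = (INF (U, r)\<in>{(U :: nat \<Rightarrow> 'a set, r).
     S \<subseteq> (\<Union>i. U i) \<and> (\<forall>i. 0 < r i \<and> (\<forall>x\<in>U i. \<forall>y\<in>U i. d x y \<le> r i))}. \<Sum>i. ennreal (r i powr s))"

lemma cover_content_le:
  assumes "S \<subseteq> (\<Union>i. U i)" "\<And>i. 0 < r i" "\<And>i x y. x \<in> U i \<Longrightarrow> y \<in> U i \<Longrightarrow> d x y \<le> r i"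
  shows "cover_content d s S \<le> (\<Sum>i. ennreal (r i powr s))"
  unfolding cover_content_def by (rule INF_lower2[of "(U, r)"]) (use assms in auto)

lemma cover_content_less:
  assumes "cover_content d s S < c"
  shows "\<exists>U r. S \<subseteq> (\<Union>i. U i) \<and> (\<forall>i. 0 < r i) \<and> (\<forall>i. \<forall>x\<in>U i. \<forall>y\<in>U i. d x y \<le> r i) \<and>
    (\<Sum>i. ennreal (r i powr s)) < c"
proof -
  obtain U r where "S \<subseteq> (\<Union>i. U i)" "\<forall>i. 0 < r i \<and> (\<forall>x\<in>U i. \<forall>y\<in>U i. d x y \<le> r i)"
    "(\<Sum>i. ennreal (r i powr s)) < c"
    using assms unfolding cover_content_def INF_less_iff by auto
  then show ?thesis by blast
qed

lemma cover_content_mono: "S \<subseteq> T \<Longrightarrow> cover_content d s S \<le> cover_content d s T"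
  unfolding cover_content_def by (rule INF_superset_mono) auto

lemma powr_inverse_powr:
  fixes s :: real
  assumes "s > 0" "c \<ge> 0" shows "(c powr (1 / s)) powr s = c"
  using assms by (simp add: powr_powr)

lemma suminf_geometric_ennreal:
  assumes "e \<ge> 0" shows "(\<Sum>n. ennreal (e * (1/2)^Suc n)) = ennreal e"
  using assms sums_mult[OF power_half_series, of e] by (intro suminf_ennreal_eq) auto

text \<open>One set covers, but every index must carry a positive radius; the empty sets get radii
  whose total cost is an arbitrarily small geometric series.\<close>

lemma cover_content_bounded:
  assumes s: "s > 0" and r: "r > 0" and d: "\<And>x y. x \<in> S \<Longrightarrow> y \<in> S \<Longrightarrow> d x y \<le> r"
  shows "cover_content d s S \<le> ennreal (r powr s)"
proof (rule ennreal_le_epsilon)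
  fix e :: real assume e: "0 < e"
  define U where "U i = (if i = 0 then S else {})" for i :: nat
  define \<rho> where "\<rho> i = (if i = 0 then r else (e * (1/2)^Suc i) powr (1 / s))" for i
  have "cover_content d s S \<le> (\<Sum>i. ennreal (\<rho> i powr s))"
    by (rule cover_content_le[of S U \<rho>])
      (use r d e in \<open>auto simp: U_def \<rho>_def split: if_splits\<close>)
  also have "\<dots> \<le> (\<Sum>i. (if i = 0 then ennreal (r powr s) else 0) + ennreal (e * (1/2)^Suc i))"
    using e s by (intro suminf_le) (auto simp: \<rho>_def powr_inverse_powr simp del: power_Suc)
  also have "\<dots> = (\<Sum>i::nat. if i = 0 then ennreal (r powr s) else 0) + (\<Sum>i. ennreal (e * (1/2)^Suc i))"
    by (rule suminf_add[symmetric]) auto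
  also have "(\<Sum>i::nat. if i = 0 then ennreal (r powr s) else 0) = (\<Sum>i\<in>{0::nat}. if i = 0 then ennreal (r powr s) else 0)"
    by (rule suminf_finite) auto
  also have "(\<Sum>i. ennreal (e * (1/2)^Suc i)) = ennreal e"
    using e by (intro suminf_geometric_ennreal) auto
  finally show "cover_content d s S \<le> ennreal (r powr s) + ennreal e" by simp
qed

lemma ennreal_eq_0_if_le:
  assumes "\<And>e. e > 0 \<Longrightarrow> x \<le> ennreal e" shows "x = 0"
proof -
  have "x \<le> 0" by (rule ennreal_le_epsilon) (simp add: assms)
  then show ?thesis by simp
qed

lemma ennreal_le_suminf: "f i \<le> (\<Sum>i. f i :: ennreal)" for f :: "nat \<Rightarrow> ennreal"
proof -
  have "sum f {i} \<le> suminf f" by (rule sum_le_suminf) auto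
  then show ?thesis by simp
qed

lemma cover_content_empty: "s > 0 \<Longrightarrow> cover_content d s {} = 0"
proof -
  assume s: "s > 0"
  have "cover_content d s {} \<le> ennreal e" if e: "e > 0" for e
    using cover_content_bounded[of s "e powr (1 / s)" "{}" d] s e by (simp add: powr_inverse_powr)
  then show ?thesis by (rule ennreal_eq_0_if_le)
qed

lemma cover_content_UN:
  "cover_content d s (\<Union>i. A i) \<le> (\<Sum>i::nat. cover_content d s (A i))"
proof (rule ennreal_le_epsilon)
  fix e :: real assume e: "0 < e" and fin: "(\<Sum>i. cover_content d s (A i)) < top"
  have lt: "cover_content d s (A n) < cover_content d s (A n) + ennreal (e * (1/2)^Suc n)" for n
    using e fin by (auto simp add: less_top dest!: ennreal_suminf_lessD)
  have "\<exists>U r. A n \<subseteq> (\<Union>i. U i) \<and> (\<forall>i. 0 < r i) \<and> (\<forall>i. \<forall>x\<in>U i. \<forall>y\<in>U i. d x y \<le> r i) \<and>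
     (\<Sum>i. ennreal (r i powr s)) \<le> cover_content d s (A n) + ennreal (e * (1/2)^Suc n)" for n
    using cover_content_less[OF lt[of n]] by (elim exE conjE) (intro exI conjI; (assumption | erule less_imp_le))
  then obtain U r where U: "\<And>n. A n \<subseteq> (\<Union>i. U n i)" "\<And>n i. 0 < r n i"
    "\<And>n i x y. x \<in> U n i \<Longrightarrow> y \<in> U n i \<Longrightarrow> d x y \<le> r n i"
    "\<And>n. (\<Sum>i. ennreal (r n i powr s)) \<le> cover_content d s (A n) + ennreal (e * (1/2)^Suc n)" by metis
  have "cover_content d s (\<Union>i. A i) \<le> (\<Sum>k. ennreal (case_prod r (prod_decode k) powr s))"
  proof (rule cover_content_le)
    show "(\<Union>i. A i) \<subseteq> (\<Union>k. case_prod U (prod_decode k))"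
    proof
      fix x assume "x \<in> (\<Union>i. A i)"
      then obtain n i where "x \<in> U n i" using U(1) by blast
      then have "x \<in> case_prod U (prod_decode (prod_encode (n, i)))" by simp
      then show "x \<in> (\<Union>k. case_prod U (prod_decode k))" by (rule UN_I[OF UNIV_I])
    qed
  qed (auto split: prod.split simp: U(2,3))
  also have "\<dots> = (\<Sum>n. \<Sum>i. ennreal (r n i powr s))"
    by (rule suminf_ennreal_2dimen[of _ "\<lambda>p. ennreal (case_prod r p powr s)"]) simp
  also have "\<dots> \<le> (\<Sum>n. cover_content d s (A n) + ennreal (e * (1/2)^Suc n))"
    by (intro suminf_le U) auto
  also have "\<dots> = (\<Sum>n. cover_content d s (A n)) + (\<Sum>n. ennreal (e * (1/2)^Suc n))"
    by (rule suminf_add[symmetric]) auto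
  also have "\<dots> = (\<Sum>n. cover_content d s (A n)) + ennreal e"
    by (simp only: suminf_geometric_ennreal[OF less_imp_le[OF e]])
  finally show "cover_content d s (\<Union>i. A i) \<le> (\<Sum>n. cover_content d s (A n)) + ennreal e" .
qed

lemma cover_content_Union:
  assumes "finite \<C>" "s > 0"
  shows "cover_content d s (\<Union>\<C>) \<le> (\<Sum>c\<in>\<C>. cover_content d s c)"
  using assms(1)
proof (induction \<C> rule: finite_induct)
  case empty
  then show ?case using assms(2) by (simp add: cover_content_empty)
next
  case (insert c \<C>)
  define A where "A i = (if i = 0 then c else if i = 1 then \<Union>\<C> else {})" for i :: nat
  have "\<Union>(insert c \<C>) = (\<Union>i. A i)" unfolding A_def by (auto split: if_splits)
  then have "cover_content d s (\<Union>(insert c \<C>)) \<le> (\<Sum>i. cover_content d s (A i))"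
    using cover_content_UN by metis
  also have "\<dots> = (\<Sum>i\<in>{0,1}. cover_content d s (A i))"
    by (rule suminf_finite) (auto simp: A_def cover_content_empty assms(2))
  also have "\<dots> \<le> cover_content d s c + (\<Sum>c\<in>\<C>. cover_content d s c)"
    using insert.IH by (simp add: A_def add_left_mono)
  finally show ?case using insert by simp
qed

lemma ediam_bounds:
  assumes "ediam d U \<le> ennreal \<delta>" "x \<in> U" "y \<in> U" shows "d x y \<le> enn2real (ediam d U)"
proof -
  have "ennreal (d x y) \<le> ediam d U"
    unfolding ediam_def using assms by (intro SUP_upper2[of x] SUP_upper2[of y]) auto
  moreover have "ediam d U < top" using assms(1) by (simp add: le_less_trans)
  ultimately show ?thesis by (metis enn2real_mono enn2real_nonneg ennreal_le_iff2 ennreal_enn2real less_irrefl linorder_not_le order_trans ennreal_le_iff)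
qed

text \<open>Diameters may be zero, whereas the radii here are positive; raising each to a minimum
  with geometric total cost \<open>e / 2\<close> bridges this.\<close>

lemma cover_content_0_if_hausdorff_measure_0:
  assumes s: "s > 0" and H: "hausdorff_measure d s S = 0"
  shows "cover_content d s S = 0"
proof -
  have "hausdorff_content d s 1 S \<le> hausdorff_measure d s S"
    unfolding hausdorff_measure_def by (rule SUP_upper) simp
  then have C: "hausdorff_content d s 1 S = 0" using H by simp
  have "cover_content d s S \<le> ennreal e" if e: "e > 0" for e
  proof -
    have "hausdorff_content d s 1 S < ennreal (e / 2)" using C e by simp
    then obtain U where U: "S \<subseteq> (\<Union>i. U i)" "\<And>i. ediam d (U i) \<le> ennreal 1"
      "(\<Sum>i. ennreal (enn2real (ediam d (U i)) powr s)) < ennreal (e / 2)"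
      unfolding hausdorff_content_def INF_less_iff by auto
    define r where "r i = max (enn2real (ediam d (U i))) ((e / 2 * (1/2)^Suc i) powr (1 / s))" for i
    have "cover_content d s S \<le> (\<Sum>i. ennreal (r i powr s))"
      using U(1) ediam_bounds[OF U(2)] e unfolding r_def by (intro cover_content_le[of S U]) (auto simp: less_max_iff_disj le_max_iff_disj)
    also have "\<dots> \<le> (\<Sum>i. ennreal (enn2real (ediam d (U i)) powr s) + ennreal (e / 2 * (1/2)^Suc i))"
    proof (intro suminf_le)
      fix i
      have "r i powr s \<le> enn2real (ediam d (U i)) powr s + e / 2 * (1/2)^Suc i"
        unfolding r_def using e s by (auto simp: max_def powr_inverse_powr simp del: power_Suc)
      then show "ennreal (r i powr s) \<le> ennreal (enn2real (ediam d (U i)) powr s) + ennreal (e / 2 * (1/2)^Suc i)"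
        using e by (simp flip: ennreal_plus add: ennreal_leI del: power_Suc)
    qed auto
    also have "\<dots> = (\<Sum>i. ennreal (enn2real (ediam d (U i)) powr s)) + (\<Sum>i. ennreal (e / 2 * (1/2)^Suc i))"
      by (rule suminf_add[symmetric]) auto
    also have "\<dots> \<le> ennreal (e / 2) + ennreal (e / 2)"
      by (rule add_mono[OF less_imp_le[OF U(3)] eq_refl[OF suminf_geometric_ennreal]]) (use e in simp)
    finally show ?thesis using e by (simp flip: ennreal_plus)
  qed
  then show ?thesis by (rule ennreal_eq_0_if_le)
qed

text \<open>A total cost below \<open>\<delta> powr s\<close> forces every single radius below
  \<open>\<delta>\<close>, so a cheap cover is automatically fine.\<close>

lemma hausdorff_measure_0_if_cover_content_0:
  assumes s: "s > 0" and C: "cover_content d s S = 0"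
  shows "hausdorff_measure d s S = 0"
proof -
  have "hausdorff_content d s \<delta> S \<le> ennreal e" if \<delta>: "\<delta> > 0" and e: "e > 0" for \<delta> e
  proof -
    have "cover_content d s S < ennreal (min e (\<delta> powr s))" using C \<delta> e by simp
    from cover_content_less[OF this] obtain U r where U: "S \<subseteq> (\<Union>i. U i)" "\<And>i. 0 < r i" "\<And>i x y. x \<in> U i \<Longrightarrow> y \<in> U i \<Longrightarrow> d x y \<le> r i"
      "(\<Sum>i. ennreal (r i powr s)) < ennreal (min e (\<delta> powr s))" by blast
    have dr: "ediam d (U i) \<le> ennreal (r i)" for i
      unfolding ediam_def using U(3) by (intro SUP_least ennreal_leI) auto
    have "ennreal (r i powr s) \<le> (\<Sum>i. ennreal (r i powr s))" for i
      by (rule ennreal_le_suminf)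
    then have "ennreal (r i powr s) < ennreal (min e (\<delta> powr s))" for i
      using U(4) by (rule le_less_trans)
    then have "r i powr s < \<delta> powr s" for i by (simp add: ennreal_less_iff)
    then have "r i \<le> \<delta>" for i
      using powr_mono2[of s \<delta> "r i"] s \<delta> by (metis less_imp_le linorder_not_le)
    then have "ediam d (U i) \<le> ennreal \<delta>" for i using dr order_trans ennreal_leI by blast
    then have "hausdorff_content d s \<delta> S \<le> (\<Sum>i. ennreal (enn2real (ediam d (U i)) powr s))"
      unfolding hausdorff_content_def using U(1) by (intro INF_lower) auto
    also have "\<dots> \<le> (\<Sum>i. ennreal (r i powr s))"
    proof (intro suminf_le ennreal_leI powr_mono2)
      show "enn2real (ediam d (U i)) \<le> r i" for i
        using dr[of i] U(2)[of i] enn2real_leI by (metis less_imp_le)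
    qed (use s in auto)
    also have "\<dots> \<le> ennreal e" by (rule order_trans[OF less_imp_le[OF U(4)]], rule ennreal_leI) simp
    finally show ?thesis by simp
  qed
  then have "hausdorff_content d s \<delta> S = 0" if "\<delta> > 0" for \<delta>
    using that by (intro ennreal_eq_0_if_le)
  then show ?thesis unfolding hausdorff_measure_def by (intro antisym SUP_least) auto
qed

text \<open>Pulling back along a map with \<open>k\<close>-dimensional fibres: the part over a set
  of size \<open>r\<close> splits into about \<open>r^(-k)\<close> pieces of size about
  \<open>r\<close>, and raising the exponent by \<open>k\<close> compensates their number.\<close>

lemma cover_content_preimage:
  fixes k :: nat
  assumes s: "s > 0" and C: "C > 0" and S: "cover_content d s S = 0" and G: "G ` T \<subseteq> S"
    and cov: "\<And>U r. 0 < r \<Longrightarrow> r \<le> 1 \<Longrightarrow> (\<And>x y. x \<in> U \<Longrightarrow> y \<in> U \<Longrightarrow> d x y \<le> r) \<Longrightarrow>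
      \<exists>\<C>. finite \<C> \<and> real (card \<C>) \<le> C / r ^ k \<and> {x\<in>T. G x \<in> U} \<subseteq> \<Union>\<C> \<and>
        (\<forall>c\<in>\<C>. \<forall>x\<in>c. \<forall>y\<in>c. d' x y \<le> C * r)"
  shows "cover_content d' (s + real k) T = 0"
proof -
  define C' where "C' = C * C powr (s + real k)"
  have C': "C' > 0" unfolding C'_def using C by simp
  have "cover_content d' (s + real k) T \<le> ennreal e" if e: "e > 0" for e
  proof -
    \<comment> \<open>The bound \<open>1\<close> forces all radii to be at most \<open>1\<close>, as
      the covering hypothesis demands.\<close>
    have "cover_content d s S < ennreal (min (e / C') 1)" using S e C' by simp
    from cover_content_less[OF this] obtain U r where U: "S \<subseteq> (\<Union>i. U i)" "\<And>i. 0 < r i" "\<And>i x y. x \<in> U i \<Longrightarrow> y \<in> U i \<Longrightarrow> d x y \<le> r i"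
      "(\<Sum>i. ennreal (r i powr s)) < ennreal (min (e / C') 1)" by blast
    have "ennreal (r i powr s) \<le> (\<Sum>i. ennreal (r i powr s))" for i
      by (rule ennreal_le_suminf)
    then have "ennreal (r i powr s) < ennreal (min (e / C') 1)" for i
      using U(4) by (rule le_less_trans)
    then have "r i powr s < 1 powr s" for i by (simp add: ennreal_less_iff)
    then have r1: "r i \<le> 1" for i
      using powr_mono2[of s 1 "r i"] s by (metis less_imp_le linorder_not_le zero_le_one)
    have piece: "cover_content d' (s + real k) {x\<in>T. G x \<in> U i} \<le> ennreal (C' * r i powr s)" for i
    proof -
      have "\<exists>\<C>. finite \<C> \<and> real (card \<C>) \<le> C / r i ^ k \<and> {x\<in>T. G x \<in> U i} \<subseteq> \<Union>\<C> \<and>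
        (\<forall>c\<in>\<C>. \<forall>x\<in>c. \<forall>y\<in>c. d' x y \<le> C * r i)"
      proof (rule cov[OF U(2) r1])
        fix x y assume "x \<in> U i" "y \<in> U i" then show "d x y \<le> r i" by (rule U(3))
      qed
      then obtain \<C> where \<C>: "finite \<C>" "real (card \<C>) \<le> C / r i ^ k" "{x\<in>T. G x \<in> U i} \<subseteq> \<Union>\<C>"
        and dC: "\<forall>c\<in>\<C>. \<forall>x\<in>c. \<forall>y\<in>c. d' x y \<le> C * r i" by (elim exE conjE)
      have "cover_content d' (s + real k) {x\<in>T. G x \<in> U i} \<le> cover_content d' (s + real k) (\<Union>\<C>)"
        by (rule cover_content_mono[OF \<C>(3)])
      also have "\<dots> \<le> (\<Sum>c\<in>\<C>. cover_content d' (s + real k) c)"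
        by (rule cover_content_Union[OF \<C>(1)]) (use s in simp)
      also have "\<dots> \<le> (\<Sum>c\<in>\<C>. ennreal ((C * r i) powr (s + real k)))"
        using U(2) C s dC by (intro sum_mono cover_content_bounded) auto
      also have "\<dots> = ennreal (real (card \<C>) * (C * r i) powr (s + real k))"
        by (simp add: ennreal_mult ennreal_of_nat_eq_real_of_nat)
      also have "\<dots> \<le> ennreal (C / r i ^ k * (C * r i) powr (s + real k))"
        using \<C>(2) by (intro ennreal_leI mult_right_mono) auto
      also have "C / r i ^ k * (C * r i) powr (s + real k) = C' * r i powr s"
        using C U(2)[of i] by (simp add: C'_def powr_mult powr_add powr_realpow)
      finally show ?thesis .
    qed
    have "T \<subseteq> (\<Union>i. {x\<in>T. G x \<in> U i})" using G U(1) by blast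
    then have "cover_content d' (s + real k) T \<le> cover_content d' (s + real k) (\<Union>i. {x\<in>T. G x \<in> U i})"
      by (rule cover_content_mono)
    also have "\<dots> \<le> (\<Sum>i. cover_content d' (s + real k) {x\<in>T. G x \<in> U i})"
      by (rule cover_content_UN)
    also have "\<dots> \<le> (\<Sum>i. ennreal C' * ennreal (r i powr s))"
      using piece C' by (intro suminf_le) (auto simp: ennreal_mult)
    also have "\<dots> = ennreal C' * (\<Sum>i. ennreal (r i powr s))" by simp
    also have "\<dots> \<le> ennreal C' * ennreal (e / C')"
      by (rule mult_left_mono[OF order_trans[OF less_imp_le[OF U(4)]]], rule ennreal_leI) simp_all
    also have "\<dots> = ennreal e" using C' e by (simp flip: ennreal_mult)
    finally show ?thesis by simp
  qed
  then show ?thesis by (rule ennreal_eq_0_if_le)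
qed

text \<open>Points are sorted by the integer parts of \<open>g b x / s\<close>. The
  \<open>g b\<close> are arbitrary functions, so the lemma serves Euclidean coordinates, the fibre
  coordinates of the lift and the adapted coordinates of a thin slice.\<close>

lemma grid_cover:
  fixes g :: "'b \<Rightarrow> 'a \<Rightarrow> real"
  assumes B: "finite B" and s: "s > 0" and g: "\<And>b x. b \<in> B \<Longrightarrow> x \<in> H \<Longrightarrow> \<bar>g b x\<bar> \<le> D b"
    and D: "\<And>b. b \<in> B \<Longrightarrow> D b \<ge> 0"
  shows "\<exists>\<C>. finite \<C> \<and> \<Union>\<C> = H \<and> real (card \<C>) \<le> (\<Prod>b\<in>B. 2 * D b / s + 2) \<and>
    (\<forall>c\<in>\<C>. \<forall>x\<in>c. \<forall>y\<in>c. \<forall>b\<in>B. \<bar>g b x - g b y\<bar> \<le> s)"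
proof -
  define \<phi> where "\<phi> x = (\<lambda>b\<in>B. \<lfloor>g b x / s\<rfloor>)" for x
  define J where "J = Pi\<^sub>E B (\<lambda>b. {\<lfloor>- D b / s\<rfloor>..\<lfloor>D b / s\<rfloor>})"
  define \<C> where "\<C> = (\<lambda>j. {x\<in>H. \<phi> x = j}) ` J"
  have J: "finite J" unfolding J_def using B by (intro finite_PiE) auto
  have "\<phi> x \<in> J" if "x \<in> H" for x
  proof -
    have "- D b / s \<le> g b x / s" "g b x / s \<le> D b / s" if "b \<in> B" for b
    proof -
      have "- D b \<le> g b x" "g b x \<le> D b" using g[OF that \<open>x \<in> H\<close>] by (simp_all add: abs_le_iff)
      from this[THEN divide_right_mono, OF less_imp_le[OF s]]
      show "- D b / s \<le> g b x / s" "g b x / s \<le> D b / s" .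
    qed
    then show ?thesis unfolding J_def \<phi>_def by (auto intro!: floor_mono)
  qed
  then have U: "\<Union>\<C> = H" unfolding \<C>_def by auto
  have "real (card \<C>) \<le> real (card J)" unfolding \<C>_def using J card_image_le by auto
  also have "\<dots> = (\<Prod>b\<in>B. real (nat (\<lfloor>D b / s\<rfloor> - \<lfloor>- D b / s\<rfloor> + 1)))"
    unfolding J_def card_PiE[OF B] card_atLeastAtMost_int of_nat_prod ..
  also have "\<dots> \<le> (\<Prod>b\<in>B. 2 * D b / s + 2)"
  proof (intro prod_mono conjI)
    fix b assume "b \<in> B"
    then have "0 \<le> D b / s" using D s by simp
    then have "\<lfloor>- D b / s\<rfloor> \<le> \<lfloor>D b / s\<rfloor>" by (intro floor_mono) simp
    then have "real (nat (\<lfloor>D b / s\<rfloor> - \<lfloor>- D b / s\<rfloor> + 1)) = of_int \<lfloor>D b / s\<rfloor> - of_int \<lfloor>- D b / s\<rfloor> + 1" by simp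
    also have "\<dots> \<le> 2 * D b / s + 2"
    proof -
      have e: "2 * D b / s = 2 * (D b / s)" "- D b / s = - (D b / s)" by simp_all
      show ?thesis unfolding e
        using floor_correct[of "D b / s"] floor_correct[of "- (D b / s)"] by linarith
    qed
    finally show "real (nat (\<lfloor>D b / s\<rfloor> - \<lfloor>- D b / s\<rfloor> + 1)) \<le> 2 * D b / s + 2" .
  qed auto
  finally have card: "real (card \<C>) \<le> (\<Prod>b\<in>B. 2 * D b / s + 2)" .
  have close: "\<bar>g b x - g b y\<bar> \<le> s" if "c \<in> \<C>" "x \<in> c" "y \<in> c" "b \<in> B" for c x y b
  proof -
    have "\<phi> x b = \<phi> y b" using that unfolding \<C>_def by auto
    then have "\<lfloor>g b x / s\<rfloor> = \<lfloor>g b y / s\<rfloor>" using that(4) by (simp add: \<phi>_def)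
    then have "\<bar>g b x / s - g b y / s\<bar> \<le> 1"
      using floor_correct[of "g b x / s"] floor_correct[of "g b y / s"] by linarith
    then show ?thesis using s by (simp add: diff_divide_distrib[symmetric] abs_divide pos_divide_le_eq)
  qed
  have "finite \<C>" using J by (simp add: \<C>_def)
  then show ?thesis
    by (intro exI[of _ \<C>] conjI ballI U card) (assumption, rule close, assumption+)
qed

lemma hausdorff_dim_lessE:
  assumes "hausdorff_dim d S < ereal c"
  obtains s where "0 < s" "s < c" "cover_content d s S = 0"
proof -
  obtain s where "0 < s" "hausdorff_measure d s S = 0" "s < c"
    using assms unfolding hausdorff_dim_def Inf_less_iff by auto
  then show ?thesis using that cover_content_0_if_hausdorff_measure_0 by blast
qed

lemma hausdorff_dim_le:
  assumes "0 < s" "cover_content d s S = 0"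
  shows "hausdorff_dim d S \<le> ereal s"
  unfolding hausdorff_dim_def using assms hausdorff_measure_0_if_cover_content_0 by (intro Inf_lower) auto

text \<open>The map to a one-point space has the bounded set as its only fibre, and a point has
  content zero for every \<open>s > 0\<close>; the preimage estimate gives dimension at most
  \<open>s + DIM('a)\<close>.\<close>

lemma hausdorff_dim_bounded_le:
  fixes K :: "'a::euclidean_space set"
  assumes "bounded K"
  shows "hausdorff_dim dist K \<le> ereal (real DIM('a))"
proof -
  obtain R where R: "R > 0" "\<And>x. x \<in> K \<Longrightarrow> norm x \<le> R" using assms unfolding bounded_pos by blast
  define D where "D = DIM('a)"
  define C where "C = (2 * R + 2) ^ D + real D"
  have D0: "D > 0" unfolding D_def by simp
  have C: "C > 0" unfolding C_def using R D0 by (auto intro!: add_nonneg_pos)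
  have cc: "cover_content (\<lambda>(_::unit) _. 0) s UNIV = 0" if s: "s > 0" for s
  proof -
    have "cover_content (\<lambda>(_::unit) _. 0) s UNIV \<le> ennreal e" if e: "e > 0" for e
      using cover_content_bounded[of s "e powr (1 / s)" UNIV "\<lambda>(_::unit) _. 0"] s e
      by (simp add: powr_inverse_powr)
    then show ?thesis by (rule ennreal_eq_0_if_le)
  qed
  have "cover_content dist (s + real D) K = 0" if s: "s > 0" for s
  proof (rule cover_content_preimage[OF s C cc[OF s], of "\<lambda>_. ()"])
    fix U :: "unit set" and r :: real assume r: "0 < r" "r \<le> 1"
    have "\<exists>\<C>. finite \<C> \<and> \<Union>\<C> = K \<and> real (card \<C>) \<le> (\<Prod>b\<in>(Basis::'a set). 2 * R / r + 2) \<and>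
      (\<forall>c\<in>\<C>. \<forall>x\<in>c. \<forall>y\<in>c. \<forall>b\<in>Basis. \<bar>x \<bullet> b - y \<bullet> b\<bar> \<le> r)"
    proof (rule grid_cover[OF finite_Basis r(1)])
      fix b x assume "b \<in> (Basis::'a set)" "x \<in> K"
      then show "\<bar>x \<bullet> b\<bar> \<le> R" using Basis_le_norm R(2) order_trans by blast
    qed (use R in simp)
    then obtain \<C> where \<C>: "finite \<C>" "\<Union>\<C> = K" "real (card \<C>) \<le> (\<Prod>b\<in>(Basis::'a set). 2 * R / r + 2)"
      "\<forall>c\<in>\<C>. \<forall>x\<in>c. \<forall>y\<in>c. \<forall>b\<in>Basis. \<bar>x \<bullet> b - y \<bullet> b\<bar> \<le> r" by (elim exE conjE)
    have "(\<Prod>b\<in>(Basis::'a set). 2 * R / r + 2) = (2 * R / r + 2) ^ D" by (simp add: D_def)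
    also have "\<dots> \<le> ((2 * R + 2) / r) ^ D"
      using r R by (intro power_mono) (auto simp: field_simps)
    also have "\<dots> \<le> C / r ^ D" unfolding C_def power_divide using r by (intro divide_right_mono) auto
    finally have 1: "real (card \<C>) \<le> C / r ^ D" using \<C>(3) by linarith
    have 2: "dist x y \<le> C * r" if "c \<in> \<C>" "x \<in> c" "y \<in> c" for c x y
    proof -
      have "dist x y \<le> (\<Sum>b\<in>Basis. \<bar>(x - y) \<bullet> b\<bar>)" unfolding dist_norm by (rule norm_le_l1)
      also have "\<dots> \<le> (\<Sum>b\<in>(Basis::'a set). r)" using \<C>(4) that by (intro sum_mono) (simp add: inner_diff_left)
      also have "\<dots> = real D * r" by (simp add: D_def)
      also have "\<dots> \<le> C * r" unfolding C_def using r R by (intro mult_right_mono) auto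
      finally show ?thesis .
    qed
    show "\<exists>\<C>. finite \<C> \<and> real (card \<C>) \<le> C / r ^ D \<and> {x \<in> K. () \<in> U} \<subseteq> \<Union>\<C> \<and> (\<forall>c\<in>\<C>. \<forall>x\<in>c. \<forall>y\<in>c. dist x y \<le> C * r)"
      using \<C>(1,2) 1 2 by blast
  qed auto
  then have "hausdorff_dim dist K \<le> ereal (s + real D)" if "s > 0" for s
    using that by (intro hausdorff_dim_le) auto
  then have *: "hausdorff_dim dist K \<le> ereal (real D) + ereal s" if "s > 0" for s using that by (simp add: add.commute)
  show ?thesis unfolding D_def[symmetric] by (rule ereal_le_epsilon2, intro allI impI *)
qed

section \<open>Lifting to the linear Kakeya problem\<close>

lemma power_diff_bound:
  fixes t t' :: real
  assumes "\<bar>t\<bar> \<le> T" "\<bar>t'\<bar> \<le> T" "1 \<le> T" "\<bar>t - t'\<bar> \<le> r"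
  shows "\<bar>t ^ j - t' ^ j\<bar> \<le> real j * T ^ j * r"
proof (induction j)
  case (Suc j)
  have r0: "r \<ge> 0" using assms(4) by linarith
  have "t ^ Suc j - t' ^ Suc j = t * (t ^ j - t' ^ j) + (t - t') * t' ^ j" by (simp add: algebra_simps)
  then have "\<bar>t ^ Suc j - t' ^ Suc j\<bar> \<le> \<bar>t\<bar> * \<bar>t ^ j - t' ^ j\<bar> + \<bar>t - t'\<bar> * \<bar>t'\<bar> ^ j"
    by (metis abs_mult abs_triangle_ineq power_abs)
  also have "\<dots> \<le> T * (real j * T ^ j * r) + r * T ^ j"
    using Suc assms r0 by (intro add_mono mult_mono power_mono) auto
  also have "\<dots> = real j * T ^ Suc j * r + T ^ j * r" by (simp add: algebra_simps)
  also have "\<dots> \<le> real j * T ^ Suc j * r + T ^ Suc j * r"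
    using assms r0 by (intro add_left_mono mult_right_mono power_increasing) auto
  also have "\<dots> = real (Suc j) * T ^ Suc j * r" by (simp add: algebra_simps)
  finally show ?case .
qed simp

text \<open>For \<open>x = (x\<^sub>0, \<dots>, x\<^sub>M, t)\<close> in \<open>\<real>\<^sup>N\<close> with \<open>x\<^sub>j \<in> \<real>\<^sup>m\<close>, \<open>N = (M + 1) m + 1\<close>, the
  submersion \<open>(\<Sum>\<^sub>j t\<^sup>j x\<^sub>j, t)\<close> maps non-horizontal lines to curves that are polynomial in \<open>t\<close>.\<close>

locale polynomial_lift =
  fixes e :: "'m::finite \<Rightarrow> nat" and M m :: nat
  assumes m_eq: "m = CARD('m)" and e: "bij_betw e UNIV {..<m}"
begin

definition N :: nat where "N = Suc (Suc M * m)"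

definition blk :: "(nat \<Rightarrow> real) \<Rightarrow> nat \<Rightarrow> real^'m" where
  "blk x j = (\<chi> i. x (j * m + e i))"

definition proj :: "(nat \<Rightarrow> real) \<Rightarrow> (real^'m) \<times> real" where
  "proj x = ((\<Sum>j\<le>M. x (N - 1) ^ j *\<^sub>R blk x j), x (N - 1))"

text \<open>Swapping a coordinate with \<open>t\<close> makes every direction transversal to \<open>t = const\<close>; the scaling
  makes its other components small.\<close>

definition swap_scale :: "nat \<Rightarrow> real \<Rightarrow> (nat \<Rightarrow> real) \<Rightarrow> nat \<Rightarrow> real" where
  "swap_scale k \<eta> x i = (if i = N - 1 then x k else \<eta> * x (Transposition.transpose k (N - 1) i))"

text \<open>The preimage of \<open>K\<close> in the chart where coordinate \<open>k\<close> plays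
  the role of time. The box and the time interval make it compact; the charts \<open>k < N\<close>
  together cover all directions.\<close>

definition lifted :: "real \<Rightarrow> real \<Rightarrow> real \<Rightarrow> real \<Rightarrow> ((real^'m) \<times> real) set \<Rightarrow> nat \<Rightarrow> (nat \<Rightarrow> real) set" where
  "lifted \<eta> R a b K k = {x. (\<forall>i\<ge>N. x i = 0) \<and> (\<forall>i. \<bar>x i\<bar> \<le> R) \<and> a \<le> x k \<and> x k \<le> b \<and> proj (swap_scale k \<eta> x) \<in> K}"

lemma e_less: "e i < m"
  using e by (auto simp: bij_betw_def)

lemma blk_index: "j \<le> M \<Longrightarrow> j * m + e i < N - 1"
proof -
  assume "j \<le> M"
  then have "j * m \<le> M * m" by (rule mult_le_mono1)
  then have "j * m + e i < Suc M * m" using e_less[of i] unfolding mult_Suc by linarith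
  then show ?thesis by (simp add: N_def)
qed

lemma blk_index_ex:
  assumes "i < N - 1" obtains j l where "j \<le> M" "i = j * m + e l"
proof -
  have m0: "m > 0" by (simp add: m_eq)
  have "i mod m \<in> e ` UNIV" using e m0 by (auto simp: bij_betw_def)
  then obtain l where l: "i mod m = e l" by auto
  have "i div m \<le> M" using assms m0 by (simp add: N_def less_mult_imp_div_less less_Suc_eq_le[symmetric])
  moreover have "i = (i div m) * m + e l" using l div_mult_mod_eq[of i m] by simp
  ultimately show ?thesis using that by blast
qed

text \<open>The ambient space is all sequences with the product topology, where the box is compact
  by Tychonoff; the remaining conditions are closed.\<close>

lemma compact_lifted:
  assumes "compact K" shows "compact (lifted \<eta> R a b K k)"
proof -
  have c: "continuous_on UNIV (\<lambda>x :: nat \<Rightarrow> real. x i)" for i by simp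
  have "compactin (product_topology (\<lambda>_. euclidean) UNIV) (Pi\<^sub>E UNIV (\<lambda>_ :: nat. {- R..R}))"
    by (simp add: compactin_PiE)
  then have box: "compact (Pi\<^sub>E UNIV (\<lambda>_ :: nat. {- R..R}))"
    by (simp add: euclidean_product_topology compactin_euclidean_iff)
  have cs: "continuous_on UNIV (\<lambda>x. swap_scale k \<eta> x i)" for i
    unfolding swap_scale_def by (cases "i = N - 1") (auto intro!: continuous_intros)
  have cp: "continuous_on UNIV (\<lambda>x. proj (swap_scale k \<eta> x))"
    unfolding proj_def blk_def by (intro continuous_intros cs continuous_on_vec_lambda)
  have "closed ({x :: nat \<Rightarrow> real. \<forall>i\<ge>N. x i = 0} \<inter> {x. a \<le> x k} \<inter> {x. x k \<le> b} \<inter> ((\<lambda>x. proj (swap_scale k \<eta> x)) -` K))"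
  proof (intro closed_Int)
    have "{x :: nat \<Rightarrow> real. \<forall>i\<ge>N. x i = 0} = (\<Inter>i\<in>{N..}. {x. x i = 0})" by auto
    then show "closed {x :: nat \<Rightarrow> real. \<forall>i\<ge>N. x i = 0}"
      by (auto intro!: closed_INT closed_Collect_eq c continuous_on_const)
    show "closed {x :: nat \<Rightarrow> real. a \<le> x k}" "closed {x :: nat \<Rightarrow> real. x k \<le> b}"
      by (intro closed_Collect_le c continuous_on_const)+
    show "closed ((\<lambda>x. proj (swap_scale k \<eta> x)) -` K)"
      using cp assms compact_imp_closed by (intro closed_vimage) auto
  qed
  from compact_Int_closed[OF box this] show ?thesis
    by (rule back_subst[of compact]) (auto simp: lifted_def PiE_UNIV_domain abs_le_iff minus_le_iff)
qed

text \<open>The indices \<open>m..<N - 1\<close> are the blocks \<open>1..M\<close>, the coordinates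
  along a fibre. Once they, the time and the image agree up to \<open>r\<close>, block
  \<open>0\<close> does too, being the image minus the terms \<open>t^j x_j\<close> with
  \<open>j \<ge> 1\<close>.\<close>

lemma lifted_dist:
  assumes \<eta>: "0 < \<eta>" "\<eta> \<le> 1" and R: "R \<ge> 1" and ab: "\<bar>a\<bar> \<le> R" "\<bar>b\<bar> \<le> R" and k: "k < N"
    and x: "x \<in> lifted \<eta> R a b K k" "y \<in> lifted \<eta> R a b K k"
    and d: "dist (proj (swap_scale k \<eta> x)) (proj (swap_scale k \<eta> y)) \<le> r"
    and g: "\<And>i. i \<in> {m..<N - 1} \<Longrightarrow> \<bar>swap_scale k \<eta> x i - swap_scale k \<eta> y i\<bar> \<le> r"
  shows "euclid_dist N x y \<le> real N * ((1 + (\<Sum>j\<le>M. R ^ j + real j * R ^ j * R)) / \<eta>) * r"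
proof -
  define u where "u = swap_scale k \<eta> x"
  define v where "v = swap_scale k \<eta> y"
  define C where "C = 1 + (\<Sum>j\<le>M. R ^ j + real j * R ^ j * R)"
  have r0: "r \<ge> 0" using d zero_le_dist order_trans by blast
  have C1: "C \<ge> 1" unfolding C_def using R by (simp add: sum_nonneg)
  have xR: "\<bar>x i\<bar> \<le> R" "\<bar>y i\<bar> \<le> R" for i using x by (auto simp: lifted_def)
  have uR: "\<bar>u i\<bar> \<le> R" "\<bar>v i\<bar> \<le> R" for i
  proof -
    have "\<bar>\<eta> * x i\<bar> \<le> 1 * R" "\<bar>\<eta> * y i\<bar> \<le> 1 * R" for i
      unfolding abs_mult using \<eta> xR by (intro mult_mono; simp)+
    then show "\<bar>u i\<bar> \<le> R" "\<bar>v i\<bar> \<le> R" unfolding u_def v_def swap_scale_def using xR by auto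
  qed
  have t: "\<bar>u (N - 1) - v (N - 1)\<bar> \<le> r"
    using dist_snd_le[of "proj u" "proj v"] d unfolding u_def v_def by (simp add: proj_def dist_real_def)
  have p: "\<bar>(fst (proj u) - fst (proj v)) $ l\<bar> \<le> r" for l
    using dist_fst_le[of "proj u" "proj v"] d component_le_norm_cart[of "fst (proj u) - fst (proj v)" l]
    unfolding u_def v_def dist_norm by linarith
  have high: "\<bar>u (j * m + e l) - v (j * m + e l)\<bar> \<le> r" if "1 \<le> j" "j \<le> M" for j l
  proof -
    have "1 * m \<le> j * m" by (rule mult_le_mono1[OF that(1)])
    then have "m \<le> j * m + e l" by linarith
    then show ?thesis using g blk_index[OF that(2), of l] unfolding u_def v_def by auto
  qed
  have pw: "\<bar>u (N - 1) ^ j * u i - v (N - 1) ^ j * v i\<bar> \<le> (R ^ j + real j * R ^ j * R) * r" if "\<bar>u i - v i\<bar> \<le> r" for i j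
  proof -
    have "u (N - 1) ^ j * u i - v (N - 1) ^ j * v i = u (N - 1) ^ j * (u i - v i) + (u (N - 1) ^ j - v (N - 1) ^ j) * v i"
      by (simp add: algebra_simps)
    then have "\<bar>u (N - 1) ^ j * u i - v (N - 1) ^ j * v i\<bar> \<le> \<bar>u (N - 1)\<bar> ^ j * \<bar>u i - v i\<bar> + \<bar>u (N - 1) ^ j - v (N - 1) ^ j\<bar> * \<bar>v i\<bar>"
      by (metis abs_mult abs_triangle_ineq power_abs)
    also have "\<dots> \<le> R ^ j * r + (real j * R ^ j * r) * R"
      using that uR R r0 power_diff_bound[OF uR(1) uR(2) R t] by (intro add_mono mult_mono power_mono) auto
    finally show ?thesis by (simp add: algebra_simps)
  qed
  have low: "\<bar>u (e l) - v (e l)\<bar> \<le> C * r" for l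
  proof -
    have comp: "fst (proj z) $ l = z (e l) + (\<Sum>j\<in>{1..M}. z (N - 1) ^ j * z (j * m + e l))" for z
    proof -
      have "{..M} = insert 0 {1..M}" by auto
      then show ?thesis unfolding proj_def blk_def by (simp add: sum_component)
    qed
    have "u (e l) - v (e l) = (fst (proj u) - fst (proj v)) $ l
      - (\<Sum>j\<in>{1..M}. u (N - 1) ^ j * u (j * m + e l) - v (N - 1) ^ j * v (j * m + e l))"
      by (simp add: comp sum_subtractf)
    then have "\<bar>u (e l) - v (e l)\<bar> \<le> \<bar>(fst (proj u) - fst (proj v)) $ l\<bar>
      + \<bar>\<Sum>j\<in>{1..M}. u (N - 1) ^ j * u (j * m + e l) - v (N - 1) ^ j * v (j * m + e l)\<bar>" by linarith
    also have "\<dots> \<le> r + (\<Sum>j\<in>{1..M}. (R ^ j + real j * R ^ j * R) * r)"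
      by (intro add_mono p order_trans[OF sum_abs] sum_mono pw high) auto
    also have "(\<Sum>j\<in>{1..M}. (R ^ j + real j * R ^ j * R) * r) \<le> (\<Sum>j\<le>M. (R ^ j + real j * R ^ j * R) * r)"
      using R r0 by (intro sum_mono2) auto
    finally show ?thesis by (simp add: C_def distrib_right sum_distrib_right)
  qed
  have all: "\<bar>u i - v i\<bar> \<le> C * r" if "i < N" for i
  proof -
    have Cr: "r \<le> C * r" using C1 r0 mult_right_mono[of 1 C r] by simp
    show ?thesis
    proof (cases "i = N - 1")
      case True then show ?thesis using t Cr by simp
    next
      case False
      then have "i < N - 1" using \<open>i < N\<close> by linarith
      then obtain j l where "j \<le> M" "i = j * m + e l" by (rule blk_index_ex)
      then show ?thesis using low[of l] high[of j l] Cr by (cases "j = 0") auto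
    qed
  qed
  have co: "\<bar>x i - y i\<bar> \<le> C / \<eta> * r" if i: "i < N" for i
  proof (cases "i = k")
    case True
    have "\<bar>x i - y i\<bar> \<le> r" using t by (simp add: u_def v_def swap_scale_def True)
    also have "r \<le> C / \<eta> * r"
      using C1 \<eta> r0 mult_right_mono[of 1 "C / \<eta>" r] by (simp add: pos_le_divide_eq)
    finally show ?thesis .
  next
    case False
    define i' where "i' = Transposition.transpose k (N - 1) i"
    have i': "i' \<noteq> N - 1" "i' < N" "Transposition.transpose k (N - 1) i' = i"
      using False i k unfolding i'_def by (auto simp: Transposition.transpose_def)
    have "\<eta> * \<bar>x i - y i\<bar> = \<bar>u i' - v i'\<bar>"
      using i' \<eta> by (simp add: u_def v_def swap_scale_def right_diff_distrib[symmetric] abs_mult)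
    then have "\<eta> * \<bar>x i - y i\<bar> \<le> C * r" using all[OF i'(2)] by simp
    then show ?thesis using \<eta> by (simp add: pos_le_divide_eq mult.commute)
  qed
  have "euclid_dist N x y \<le> (\<Sum>i<N. \<bar>x i - y i\<bar>)" unfolding euclid_dist_def by (rule L2_set_le_sum_abs)
  also have "\<dots> \<le> (\<Sum>i<N. C / \<eta> * r)" using co by (intro sum_mono) auto
  finally show ?thesis by (simp add: C_def)
qed

lemma cover_content_lifted:
  assumes \<eta>: "0 < \<eta>" "\<eta> \<le> 1" and R: "R \<ge> 1" and ab: "\<bar>a\<bar> \<le> R" "\<bar>b\<bar> \<le> R" and k: "k < N"
    and s: "s > 0" and K: "cover_content dist s K = 0"
  shows "cover_content (euclid_dist N) (s + real (M * m)) (lifted \<eta> R a b K k) = 0"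
proof -
  let ?L = "lifted \<eta> R a b K k"
  define C0 where "C0 = real N * ((1 + (\<Sum>j\<le>M. R ^ j + real j * R ^ j * R)) / \<eta>)"
  define C where "C = (2 * R + 2) ^ (M * m) + C0"
  have C0: "C0 \<ge> 0" unfolding C0_def using R \<eta> by (auto intro!: mult_nonneg_nonneg divide_nonneg_nonneg add_nonneg_nonneg sum_nonneg)
  have C: "C > 0" unfolding C_def using R C0 by (intro add_pos_nonneg) auto
  show ?thesis
  proof (rule cover_content_preimage[OF s C K, of "\<lambda>x. proj (swap_scale k \<eta> x)"])
    show "(\<lambda>x. proj (swap_scale k \<eta> x)) ` ?L \<subseteq> K" by (auto simp: lifted_def)
    fix U :: "((real^'m) \<times> real) set" and r :: real
    assume r: "0 < r" "r \<le> 1" and U: "\<And>x y. x \<in> U \<Longrightarrow> y \<in> U \<Longrightarrow> dist x y \<le> r"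
    let ?H = "{x \<in> ?L. proj (swap_scale k \<eta> x) \<in> U}"
    have bd: "\<bar>swap_scale k \<eta> x i\<bar> \<le> R" if "x \<in> ?H" for x i
    proof -
      have xR: "\<bar>x i\<bar> \<le> R" for i using that by (auto simp: lifted_def)
      have "\<bar>\<eta> * x i\<bar> \<le> 1 * R" for i
        unfolding abs_mult using \<eta> xR by (intro mult_mono) auto
      then show ?thesis unfolding swap_scale_def using xR by auto
    qed
    obtain \<C> where \<C>: "finite \<C>" "\<Union>\<C> = ?H" "real (card \<C>) \<le> (\<Prod>i\<in>{m..<N - 1}. 2 * R / r + 2)"
      "\<forall>c\<in>\<C>. \<forall>x\<in>c. \<forall>y\<in>c. \<forall>i\<in>{m..<N - 1}. \<bar>swap_scale k \<eta> x i - swap_scale k \<eta> y i\<bar> \<le> r"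
      using grid_cover[of "{m..<N - 1}" r ?H "\<lambda>i x. swap_scale k \<eta> x i" "\<lambda>_. R"] bd r R by auto
    have "(\<Prod>i\<in>{m..<N - 1}. 2 * R / r + 2) = (2 * R / r + 2) ^ (M * m)" by (simp add: N_def)
    also have "\<dots> \<le> ((2 * R + 2) / r) ^ (M * m)"
      using r R by (intro power_mono) (auto simp: field_simps)
    also have "\<dots> \<le> C / r ^ (M * m)"
      unfolding C_def power_divide using r C0 by (intro divide_right_mono) auto
    finally have 1: "real (card \<C>) \<le> C / r ^ (M * m)" using \<C>(3) by linarith
    have 2: "euclid_dist N x y \<le> C * r" if "c \<in> \<C>" "x \<in> c" "y \<in> c" for c x y
    proof -
      have H: "x \<in> ?H" "y \<in> ?H" using that \<C>(2) by blast+
      have "euclid_dist N x y \<le> C0 * r"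
        unfolding C0_def using H U that \<C>(4)
        by (intro lifted_dist[OF \<eta> R ab k, of x K y]) auto
      also have "\<dots> \<le> C * r" unfolding C_def using r R by (intro mult_right_mono) auto
      finally show ?thesis .
    qed
    show "\<exists>\<C>. finite \<C> \<and> real (card \<C>) \<le> C / r ^ (M * m) \<and> {x \<in> ?L. proj (swap_scale k \<eta> x) \<in> U} \<subseteq> \<Union>\<C> \<and>
        (\<forall>c\<in>\<C>. \<forall>x\<in>c. \<forall>y\<in>c. euclid_dist N x y \<le> C * r)"
      using \<C>(1,2) 1 2 by (intro exI[of _ \<C>]) auto
  qed
qed

text \<open>If \<open>K\<close> were too small, the union of its lifts would have dimension below
  \<open>N\<close>, although it contains a segment in every direction and thus has dimension
  \<open>N\<close> by the linear conjecture.\<close>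

theorem hausdorff_dim_lower_bound:
  fixes c :: "nat \<Rightarrow> 'b \<Rightarrow> real^'m \<Rightarrow> real^'m"
  assumes kak: "linear_kakeya_conjecture N"
    and h: "h > 0" and \<sigma>: "\<sigma> > 0" and ab: "a < b"
    and c: "\<And>j w y. w \<in> W \<Longrightarrow> y \<in> cball y\<^sub>0 \<sigma> \<Longrightarrow> norm (c j w y) \<le> B"
    and K: "compact K"
      "\<And>y. y \<in> cball y\<^sub>0 \<sigma> \<Longrightarrow> \<exists>w\<in>W. \<forall>t\<in>{a..b}. ((\<Sum>j\<le>M. t ^ j *\<^sub>R c j w y) + (h * t ^ Suc M) *\<^sub>R (y - y\<^sub>0), t) \<in> K"
  shows "hausdorff_dim dist K \<ge> ereal (real (Suc m))"
proof (rule ccontr)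
  assume "\<not> hausdorff_dim dist K \<ge> ereal (real (Suc m))"
  then have "hausdorff_dim dist K < ereal (real (Suc m))" by simp
  then obtain s where s: "0 < s" "s < real (Suc m)" "cover_content dist s K = 0"
    by (rule hausdorff_dim_lessE)
  have m0: "real m > 0" by (simp add: m_eq)
  have N0: "N > 0" "N - 1 < N" by (auto simp: N_def)
  \<comment> \<open>Small enough that the block \<open>v_M\<close> of every rescaled direction has
    norm at most \<open>h * \<sigma>\<close>, so that the \<open>y\<close> it determines lies in the
    ball.\<close>
  define \<eta> where "\<eta> = min 1 (h * \<sigma> / real m)"
  have \<eta>: "0 < \<eta>" "\<eta> \<le> 1" "real m * \<eta> \<le> h * \<sigma>"
  proof -
    show "0 < \<eta>" unfolding \<eta>_def using h \<sigma> m0 by simp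
    show "\<eta> \<le> 1" unfolding \<eta>_def by simp
    have "\<eta> \<le> h * \<sigma> / real m" unfolding \<eta>_def by simp
    then show "real m * \<eta> \<le> h * \<sigma>" using m0 by (simp add: pos_le_divide_eq mult.commute)
  qed
  define T where "T = max \<bar>a\<bar> \<bar>b\<bar>"
  \<comment> \<open>Bounds a base point by \<open>(|B| + \<eta>) / \<eta>\<close> and the motion
    along the line by \<open>T\<close>.\<close>
  define R where "R = (\<bar>B\<bar> + \<eta>) / \<eta> + T + 1"
  have T: "T \<ge> 0" "\<And>t. a \<le> t \<Longrightarrow> t \<le> b \<Longrightarrow> \<bar>t\<bar> \<le> T" unfolding T_def by auto
  have "0 \<le> (\<bar>B\<bar> + \<eta>) / \<eta>" using \<eta> by simp
  then have R: "R \<ge> 1" "\<bar>a\<bar> \<le> R" "\<bar>b\<bar> \<le> R" "R \<ge> T" "R \<ge> (\<bar>B\<bar> + \<eta>) / \<eta> + T"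
    unfolding R_def T_def by auto
  define L where "L = (\<Union>k<N. lifted \<eta> R a b K k)"
  have comp: "compact L" unfolding L_def using K(1) by (intro compact_UN compact_lifted) auto
  have L_top: "L \<subseteq> topspace (Euclidean_space N)"
    unfolding L_def topspace_Euclidean_space by (auto simp: lifted_def)
  have compactin: "compactin (Euclidean_space N) L"
    using comp L_top unfolding Euclidean_space_def compactin_subtopology euclidean_product_topology
    by (simp add: compactin_euclidean_iff)
  have "contains_segment_in_each_direction N L"
    unfolding contains_segment_in_each_direction_def
  proof (intro ballI impI)
    fix d assume d: "d \<in> topspace (Euclidean_space N)" "L2_set d {..<N} = 1"
    have d0: "d i = 0" if "i \<ge> N" for i using d(1) that by (auto simp: topspace_Euclidean_space)
    have "\<exists>k<N. \<forall>i<N. \<bar>d i\<bar> \<le> \<bar>d k\<bar>"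
    proof -
      have "Max ((\<lambda>i. \<bar>d i\<bar>) ` {..<N}) \<in> (\<lambda>i. \<bar>d i\<bar>) ` {..<N}" using N0 by (intro Max_in) auto
      then obtain k where k: "k < N" "Max ((\<lambda>i. \<bar>d i\<bar>) ` {..<N}) = \<bar>d k\<bar>" by auto
      have "\<bar>d i\<bar> \<le> Max ((\<lambda>i. \<bar>d i\<bar>) ` {..<N})" if "i < N" for i using that by (intro Max_ge) auto
      then show ?thesis using k by auto
    qed
    \<comment> \<open>The largest coordinate becomes time; after division by it all components are
      at most \<open>1\<close>.\<close>
    then obtain k where k: "k < N" "\<And>i. i < N \<Longrightarrow> \<bar>d i\<bar> \<le> \<bar>d k\<bar>" by blast
    have dk: "d k \<noteq> 0"
    proof
      assume "d k = 0"
      then have "d i = 0" if "i \<in> {..<N}" for i using k(2)[of i] that by simp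
      then have "L2_set d {..<N} = 0" by (simp add: L2_set_eq_0_iff)
      then show False using d(2) by simp
    qed
    define u where "u i = d i / d k" for i
    have u: "\<bar>u i\<bar> \<le> 1" "u k = 1" "i \<ge> N \<Longrightarrow> u i = 0" for i
    proof -
      show "\<bar>u i\<bar> \<le> 1" using k(2)[of i] dk d0[of i] by (cases "i < N") (auto simp: u_def abs_divide divide_le_eq_1)
    qed (use dk d0 in \<open>auto simp: u_def\<close>)
    define \<pi> where "\<pi> = Transposition.transpose k (N - 1)"
    define v where "v i = \<eta> * u (\<pi> i)" for i
    have v: "\<bar>v i\<bar> \<le> \<eta>" for i
      unfolding v_def abs_mult using u(1)[of "\<pi> i"] \<eta>(1) mult_left_mono[of "\<bar>u (\<pi> i)\<bar>" 1 \<eta>] by simp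
    \<comment> \<open>Solves \<open>h (y - y\<^sub>0) = v_M\<close>: the direction alone selects the
      curve family.\<close>
    define y where "y = y\<^sub>0 + (1 / h) *\<^sub>R blk v M"
    have "norm (blk v M) \<le> (\<Sum>i\<in>UNIV. \<bar>blk v M $ i\<bar>)" by (rule norm_le_l1_cart)
    also have "\<dots> \<le> (\<Sum>i\<in>(UNIV::'m set). \<eta>)" by (intro sum_mono) (simp add: blk_def v)
    also have "\<dots> \<le> h * \<sigma>" using \<eta>(3) by (simp add: m_eq)
    finally have "norm (blk v M) / h \<le> \<sigma>" using h by (simp add: pos_divide_le_eq mult.commute)
    then have y: "y \<in> cball y\<^sub>0 \<sigma>" using h by (simp add: y_def dist_norm)
    obtain w where w: "w \<in> W" "\<And>t. t\<in>{a..b} \<Longrightarrow> ((\<Sum>j\<le>M. t ^ j *\<^sub>R c j w y) + (h * t ^ Suc M) *\<^sub>R (y - y\<^sub>0), t) \<in> K"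
      using K(2)[OF y] by blast
    \<comment> \<open>Block \<open>j\<close> of the base point is \<open>c_j - v_(j-1)\<close>, with
      no correction for \<open>j = 0\<close>. Then the sum of \<open>t^j (A_j + t v_j)\<close>
      telescopes to the prescribed polynomial plus \<open>t^(M+1) v_M\<close>.\<close>
    define A where "A i = c (i div m) w y $ (inv_into UNIV e (i mod m)) - (if i < m then 0 else v (i - m))" for i
    have A: "\<bar>A i\<bar> \<le> \<bar>B\<bar> + \<eta>" for i
    proof -
      have 1: "\<bar>c j w y $ l\<bar> \<le> \<bar>B\<bar>" for j l
        using c[OF w(1) y, of j] component_le_norm_cart[of "c j w y" l] by linarith
      have 2: "\<bar>if i < m then 0 else v (i - m)\<bar> \<le> \<eta>" using v \<eta>(1) by auto
      show ?thesis unfolding A_def by (rule order_trans[OF abs_triangle_ineq4 add_mono[OF 1 2]])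
    qed
    have A_blk: "A (j * m + e l) = c j w y $ l - (if j = 0 then 0 else v ((j - 1) * m + e l))" for j l
    proof -
      have "(j * m + e l) div m = j" "(j * m + e l) mod m = e l" using e_less[of l] by auto
      moreover have "inv_into UNIV e (e l) = l" using e by (simp add: bij_betw_def)
      moreover have "(j * m + e l) - m = (j - 1) * m + e l" if "j \<noteq> 0" using that by (cases j) auto
      moreover have "j * m + e l < m \<longleftrightarrow> j = 0" using e_less[of l] by (cases j) auto
      ultimately show ?thesis unfolding A_def by auto
    qed
    \<comment> \<open>Coordinate \<open>k\<close> starts at \<open>0\<close> so that the parameter
      of the line equals the time.\<close>
    define X0 where "X0 i = (if i = k \<or> i \<ge> N then 0 else A (\<pi> i) / \<eta>)" for i
    define p where "p t i = X0 i + t * u i" for t i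
    have pL: "p t \<in> L" if t: "a \<le> t" "t \<le> b" for t
    proof -
      have sw: "swap_scale k \<eta> (p t) i = (if i = N - 1 then t else A i + t * v i)" if "i < N" for i
      proof (cases "i = N - 1")
        case True
        then show ?thesis by (simp add: swap_scale_def p_def X0_def u)
      next
        case False
        then have "\<pi> i \<noteq> k" "\<pi> i < N" "\<pi> (\<pi> i) = i" using that k(1) by (auto simp: \<pi>_def Transposition.transpose_def)
        moreover have "swap_scale k \<eta> z i = \<eta> * z (\<pi> i)" for z
          using False by (simp add: swap_scale_def \<pi>_def)
        ultimately show ?thesis using False \<eta>(1) by (simp add: p_def X0_def v_def algebra_simps)
      qed
      have swN: "swap_scale k \<eta> (p t) (N - 1) = t" using sw[OF N0(2)] by simp
      have blkp: "blk (swap_scale k \<eta> (p t)) j = c j w y - (if j = 0 then 0 else blk v (j - 1)) + t *\<^sub>R blk v j" if "j \<le> M" for j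
      proof -
        have "swap_scale k \<eta> (p t) (j * m + e l) = c j w y $ l - (if j = 0 then 0 else v ((j - 1) * m + e l)) + t * v (j * m + e l)" for l
          using sw[of "j * m + e l"] blk_index[OF that, of l] by (simp add: A_blk)
        then show ?thesis by (simp add: blk_def vec_eq_iff)
      qed
      have tele: "(\<Sum>j\<le>J. t ^ j *\<^sub>R (c j w y - (if j = 0 then 0 else blk v (j - 1)) + t *\<^sub>R blk v j))
        = (\<Sum>j\<le>J. t ^ j *\<^sub>R c j w y) + t ^ Suc J *\<^sub>R blk v J" for J
        by (induction J) (simp_all add: algebra_simps)
      have "fst (proj (swap_scale k \<eta> (p t))) = (\<Sum>j\<le>M. t ^ j *\<^sub>R c j w y) + t ^ Suc M *\<^sub>R blk v M"
        unfolding proj_def fst_conv swN tele[symmetric]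
        by (intro sum.cong refl) (simp add: blkp)
      moreover have "snd (proj (swap_scale k \<eta> (p t))) = t" unfolding proj_def snd_conv by (rule swN)
      moreover have "(h * t ^ Suc M) *\<^sub>R (y - y\<^sub>0) = t ^ Suc M *\<^sub>R blk v M" using h by (simp add: y_def)
      ultimately have "proj (swap_scale k \<eta> (p t)) \<in> K"
        using w(2)[of t] t by (metis atLeastAtMost_iff prod.collapse)
      moreover have "\<forall>i\<ge>N. p t i = 0" by (auto simp: p_def X0_def u(3))
      moreover have "\<bar>p t i\<bar> \<le> R" for i
      proof -
        have "\<bar>X0 i\<bar> \<le> (\<bar>B\<bar> + \<eta>) / \<eta>" using A[of "\<pi> i"] \<eta>(1) by (auto simp: X0_def abs_divide divide_right_mono)
        moreover have "\<bar>t * u i\<bar> \<le> T * 1" unfolding abs_mult using T t u(1)[of i] by (intro mult_mono) auto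
        ultimately show ?thesis unfolding p_def using R(5) by linarith
      qed
      moreover have "p t k = t" by (simp add: p_def X0_def u)
      ultimately show ?thesis using t k(1) unfolding L_def lifted_def by (intro UN_I[of k]) auto
    qed
    \<comment> \<open>Parametrised by the unit vector \<open>d\<close>, time runs with speed
      \<open>d k\<close>; the sign decides at which end of the interval to start.\<close>
    define t0 where "t0 = (if d k > 0 then a else b)"
    define l where "l = (b - a) / \<bar>d k\<bar>"
    have l: "l > 0" unfolding l_def using ab dk by simp
    have seg: "(\<lambda>i. p t0 i + \<tau> * d i) \<in> L" if \<tau>: "\<tau> \<in> {0..l}" for \<tau>
    proof -
      have "\<tau> * \<bar>d k\<bar> \<le> b - a" using \<tau> dk unfolding l_def by (simp add: pos_le_divide_eq)
      moreover have "0 \<le> \<tau> * \<bar>d k\<bar>" using \<tau> by simp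
      ultimately have "a \<le> t0 + \<tau> * d k" "t0 + \<tau> * d k \<le> b"
        unfolding t0_def by (auto simp: abs_if split: if_splits)
      then have "p (t0 + \<tau> * d k) \<in> L" by (rule pL)
      moreover have "p (t0 + \<tau> * d k) = (\<lambda>i. p t0 i + \<tau> * d i)"
        using dk by (simp add: p_def u_def fun_eq_iff field_simps)
      ultimately show ?thesis by simp
    qed
    have "p t0 \<in> L" using ab by (intro pL) (auto simp: t0_def)
    then have "p t0 \<in> topspace (Euclidean_space N)" using L_top by blast
    then show "\<exists>a\<in>topspace (Euclidean_space N). \<exists>l>0. \<forall>s\<in>{0..l}. (\<lambda>i. a i + s * d i) \<in> L"
      using l seg by blast
  qed
  then have dim: "hausdorff_dim (euclid_dist N) L = ereal (real N)"
    using kak compactin unfolding linear_kakeya_conjecture_def by blast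
  have sp: "0 < s + real (M * m)" using s(1) by (intro add_pos_nonneg) auto
  have "cover_content (euclid_dist N) (s + real (M * m)) L \<le> (\<Sum>c\<in>lifted \<eta> R a b K ` {..<N}. cover_content (euclid_dist N) (s + real (M * m)) c)"
    unfolding L_def by (intro cover_content_Union sp) auto
  also have "\<dots> = 0"
    using cover_content_lifted[OF \<eta>(1,2) R(1-3) _ s(1,3)] by (intro sum.neutral) auto
  finally have "hausdorff_dim (euclid_dist N) L \<le> ereal (s + real (M * m))"
    by (intro hausdorff_dim_le sp) auto
  \<comment> \<open>Since \<open>N = M m + m + 1\<close>, this contradicts
    \<open>s < m + 1\<close>.\<close>
  then have "real N \<le> s + real (M * m)" unfolding dim by simp
  then show False using s(2) by (simp add: N_def)
qed

end

section \<open>Lipschitz and Taylor bounds on the domain, and a test for non-scalar matrices\<close>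

context smooth_domain
begin

lemma pderiv_on_bound:
  assumes f: "smooth Q f"
  obtains K where "K > 0" "\<And>v x. x \<in> Q \<Longrightarrow> norm (pderiv_on Q v f x) \<le> K * norm v"
proof -
  have "\<exists>B. \<forall>x\<in>Q. norm (pderiv_on Q b f x) \<le> B" for b
    by (rule smooth_bounded[OF smooth_pderiv_on[OF f, of b]]) (rule exI, rule ballI)
  then have "\<exists>B. \<forall>b. \<forall>x\<in>Q. norm (pderiv_on Q b f x) \<le> B b" by (intro choice allI)
  then obtain B where "\<forall>b. \<forall>x\<in>Q. norm (pderiv_on Q b f x) \<le> B b" by (rule exE)
  then have B: "norm (pderiv_on Q b f x) \<le> B b" if "x \<in> Q" for b x using that by simp
  have Q: "Q \<noteq> {}" using interior by auto
  obtain x0 where "x0 \<in> Q" using Q by blast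
  then have B0: "0 \<le> B b" for b by (rule order_trans[OF norm_ge_zero B])
  show ?thesis
  proof (rule that[of "(\<Sum>b\<in>Basis. B b) + 1"])
    show "0 < (\<Sum>b\<in>Basis. B b) + 1" using B0 by (intro add_nonneg_pos sum_nonneg) auto
    fix v x assume x: "x \<in> Q"
    have "norm (pderiv_on Q v f x) \<le> (\<Sum>b\<in>Basis. norm v * B b)"
      unfolding pderiv_on_basis[OF smooth_differentiable[OF f] x, of v]
      using B[OF x] by (intro sum_norm_le) (auto intro!: mult_mono Basis_le_norm)
    also have "\<dots> = (\<Sum>b\<in>Basis. B b) * norm v"
      unfolding sum_distrib_right by (intro sum.cong refl mult.commute)
    also have "\<dots> \<le> ((\<Sum>b\<in>Basis. B b) + 1) * norm v" by (intro mult_right_mono) auto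
    finally show "norm (pderiv_on Q v f x) \<le> ((\<Sum>b\<in>Basis. B b) + 1) * norm v" .
  qed
qed

lemma smooth_Lipschitz:
  assumes f: "smooth Q f"
  obtains K where "K > 0" "\<And>x y. x \<in> Q \<Longrightarrow> y \<in> Q \<Longrightarrow> norm (f x - f y) \<le> K * norm (x - y)"
proof -
  obtain K where K: "K > 0" "\<And>v x. x \<in> Q \<Longrightarrow> norm (pderiv_on Q v f x) \<le> K * norm v"
    by (rule pderiv_on_bound[OF f], rule that)
  show ?thesis
  proof (rule that[OF K(1)])
    fix x y assume "x \<in> Q" "y \<in> Q"
    then show "norm (f x - f y) \<le> K * norm (x - y)"
      using K by (intro differentiable_bound[OF convex pderiv_on_works[OF smooth_differentiable[OF f]]])
        (auto intro: onorm_le)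
  qed
qed

text \<open>The mean value inequality on the segment, applied to \<open>f\<close> minus its
  linearisation at \<open>x\<close>, whose derivative is Lipschitz and vanishes at
  \<open>x\<close>.\<close>

lemma taylor_second_order:
  assumes f: "smooth Q f"
  obtains K where "K > 0" "\<And>x y. x \<in> Q \<Longrightarrow> y \<in> Q \<Longrightarrow>
    norm (f y - f x - pderiv_on Q (y - x) f x) \<le> K * (norm (y - x))\<^sup>2"
proof -
  have "\<exists>K. \<forall>x\<in>Q. \<forall>y\<in>Q. norm (pderiv_on Q b f x - pderiv_on Q b f y) \<le> K * norm (x - y)" for b
    by (rule smooth_Lipschitz[OF smooth_pderiv_on[OF f, of b]]) (rule exI, intro ballI)
  then have "\<exists>L. \<forall>b. \<forall>x\<in>Q. \<forall>y\<in>Q. norm (pderiv_on Q b f x - pderiv_on Q b f y) \<le> L b * norm (x - y)"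
    by (intro choice allI)
  then obtain L where "\<forall>b. \<forall>x\<in>Q. \<forall>y\<in>Q. norm (pderiv_on Q b f x - pderiv_on Q b f y) \<le> L b * norm (x - y)"
    by (rule exE)
  then have L: "norm (pderiv_on Q b f x - pderiv_on Q b f y) \<le> L b * norm (x - y)" if "x \<in> Q" "y \<in> Q" for b x y
    using that by simp
  define K where "K = (\<Sum>b\<in>Basis. \<bar>L b\<bar>) + 1"
  have K: "K > 0" unfolding K_def by (intro add_nonneg_pos sum_nonneg) auto
  show ?thesis
  proof (rule that[OF K])
    fix x y assume x: "x \<in> Q" and y: "y \<in> Q"
    have sub: "closed_segment x y \<subseteq> Q" using x y convex by (rule closed_segment_subset)
    interpret D: bounded_linear "\<lambda>v. pderiv_on Q v f x"
      using pderiv_on_works[OF smooth_differentiable[OF f] x] has_derivative_bounded_linear by blast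
    have "norm ((f y - pderiv_on Q (y - x) f x) - (f x - pderiv_on Q (x - x) f x)) \<le> (K * norm (y - x)) * norm (y - x)"
    proof (rule differentiable_bound[of "closed_segment x y" "\<lambda>z. f z - pderiv_on Q (z - x) f x"
          "\<lambda>z v. pderiv_on Q v f z - pderiv_on Q v f x"])
      fix z assume z: "z \<in> closed_segment x y"
      then have zQ: "z \<in> Q" using sub by blast
      have "(f has_derivative (\<lambda>v. pderiv_on Q v f z)) (at z within closed_segment x y)"
        by (rule has_derivative_subset[OF pderiv_on_works[OF smooth_differentiable[OF f] zQ] sub])
      moreover have "((\<lambda>z. pderiv_on Q (z - x) f x) has_derivative (\<lambda>v. pderiv_on Q v f x)) (at z within closed_segment x y)"
        by (rule D.has_derivative) (auto intro!: derivative_eq_intros)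
      ultimately show "((\<lambda>z. f z - pderiv_on Q (z - x) f x) has_derivative (\<lambda>v. pderiv_on Q v f z - pderiv_on Q v f x)) (at z within closed_segment x y)"
        by (rule has_derivative_diff)
      have zx: "norm (z - x) \<le> norm (y - x)"
        using segment_bound1[OF z] by (simp add: norm_minus_commute)
      show "onorm (\<lambda>v. pderiv_on Q v f z - pderiv_on Q v f x) \<le> K * norm (y - x)"
      proof (rule onorm_le)
        fix v
        have "pderiv_on Q v f z - pderiv_on Q v f x = (\<Sum>b\<in>Basis. (v \<bullet> b) *\<^sub>R (pderiv_on Q b f z - pderiv_on Q b f x))"
          unfolding pderiv_on_basis[OF smooth_differentiable[OF f] zQ, of v] pderiv_on_basis[OF smooth_differentiable[OF f] x, of v]
          by (simp add: sum_subtractf scaleR_diff_right)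
        also have "norm \<dots> \<le> (\<Sum>b\<in>Basis. norm v * (\<bar>L b\<bar> * norm (y - x)))"
        proof (rule sum_norm_le)
          fix b :: 'a assume b: "b \<in> Basis"
          have "norm (pderiv_on Q b f z - pderiv_on Q b f x) \<le> L b * norm (z - x)" by (rule L[OF zQ x])
          also have "\<dots> \<le> \<bar>L b\<bar> * norm (y - x)" using zx by (intro mult_mono) auto
          finally show "norm ((v \<bullet> b) *\<^sub>R (pderiv_on Q b f z - pderiv_on Q b f x)) \<le> norm v * (\<bar>L b\<bar> * norm (y - x))"
            using b by (auto intro!: mult_mono Basis_le_norm)
        qed
        also have "\<dots> = (\<Sum>b\<in>Basis. \<bar>L b\<bar>) * norm (y - x) * norm v"
          by (simp add: sum_distrib_left sum_distrib_right mult_ac)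
        also have "\<dots> \<le> K * norm (y - x) * norm v" unfolding K_def by (intro mult_right_mono) auto
        finally show "norm (pderiv_on Q v f z - pderiv_on Q v f x) \<le> K * norm (y - x) * norm v" .
      qed
    qed auto
    then show "norm (f y - f x - pderiv_on Q (y - x) f x) \<le> K * (norm (y - x))\<^sup>2"
      by (simp add: D.zero power2_eq_square algebra_simps)
  qed
qed

lemma zero_on_interior_imp_zero:
  fixes f :: "'a \<Rightarrow> 'b::real_normed_vector"
  assumes "continuous_on Q f" "\<And>x. x \<in> interior Q \<Longrightarrow> f x = 0" "x \<in> Q"
  shows "f x = 0"
proof -
  have "closure (interior Q) = Q"
    using convex_closure_interior[OF convex interior] compact_imp_closed[OF compact] by simp
  then show ?thesis using continuous_constant_on_closure[of "interior Q" f 0 x] assms by simp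
qed

end

context slab
begin

text \<open>The remainder \<open>H0\<close> has time derivative \<open>H1\<close>, whose time
  derivative is an increment of the second derivative; both vanish at \<open>t0\<close>. Integrating
  a bound by powers of \<open>|t - t0|\<close> gains one power each time, without the sharp
  factorial.\<close>

lemma taylor_third_order_t:
  fixes F :: "'m pt \<Rightarrow> 'b::real_normed_vector"
  assumes F: "smooth Q F" and t0: "t0 \<in> {a..b}"
  obtains B where "B > 0" "\<And>w t y. (w, t, y) \<in> Q \<Longrightarrow>
    norm (F (w, t, y) - F (w, t0, y) - (t - t0) *\<^sub>R Dt F (w, t0, y) - ((t - t0)\<^sup>2 / 2) *\<^sub>R Dt (Dt F) (w, t0, y)) \<le> B * \<bar>t - t0\<bar> ^ 3"
proof -
  have F1: "smooth Q (Dt F)" and F2: "smooth Q (Dt (Dt F))" and F3: "smooth Q (Dt (Dt (Dt F)))"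
    using F by (auto intro: smooth_pderiv_on)
  obtain B where B: "B > 0" "\<And>q. q \<in> Q \<Longrightarrow> norm (Dt (Dt (Dt F)) q) \<le> B"
    by (rule smooth_bounded[OF F3], rule that)
  \<comment> \<open>\<open>t - t0\<close> and \<open>(t - t0)^2 / 2\<close> as polynomials, so that
    the product rule for \<open>tpoly\<close> and \<open>slice\<close> applies.\<close>
  define p1 :: "real poly" where "p1 = [:- t0, 1:]"
  define p2 :: "real poly" where "p2 = [:t0\<^sup>2 / 2, - t0, 1 / 2:]"
  have d1: "pderiv p1 = 1" and d2: "pderiv p2 = p1" and d0: "pderiv (1 :: real poly) = 0"
    by (auto simp: p1_def p2_def pderiv_pCons)
  have v1: "tpoly p1 (w, t, y) = t - t0" and v2: "tpoly p2 (w, t, y) = (t - t0)\<^sup>2 / 2"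
    and v0: "tpoly 1 q = 1" "tpoly 0 q = 0" for w t y q
    by (auto simp: tpoly_def p1_def p2_def power2_eq_square algebra_simps)
  define H1 where "H1 q = Dt F q - (tpoly 1 q *\<^sub>R slice t0 (Dt F) q + tpoly p1 q *\<^sub>R slice t0 (Dt (Dt F)) q)" for q
  define H0 where "H0 q = F q - (tpoly 1 q *\<^sub>R slice t0 F q + (tpoly p1 q *\<^sub>R slice t0 (Dt F) q + tpoly p2 q *\<^sub>R slice t0 (Dt (Dt F)) q))" for q
  have st: "smooth Q (\<lambda>q. tpoly p q *\<^sub>R slice t0 f q)" if "smooth Q f" for p and f :: "'m pt \<Rightarrow> 'b"
    using that t0 by (intro smooth_scaleR smooth_tpoly smooth_slice)
  note st' = st[OF F] st[OF F1] st[OF F2]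
  have H1: "smooth Q H1" and H0: "smooth Q H0"
    unfolding H1_def H0_def by (intro smooth_diff smooth_add F F1 st')+
  have mem: "(w, s, y) \<in> Q" if "(w, t, y) \<in> Q" "s \<in> closed_segment t t0" for w s t y
    using that t0 ab by (auto simp: Q_eq closed_segment_eq_real_ivl split: if_splits)
  have seg: "\<bar>s - t0\<bar> \<le> \<bar>t - t0\<bar>" if "s \<in> closed_segment t t0" for s t
    using that by (auto simp: closed_segment_eq_real_ivl split: if_splits)
  have mem0: "(w, t0, y) \<in> Q" if "(w, t, y) \<in> Q" for w t y using mem[OF that] by simp
  have e2: "norm (Dt (Dt F) (w, t, y) - Dt (Dt F) (w, t0, y)) \<le> B * \<bar>t - t0\<bar>" if "(w, t, y) \<in> Q" for w t y
    using dir_t_bound[OF F2 _ that mem0[OF that]] B(2) mem[OF that] by blast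
  have DH1: "Dt H1 q = Dt (Dt F) q - slice t0 (Dt (Dt F)) q" if "q \<in> Q" for q
    unfolding H1_def
    by (subst pderiv_on_minus_eq[OF F1 smooth_add[OF st'(2,3)] that],
        subst pderiv_on_add[OF smooth_differentiable[OF st'(2)] smooth_differentiable[OF st'(3)] that])
      (simp only: Dt_tpoly_slice[OF t0 F1 that] Dt_tpoly_slice[OF t0 F2 that] d0 d1, simp add: v0)
  have e1: "norm (H1 (w, t, y)) \<le> B * \<bar>t - t0\<bar>\<^sup>2" if Q: "(w, t, y) \<in> Q" for w t y
  proof -
    have "norm (H1 (w, t, y) - H1 (w, t0, y)) \<le> (B * \<bar>t - t0\<bar>) * \<bar>t - t0\<bar>"
    proof (rule dir_t_bound[OF H1 _ Q mem0[OF Q]])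
      fix s assume s: "s \<in> closed_segment t t0"
      have "norm (Dt H1 (w, s, y)) \<le> B * \<bar>s - t0\<bar>"
        using e2[OF mem[OF Q s]] DH1[OF mem[OF Q s]] by (simp add: slice_def)
      also have "\<dots> \<le> B * \<bar>t - t0\<bar>" using seg[OF s] B(1) by (intro mult_left_mono) auto
      finally show "norm (Dt H1 (w, s, y)) \<le> B * \<bar>t - t0\<bar>" .
    qed
    moreover have "H1 (w, t0, y) = 0" by (simp add: H1_def v0 v1 slice_def)
    ultimately show ?thesis by (simp add: power2_eq_square mult.assoc)
  qed
  have DH0: "Dt H0 q = H1 q" if "q \<in> Q" for q
    unfolding H0_def H1_def
    by (subst pderiv_on_minus_eq[OF F smooth_add[OF st'(1) smooth_add[OF st'(2,3)]] that],
        subst pderiv_on_add[OF smooth_differentiable[OF st'(1)] smooth_differentiable[OF smooth_add[OF st'(2,3)]] that],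
        subst pderiv_on_add[OF smooth_differentiable[OF st'(2)] smooth_differentiable[OF st'(3)] that])
      (simp only: Dt_tpoly_slice[OF t0 F that] Dt_tpoly_slice[OF t0 F1 that] Dt_tpoly_slice[OF t0 F2 that] d0 d1 d2, simp add: v0)
  have e0: "norm (H0 (w, t, y)) \<le> B * \<bar>t - t0\<bar> ^ 3" if Q: "(w, t, y) \<in> Q" for w t y
  proof -
    have "norm (H0 (w, t, y) - H0 (w, t0, y)) \<le> (B * \<bar>t - t0\<bar>\<^sup>2) * \<bar>t - t0\<bar>"
    proof (rule dir_t_bound[OF H0 _ Q mem0[OF Q]])
      fix s assume s: "s \<in> closed_segment t t0"
      have "norm (Dt H0 (w, s, y)) \<le> B * \<bar>s - t0\<bar>\<^sup>2"
        using e1[OF mem[OF Q s]] DH0[OF mem[OF Q s]] by simp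
      also have "\<dots> \<le> B * \<bar>t - t0\<bar>\<^sup>2" using seg[OF s] B(1) by (intro mult_left_mono power_mono) auto
      finally show "norm (Dt H0 (w, s, y)) \<le> B * \<bar>t - t0\<bar>\<^sup>2" .
    qed
    moreover have "H0 (w, t0, y) = 0" by (simp add: H0_def v0 v1 v2 slice_def)
    ultimately show ?thesis by (simp add: power2_eq_square power3_eq_cube mult.assoc)
  qed
  show ?thesis
  proof (rule that[OF B(1)])
    fix w t y assume Q: "(w, t, y) \<in> Q"
    show "norm (F (w, t, y) - F (w, t0, y) - (t - t0) *\<^sub>R Dt F (w, t0, y) - ((t - t0)\<^sup>2 / 2) *\<^sub>R Dt (Dt F) (w, t0, y)) \<le> B * \<bar>t - t0\<bar> ^ 3"
      using e0[OF Q] by (simp add: H0_def v0 v1 v2 slice_def algebra_simps)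
  qed
qed

end

text \<open>With \<open>p = e_j + \<theta> e_i\<close> and the functional
  \<open>z_i - \<theta> z_j\<close>, which annihilates \<open>p\<close>, the displayed expression is
  the functional at \<open>M p\<close>. A nonzero off-diagonal entry works with
  \<open>\<theta> = 0\<close>, two different diagonal entries with
  \<open>\<theta> = 1\<close>.\<close>

lemma exists_orthogonal_pair_nonscalar:
  fixes M :: "real^'n^'n"
  assumes "\<not> (\<exists>l. M = l *\<^sub>R mat 1)"
  obtains i j :: 'n and \<theta> :: real where "i \<noteq> j" "\<bar>\<theta>\<bar> \<le> 1"
    "M $ i $ j + \<theta> * M $ i $ i - \<theta> * (M $ j $ j + \<theta> * M $ j $ i) \<noteq> 0"
proof (cases "\<exists>i j. i \<noteq> j \<and> M $ i $ j \<noteq> 0")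
  case True
  then obtain i j where "i \<noteq> j" "M $ i $ j \<noteq> 0" by blast
  then show ?thesis using that[of i j 0] by simp
next
  case False
  have "\<exists>i j. M $ i $ i \<noteq> M $ j $ j"
  proof (rule ccontr)
    assume eq: "\<not> (\<exists>i j. M $ i $ i \<noteq> M $ j $ j)"
    fix k :: 'n
    have "M = (M $ k $ k) *\<^sub>R mat 1"
      using False eq by (auto simp: vec_eq_iff mat_def)
    then show False using assms by blast
  qed
  then obtain i j where ij: "M $ i $ i \<noteq> M $ j $ j" by blast
  then have "i \<noteq> j" by auto
  then have "M $ i $ j = 0" using False by blast
  moreover have "M $ j $ i = 0" using False \<open>i \<noteq> j\<close>[symmetric] by blast
  ultimately show ?thesis using \<open>i \<noteq> j\<close> ij by (intro that[of i j 1]) auto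
qed

section \<open>Thin slices when Bourgain's condition fails\<close>

lemma bounded_bilinear_matrix_vector_mult: "bounded_bilinear ((*v) :: real^'n^'m \<Rightarrow> real^'n \<Rightarrow> real^'m)"
  unfolding bilinear_conv_bounded_bilinear[symmetric] bilinear_def linear_iff
  by (auto simp: matrix_vector_mult_def vec_eq_iff distrib_right distrib_left sum.distrib sum_distrib_left mult_ac)

lemma matrix_vector_mult_bound:
  fixes B :: real
  obtains K where "K \<ge> 1" "\<And>(A :: real^'n^'m) x. norm A \<le> B \<Longrightarrow> norm (A *v x) \<le> K * norm x"
proof -
  obtain k where k: "k > 0" "\<forall>(A :: real^'n^'m) x. norm (A *v x) \<le> norm A * norm x * k"
    using bounded_bilinear.pos_bounded[OF bounded_bilinear_matrix_vector_mult] by blast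
  show ?thesis
  proof (rule that[of "max 1 (B * k)"])
    fix A :: "real^'n^'m" and x :: "real^'n" assume A: "norm A \<le> B"
    have "norm (A *v x) \<le> norm A * norm x * k" using k(2) by blast
    also have "\<dots> = (norm A * k) * norm x" by simp
    also have "\<dots> \<le> max 1 (B * k) * norm x"
      using A k(1) by (intro mult_right_mono) (auto intro: le_max_iff_disj[THEN iffD2] mult_right_mono)
    finally show "norm (A *v x) \<le> max 1 (B * k) * norm x" .
  qed simp
qed

context slab
begin

lemma pderiv_on_matrix:
  assumes "smooth Q X" "q \<in> Q"
  shows "pderiv_on Q (u, 0, v) X q = grad_w Q X q *v u + grad_y Q X q *v v"
proof -
  interpret bounded_linear "\<lambda>v. pderiv_on Q v X q"
    using pderiv_on_works[OF smooth_differentiable[OF assms(1)] assms(2)] has_derivative_bounded_linear by blast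
  have rep: "(\<Sum>j\<in>UNIV. u $ j *\<^sub>R axis j 1) = u" for u :: "real^'m"
    by (simp add: vec_eq_iff axis_def if_distrib cong: if_cong)
  have lw: "(\<Sum>j\<in>UNIV. u $ j *\<^sub>R ((axis j 1, 0, 0) :: 'm pt)) = (u, 0, 0)" for u
  proof -
    have "(\<Sum>j\<in>UNIV. u $ j *\<^sub>R ((axis j 1, 0, 0) :: 'm pt)) = (\<Sum>j\<in>UNIV. (u $ j *\<^sub>R axis j 1, 0, 0))" by simp
    also have "\<dots> = (\<Sum>j\<in>UNIV. u $ j *\<^sub>R axis j 1, \<Sum>j\<in>(UNIV::'m set). 0, \<Sum>j\<in>(UNIV::'m set). 0)"
      by (simp add: sum_prod zero_prod_def)
    finally show ?thesis by (simp add: rep)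
  qed
  have ly: "(\<Sum>j\<in>UNIV. u $ j *\<^sub>R ((0, 0, axis j 1) :: 'm pt)) = (0, 0, u)" for u
  proof -
    have "(\<Sum>j\<in>UNIV. u $ j *\<^sub>R ((0, 0, axis j 1) :: 'm pt)) = (\<Sum>j\<in>UNIV. (0, 0, u $ j *\<^sub>R axis j 1))" by simp
    also have "\<dots> = (\<Sum>j\<in>(UNIV::'m set). 0, \<Sum>j\<in>(UNIV::'m set). 0, \<Sum>j\<in>UNIV. u $ j *\<^sub>R axis j 1)"
      by (simp add: sum_prod zero_prod_def)
    finally show ?thesis by (simp add: rep)
  qed
  have "pderiv_on Q (u, 0, 0) X q = grad_w Q X q *v u"
    unfolding lw[of u, symmetric] sum scaleR
    by (simp add: vec_eq_iff matrix_vector_mult_def grad_w_def mult.commute)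
  moreover have "pderiv_on Q (0, 0, v) X q = grad_y Q X q *v v"
    unfolding ly[of v, symmetric] sum scaleR
    by (simp add: vec_eq_iff matrix_vector_mult_def grad_y_def mult.commute)
  ultimately show ?thesis using add[of "(u, 0, 0)" "(0, 0, v)"] by simp
qed

text \<open>The defect is continuous and the interior dense, so failure at the boundary propagates
  inwards, where there is room for balls in \<open>w\<close>, \<open>t\<close> and
  \<open>y\<close>.\<close>

lemma bourgain_fails_in_interior:
  assumes X: "X \<in> hormander Q" "X \<notin> bourgain Q"
  obtains q where "q \<in> interior Q"
    "\<not> (\<exists>l. deriv_t Q (deriv_t Q (curv_matrix Q X)) q = l *\<^sub>R deriv_t Q (curv_matrix Q X) q)"
proof -
  let ?f = "\<lambda>q. parallel_defect (deriv_t Q (curv_matrix Q X) q) (deriv_t Q (deriv_t Q (curv_matrix Q X)) q)"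
  note H = hormanderD[OF X(1)]
  have c: "continuous_on Q ?f"
    unfolding parallel_defect_def
    by (intro continuous_intros smooth_continuous_on curv_eqs(2,3)[OF H(1,2)]) auto
  have "\<not> (\<forall>q\<in>interior Q. ?f q = 0)"
  proof
    assume z: "\<forall>q\<in>interior Q. ?f q = 0"
    have "\<forall>q\<in>Q. ?f q = 0"
      using zero_on_interior_imp_zero[OF c] z by blast
    then show False using bourgain_iff[OF X(1)] X(2) by blast
  qed
  then obtain q where q: "q \<in> interior Q" "?f q \<noteq> 0" by blast
  have "q \<in> Q" using q(1) interior_subset by blast
  then have "deriv_t Q (curv_matrix Q X) q \<noteq> 0"
    using H(4) det_nonzero_imp_nonzero by blast
  then show ?thesis using that[OF q(1)] q(2) parallel_defect_eq_0 by blast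
qed

text \<open>The linear choice \<open>\<omega>(y) = w\<^sub>0 + \<Lambda> (y - y\<^sub>0)\<close> annihilates \<open>\<nu> = l - (t - t\<^sub>0) M\<^sup>T l / 2\<close> up to
  third order in \<open>t - t\<^sub>0\<close>, where \<open>M\<close> is the non-scalar matrix witnessing the failure of
  Bourgain's condition; hence the time slices are abnormally thin.\<close>

lemma thin_slices:
  assumes X: "X \<in> hormander Q" "X \<notin> bourgain Q"
  obtains t\<^sub>0 :: real and y\<^sub>0 :: "real^'m" and \<omega> :: "real^'m \<Rightarrow> real^'m" and r K :: real
  where "0 < r" "r \<le> 1" "0 < K" "{t\<^sub>0 - r..t\<^sub>0 + r} \<subseteq> {a..b}" "cball y\<^sub>0 r \<subseteq> Y" "\<And>y. y \<in> cball y\<^sub>0 r \<Longrightarrow> \<omega> y \<in> W"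
    "\<And>\<rho> t H. 0 < \<rho> \<Longrightarrow> \<rho> \<le> r \<Longrightarrow> \<bar>t - t\<^sub>0\<bar> \<le> \<rho> \<Longrightarrow>
      H \<subseteq> {x. \<exists>y\<in>ball y\<^sub>0 (\<rho> ^ 3). \<exists>t'\<in>{a..b}. \<bar>t - t'\<bar> < \<rho> ^ 6 \<and> dist x (X (\<omega> y, t', y)) < \<rho> ^ 6} \<Longrightarrow>
      \<exists>\<C>. finite \<C> \<and> \<Union>\<C> = H \<and> real (card \<C>) * \<rho> ^ (2 * CARD('m)) \<le> K * \<rho> \<and>
        (\<forall>c\<in>\<C>. \<forall>x\<in>c. \<forall>x'\<in>c. dist x x' \<le> K * \<rho> ^ 6)"
proof -
  note H = hormanderD[OF X(1)]
  let ?C = "curv_matrix Q X"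
  have sC: "smooth Q ?C" by (rule curv_eqs(1)[OF H(1,2)])
  obtain q\<^sub>0 where q0: "q\<^sub>0 \<in> interior Q"
    "\<not> (\<exists>l. deriv_t Q (deriv_t Q ?C) q\<^sub>0 = l *\<^sub>R deriv_t Q ?C q\<^sub>0)"
    by (rule bourgain_fails_in_interior[OF X])
  obtain w\<^sub>0 t\<^sub>0 y\<^sub>0 where q0_eq: "q\<^sub>0 = (w\<^sub>0, t\<^sub>0, y\<^sub>0)" by (cases q\<^sub>0)
  have int: "w\<^sub>0 \<in> interior W" "t\<^sub>0 \<in> interior {a..b}" "y\<^sub>0 \<in> interior Y"
    using q0(1) unfolding q0_eq Q_eq interior_Times by auto
  obtain e1 where e1: "e1 > 0" "cball w\<^sub>0 e1 \<subseteq> W" using int(1) mem_interior_cball by blast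
  obtain e2 where e2: "e2 > 0" "cball t\<^sub>0 e2 \<subseteq> {a..b}" using int(2) mem_interior_cball by blast
  obtain e3 where e3: "e3 > 0" "cball y\<^sub>0 e3 \<subseteq> Y" using int(3) mem_interior_cball by blast
  have q0Q: "q\<^sub>0 \<in> Q" using q0(1) interior_subset by blast
  have t0: "t\<^sub>0 \<in> {a..b}" and w0: "w\<^sub>0 \<in> W" and y0: "y\<^sub>0 \<in> Y" using q0Q by (auto simp: q0_eq Q_eq)
  define A1 where "A1 = deriv_t Q ?C q\<^sub>0"
  define A2 where "A2 = deriv_t Q (deriv_t Q ?C) q\<^sub>0"
  have det1: "det A1 \<noteq> 0" unfolding A1_def by (rule H(4)[OF q0Q])
  define M where "M = matrix_inv A1 ** A2"
  have A2: "A2 = A1 ** M" unfolding M_def matrix_mul_assoc matrix_inv_works(1)[OF det1] by simp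
  have "\<not> (\<exists>l. M = l *\<^sub>R mat 1)"
  proof
    assume "\<exists>l. M = l *\<^sub>R mat 1"
    then obtain l where "M = l *\<^sub>R mat 1" by blast
    then have "A2 = l *\<^sub>R A1" unfolding A2 by (simp add: matrix_scalar_ac scalar_matrix_assoc[symmetric])
    then show False using q0(2) unfolding A1_def A2_def by blast
  qed
  then obtain i j :: 'm and \<theta> :: real where ij: "i \<noteq> j" "\<bar>\<theta>\<bar> \<le> 1"
    "M $ i $ j + \<theta> * M $ i $ i - \<theta> * (M $ j $ j + \<theta> * M $ j $ i) \<noteq> 0"
    by (rule exists_orthogonal_pair_nonscalar)
  define lf :: "real^'m \<Rightarrow> real" where "lf z = z $ i - \<theta> * z $ j" for z
  define p :: "real^'m" where "p = axis j 1 + \<theta> *\<^sub>R axis i 1"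
  define \<kappa> where "\<kappa> = lf (M *v p)"
  have lf_add: "lf (u + v) = lf u + lf v" and lf_scale: "lf (s *\<^sub>R u) = s * lf u"
    and lf_diff: "lf (u - v) = lf u - lf v" for u v s
    by (simp_all add: lf_def algebra_simps)
  have lf_bound: "\<bar>lf u\<bar> \<le> 2 * norm u" for u
  proof -
    have "\<bar>\<theta> * u $ j\<bar> \<le> 1 * norm u"
      unfolding abs_mult using ij(2) component_le_norm_cart by (intro mult_mono) auto
    then show ?thesis using component_le_norm_cart[of u i] unfolding lf_def by linarith
  qed
  have p_comp: "p $ i = \<theta>" "p $ j = 1" "\<And>k. k \<noteq> i \<Longrightarrow> k \<noteq> j \<Longrightarrow> p $ k = 0"
    using ij(1) by (auto simp: p_def axis_def)
  have lf_p: "lf p = 0" by (simp add: lf_def p_comp)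
  have np: "norm p \<le> 2"
  proof -
    have "norm p \<le> norm (axis j 1 :: real^'m) + norm (\<theta> *\<^sub>R axis i 1 :: real^'m)"
      unfolding p_def by (rule norm_triangle_ineq)
    also have "\<dots> \<le> 1 + 1" using ij(2) by (simp add: norm_axis_1)
    finally show ?thesis by simp
  qed
  have \<kappa>: "\<kappa> \<noteq> 0"
  proof -
    have "(M *v p) $ k = M $ k $ j + \<theta> * M $ k $ i" for k
    proof -
      have "(M *v axis l 1) $ k = M $ k $ l" for l
        unfolding matrix_vector_mult_def axis_def by (simp add: if_distrib cong: if_cong)
      then show ?thesis
        by (simp add: p_def matrix_vector_right_distrib matrix_vector_mult_scaleR)
    qed
    then show ?thesis using ij(3) by (simp add: \<kappa>_def lf_def)
  qed
  \<comment> \<open>The normalisation \<open>c * \<kappa> = 2\<close> makes the first-order terms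
    cancel in the coordinate \<open>g t i\<close>.\<close>
  define c where "c = 2 / \<kappa>"
  define C0 where "C0 = ?C q\<^sub>0"
  \<comment> \<open>At time \<open>t\<^sub>0\<close> the choice of \<open>\<omega>\<close> leaves
    only this rank-one map of \<open>y - y\<^sub>0\<close>, whose image is spanned by
    \<open>A1 p\<close> with \<open>lf p = 0\<close>.\<close>
  define L where "L h = (c * lf h) *\<^sub>R (A1 *v p)" for h
  define \<Lambda> where "\<Lambda> h = L h - C0 *v h" for h
  define \<omega> where "\<omega> y = w\<^sub>0 + \<Lambda> (y - y\<^sub>0)" for y
  define G where "G t = grad_w Q X (w\<^sub>0, t, y\<^sub>0)" for t
  have qt: "(w\<^sub>0, t, y\<^sub>0) \<in> Q" if "t \<in> {a..b}" for t using that w0 y0 by (auto simp: Q_eq)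
  have detG: "det (G t) \<noteq> 0" if "t \<in> {a..b}" for t unfolding G_def by (rule H(2)[OF qt[OF that]])
  have sG: "smooth Q (grad_w Q X)" unfolding grad_w_jacobian by (rule smooth_jacobian[OF H(1)])
  obtain BG where BG: "BG > 0" "\<And>q. q \<in> Q \<Longrightarrow> norm (grad_w Q X q) \<le> BG" by (rule smooth_bounded[OF sG], rule that)
  obtain BI where BI: "BI > 0" "\<And>q. q \<in> Q \<Longrightarrow> norm (matrix_inv (grad_w Q X q)) \<le> BI"
    by (rule smooth_bounded[OF smooth_matrix_inv[OF sG H(2)]], assumption, rule that)
  define Bm where "Bm = Max {BG, BI, norm A1, norm (matrix_inv A1), norm M, norm C0}"
  obtain KB where KB: "KB \<ge> 1" "\<And>(A :: real^'m^'m) x. norm A \<le> Bm \<Longrightarrow> norm (A *v x) \<le> KB * norm x"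
    using matrix_vector_mult_bound[of Bm] by blast
  have Bm: "BG \<le> Bm" "BI \<le> Bm" "norm A1 \<le> Bm" "norm (matrix_inv A1) \<le> Bm" "norm M \<le> Bm" "norm C0 \<le> Bm"
    unfolding Bm_def by auto
  have bG: "norm (G t *v x) \<le> KB * norm x" "norm (matrix_inv (G t) *v x) \<le> KB * norm x" if "t \<in> {a..b}" for t x
    unfolding G_def using Bm(1,2) BG(2)[OF qt[OF that]] BI(2)[OF qt[OF that]] by (auto intro!: KB(2))
  have bA1: "norm (A1 *v x) \<le> KB * norm x" and bI: "norm (matrix_inv A1 *v x) \<le> KB * norm x"
    and bM: "norm (M *v x) \<le> KB * norm x" and bC0: "norm (C0 *v x) \<le> KB * norm x" for x
    using Bm by (auto intro!: KB(2))
  define KL where "KL = \<bar>c\<bar> * 4 * KB + KB"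
  have KL: "norm (\<Lambda> h) \<le> KL * norm h" for h
  proof -
    have "norm (L h) = \<bar>c\<bar> * \<bar>lf h\<bar> * norm (A1 *v p)" by (simp add: L_def abs_mult)
    also have "\<dots> \<le> \<bar>c\<bar> * (2 * norm h) * (KB * 2)"
    proof (intro mult_mono)
      show "norm (A1 *v p) \<le> KB * 2" by (rule order_trans[OF bA1 mult_left_mono[OF np]]) (use KB(1) in simp)
    qed (use lf_bound[of h] in auto)
    finally have "norm (L h) \<le> \<bar>c\<bar> * 4 * KB * norm h" by (simp add: mult_ac)
    then show ?thesis unfolding \<Lambda>_def KL_def using bC0[of h] norm_triangle_ineq4[of "L h" "C0 *v h"]
      by (simp add: distrib_right)
  qed
  have KL0: "KL \<ge> 1" unfolding KL_def using KB(1) by (simp add: add_increasing)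
  obtain K1 where K1: "K1 > 0" "\<And>q q'. q \<in> Q \<Longrightarrow> q' \<in> Q \<Longrightarrow> norm (X q - X q') \<le> K1 * norm (q - q')"
    by (rule smooth_Lipschitz[OF H(1)], rule that)
  obtain K2 where K2: "K2 > 0" "\<And>q q'. q \<in> Q \<Longrightarrow> q' \<in> Q \<Longrightarrow>
      norm (X q' - X q - pderiv_on Q (q' - q) X q) \<le> K2 * (norm (q' - q))\<^sup>2"
    by (rule taylor_second_order[OF H(1)], rule that)
  obtain B where B: "B > 0" "\<And>w t y. (w, t, y) \<in> Q \<Longrightarrow>
    norm (?C (w, t, y) - ?C (w, t\<^sub>0, y) - (t - t\<^sub>0) *\<^sub>R Dt ?C (w, t\<^sub>0, y) - ((t - t\<^sub>0)\<^sup>2 / 2) *\<^sub>R Dt (Dt ?C) (w, t\<^sub>0, y)) \<le> B * \<bar>t - t\<^sub>0\<bar> ^ 3"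
    by (rule taylor_third_order_t[OF sC t0], rule that)
  obtain k3 where k3: "k3 > 0" "\<forall>(A :: real^'m^'m) x. norm (A *v x) \<le> norm A * norm x * k3"
    using bounded_bilinear.pos_bounded[OF bounded_bilinear_matrix_vector_mult] by blast
  define K5 where "K5 = KB * KB * (1 + K1 + K2 * (KL + 1)\<^sup>2) + KB * (B * k3)"
  have K5: "K5 > 0" unfolding K5_def using KB(1) K1(1) K2(1) B(1) k3(1) by (intro add_nonneg_pos mult_nonneg_nonneg) auto
  define D where "D = 4 * K5 + 4 * \<bar>c\<bar> + 1 + KB + KB * KB + KB * K5"
  have D: "D > 0" unfolding D_def using K5 KB(1) by (intro add_pos_pos add_pos_nonneg) auto
  \<comment> \<open>In turn: normalisation, room in time, room in \<open>y\<close>, room for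
    \<open>\<omega> y\<close> in \<open>W\<close>, and smallness that lets the corrected functional
    still control \<open>lf\<close>.\<close>
  define r where "r = Min {1, e2, e3, e1 / KL, 1 / (2 * KB)}"
  have r: "0 < r" "r \<le> 1" "r \<le> e2" "r \<le> e3" "r \<le> e1 / KL" "r \<le> 1 / (2 * KB)"
    unfolding r_def using e1 e2 e3 KL0 KB(1) by auto
  have rKL: "KL * r \<le> e1" using r(5) KL0 by (simp add: pos_le_divide_eq mult.commute)
  have rKB: "r * KB \<le> 1 / 2" using r(6) KB(1) by (simp add: pos_le_divide_eq)
  have \<omega>W: "\<omega> y \<in> W" if "y \<in> cball y\<^sub>0 r" for y
  proof -
    have "norm (\<Lambda> (y - y\<^sub>0)) \<le> KL * norm (y - y\<^sub>0)" by (rule KL)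
    also have "\<dots> \<le> KL * r" using that KL0 by (intro mult_left_mono) (auto simp: dist_norm norm_minus_commute)
    finally have "dist w\<^sub>0 (\<omega> y) \<le> e1" using rKL by (simp add: \<omega>_def dist_norm)
    then show ?thesis using e1(2) by auto
  qed
  have yY: "y \<in> Y" if "y \<in> cball y\<^sub>0 r" for y using that r(4) e3(2) by auto
  have tI: "{t\<^sub>0 - r..t\<^sub>0 + r} \<subseteq> {a..b}"
  proof
    fix t assume "t \<in> {t\<^sub>0 - r..t\<^sub>0 + r}"
    then have "t \<in> cball t\<^sub>0 e2" using r(3) by (auto simp: dist_real_def)
    then show "t \<in> {a..b}" using e2(2) by blast
  qed
  \<comment> \<open>The slice recentred at the central curve, with the invertible factors
    \<open>G t\<close> and \<open>A1\<close> undone.\<close>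
  define S where "S t x = matrix_inv A1 *v (matrix_inv (G t) *v (x - X (w\<^sub>0, t, y\<^sub>0)))" for t x
  \<comment> \<open>Four errors of size \<open>\<rho>^6\<close>: the neighbourhood
    (\<open>f1\<close>), the time shift (\<open>f2\<close>), the quadratic Taylor term in
    \<open>y - y\<^sub>0\<close> of norm below \<open>\<rho>^3\<close> (\<open>f3\<close>), and the
    cubic time remainder of the curvature matrix applied to \<open>y - y\<^sub>0\<close>
    (\<open>Rm\<close>).\<close>
  have expansion: "\<exists>e. S t x = (c * lf (y - y\<^sub>0)) *\<^sub>R p + (t - t\<^sub>0) *\<^sub>R (y - y\<^sub>0) + ((t - t\<^sub>0)\<^sup>2 / 2) *\<^sub>R (M *v (y - y\<^sub>0)) + e
      \<and> norm e \<le> K5 * \<rho> ^ 6"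
    if \<rho>: "0 < \<rho>" "\<rho> \<le> r" "\<bar>t - t\<^sub>0\<bar> \<le> \<rho>" and y: "y \<in> ball y\<^sub>0 (\<rho> ^ 3)" and t': "t' \<in> {a..b}" "\<bar>t - t'\<bar> < \<rho> ^ 6"
      and x: "dist x (X (\<omega> y, t', y)) < \<rho> ^ 6" for \<rho> t y t' x
  proof -
    define h where "h = y - y\<^sub>0"
    define \<tau> where "\<tau> = t - t\<^sub>0"
    have h: "norm h < \<rho> ^ 3" using y by (simp add: h_def dist_norm norm_minus_commute)
    have \<rho>1: "\<rho> \<le> 1" using \<rho>(2) r(2) by simp
    have "\<rho> ^ 3 \<le> \<rho> ^ 1" using \<rho>(1) \<rho>1 by (intro power_decreasing) auto
    then have yr: "y \<in> cball y\<^sub>0 r" using y \<rho>(2) by simp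
    have tab: "t \<in> {a..b}" using tI \<rho> by (intro subsetD[OF tI]) auto
    have qy: "(\<omega> y, t, y) \<in> Q" "(\<omega> y, t', y) \<in> Q" using \<omega>W[OF yr] yY[OF yr] tab t' by (auto simp: Q_eq)
    define x0 where "x0 = X (w\<^sub>0, t, y\<^sub>0)"
    define f1 where "f1 = x - X (\<omega> y, t', y)"
    define f2 where "f2 = X (\<omega> y, t', y) - X (\<omega> y, t, y)"
    define f3 where "f3 = X (\<omega> y, t, y) - x0 - pderiv_on Q (\<Lambda> h, 0, h) X (w\<^sub>0, t, y\<^sub>0)"
    have "norm f1 \<le> \<rho> ^ 6" using x by (simp add: f1_def dist_norm)
    moreover have "norm f2 \<le> K1 * \<rho> ^ 6"
    proof -
      have "norm f2 \<le> K1 * norm ((\<omega> y, t', y) - (\<omega> y, t, y))" unfolding f2_def by (rule K1(2)[OF qy(2,1)])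
      also have "norm ((\<omega> y, t', y) - (\<omega> y, t, y)) = \<bar>t' - t\<bar>" by (simp add: norm_Pair)
      also have "K1 * \<bar>t' - t\<bar> \<le> K1 * \<rho> ^ 6" using t'(2) K1(1) by (intro mult_left_mono) auto
      finally show ?thesis .
    qed
    moreover have "norm f3 \<le> K2 * (KL + 1)\<^sup>2 * \<rho> ^ 6"
    proof -
      have dq: "(\<omega> y, t, y) - (w\<^sub>0, t, y\<^sub>0) = (\<Lambda> h, 0, h)" by (simp add: \<omega>_def h_def)
      have "norm (\<Lambda> h, 0 :: real, h) \<le> norm (\<Lambda> h) + norm h"
        unfolding norm_Pair using sqrt_sum_squares_le_sum_abs[of "norm (\<Lambda> h)" "norm h"] by simp
      also have "norm (\<Lambda> h) + norm h \<le> (KL + 1) * norm h" using KL[of h] by (simp add: distrib_right)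
      also have "(KL + 1) * norm h \<le> (KL + 1) * \<rho> ^ 3" using h KL0 by (intro mult_left_mono) auto
      finally have nn: "norm (\<Lambda> h, 0 :: real, h) \<le> (KL + 1) * \<rho> ^ 3" .
      have "norm f3 \<le> K2 * (norm (\<Lambda> h, 0 :: real, h))\<^sup>2"
        using K2(2)[OF qt[OF tab] qy(1)] unfolding dq f3_def x0_def .
      also have "\<dots> \<le> K2 * ((KL + 1) * \<rho> ^ 3)\<^sup>2" using K2(1) nn by (intro mult_left_mono power_mono) auto
      also have "\<dots> = K2 * (KL + 1)\<^sup>2 * \<rho> ^ 6" by (simp add: power_mult_distrib power_mult[symmetric])
      finally show ?thesis .
    qed
    ultimately have f: "norm (f1 + f2 + f3) \<le> (1 + K1 + K2 * (KL + 1)\<^sup>2) * \<rho> ^ 6"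
      using norm_triangle_ineq[of "f1 + f2" f3] norm_triangle_ineq[of f1 f2] by (simp add: distrib_right)
    define Rm where "Rm = ?C (w\<^sub>0, t, y\<^sub>0) - C0 - \<tau> *\<^sub>R A1 - (\<tau>\<^sup>2 / 2) *\<^sub>R A2"
    have Rm: "norm Rm \<le> B * \<rho> ^ 3"
    proof -
      have "norm Rm \<le> B * \<bar>\<tau>\<bar> ^ 3"
        using B(2)[OF qt[OF tab]] unfolding Rm_def C0_def A1_def A2_def \<tau>_def q0_eq deriv_t_def .
      also have "\<dots> \<le> B * \<rho> ^ 3" using \<rho>(3) B(1) unfolding \<tau>_def by (intro mult_left_mono power_mono) auto
      finally show ?thesis .
    qed
    have GC: "grad_y Q X (w\<^sub>0, t, y\<^sub>0) = G t ** ?C (w\<^sub>0, t, y\<^sub>0)"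
      unfolding curv_matrix_def G_def matrix_mul_assoc using matrix_inv_works(1)[OF H(2)[OF qt[OF tab]]] by simp
    have "pderiv_on Q (\<Lambda> h, 0, h) X (w\<^sub>0, t, y\<^sub>0) = G t *v (\<Lambda> h + ?C (w\<^sub>0, t, y\<^sub>0) *v h)"
      unfolding pderiv_on_matrix[OF H(1) qt[OF tab]] GC
      by (simp add: G_def matrix_vector_right_distrib matrix_vector_mul_assoc)
    moreover have "\<Lambda> h + ?C (w\<^sub>0, t, y\<^sub>0) *v h = A1 *v ((c * lf h) *\<^sub>R p + \<tau> *\<^sub>R h + (\<tau>\<^sup>2 / 2) *\<^sub>R (M *v h)) + Rm *v h"
    proof -
      have "?C (w\<^sub>0, t, y\<^sub>0) = C0 + \<tau> *\<^sub>R A1 + (\<tau>\<^sup>2 / 2) *\<^sub>R (A1 ** M) + Rm" unfolding Rm_def A2 by simp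
      then show ?thesis
        by (simp add: \<Lambda>_def L_def matrix_vector_mult_add_rdistrib matrix_vector_right_distrib
            matrix_vector_mult_scaleR scaleR_matrix_vector_assoc[symmetric] matrix_vector_mul_assoc)
    qed
    ultimately have Dh: "pderiv_on Q (\<Lambda> h, 0, h) X (w\<^sub>0, t, y\<^sub>0)
      = G t *v (A1 *v ((c * lf h) *\<^sub>R p + \<tau> *\<^sub>R h + (\<tau>\<^sup>2 / 2) *\<^sub>R (M *v h)) + Rm *v h)" by simp
    have "x - x0 = (f1 + f2 + f3) + pderiv_on Q (\<Lambda> h, 0, h) X (w\<^sub>0, t, y\<^sub>0)"
      by (simp add: f1_def f2_def f3_def)
    have invG: "matrix_inv (G t) *v (G t *v v) = v" for v
      by (simp add: matrix_vector_mul_assoc matrix_inv_works(2)[OF detG[OF tab]])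
    have invA: "matrix_inv A1 *v (A1 *v v) = v" for v
      by (simp add: matrix_vector_mul_assoc matrix_inv_works(2)[OF det1])
    define e where "e = matrix_inv A1 *v (matrix_inv (G t) *v (f1 + f2 + f3)) + matrix_inv A1 *v (Rm *v h)"
    have "S t x = (c * lf h) *\<^sub>R p + \<tau> *\<^sub>R h + (\<tau>\<^sup>2 / 2) *\<^sub>R (M *v h) + e"
      unfolding S_def x0_def[symmetric] \<open>x - x0 = _\<close> Dh
      by (simp only: matrix_vector_right_distrib[of "matrix_inv (G t)"] invG matrix_vector_right_distrib[of "matrix_inv A1"] invA e_def add_ac)
    moreover have "norm e \<le> K5 * \<rho> ^ 6"
    proof -
      have "norm (matrix_inv A1 *v (matrix_inv (G t) *v (f1 + f2 + f3))) \<le> KB * (KB * norm (f1 + f2 + f3))"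
        using bG(2)[OF tab, of "f1 + f2 + f3"] KB(1) by (intro order_trans[OF bI] mult_left_mono) auto
      also have "\<dots> \<le> KB * (KB * ((1 + K1 + K2 * (KL + 1)\<^sup>2) * \<rho> ^ 6))"
        using f KB(1) by (intro mult_left_mono) auto
      finally have 1: "norm (matrix_inv A1 *v (matrix_inv (G t) *v (f1 + f2 + f3))) \<le> KB * KB * (1 + K1 + K2 * (KL + 1)\<^sup>2) * \<rho> ^ 6"
        by (simp only: mult.assoc)
      have "norm (Rm *v h) \<le> norm Rm * norm h * k3" using k3(2) by blast
      also have "\<dots> \<le> (B * \<rho> ^ 3) * \<rho> ^ 3 * k3" using Rm h k3(1) B(1) \<rho>(1) by (intro mult_mono) auto
      also have "\<dots> = B * k3 * \<rho> ^ 6" by (simp add: power_add[symmetric])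
      finally have "norm (matrix_inv A1 *v (Rm *v h)) \<le> KB * (B * k3 * \<rho> ^ 6)"
        using KB(1) by (intro order_trans[OF bI] mult_left_mono) auto
      then show ?thesis using 1 norm_triangle_ineq[of "matrix_inv A1 *v (matrix_inv (G t) *v (f1 + f2 + f3))" "matrix_inv A1 *v (Rm *v h)"]
        unfolding e_def K5_def by (simp add: distrib_right mult.assoc)
    qed
    ultimately show ?thesis unfolding h_def \<tau>_def by blast
  qed
  \<comment> \<open>Adapted coordinates: the component \<open>i\<close> is replaced by the
    functional \<open>lf\<close> corrected to first order in time, the others are kept.\<close>
  define g where "g t k x = (if k = i then lf (S t x) - (t - t\<^sub>0) / 2 * lf (M *v S t x) else S t x $ k)" for t k x
  \<comment> \<open>The extents: \<open>\<rho>^6\<close> for the corrected functional,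
    \<open>\<rho>^3\<close> along \<open>p\<close>, where the rank-one term acts, and
    \<open>\<rho> * \<rho>^3\<close> elsewhere.\<close>
  define ex :: "'m \<Rightarrow> nat" where "ex k = (if k = i then 6 else if k = j then 3 else 4)" for k
  have g_bound: "\<bar>g t k x\<bar> \<le> D * \<rho> ^ ex k"
    if \<rho>: "0 < \<rho>" "\<rho> \<le> r" "\<bar>t - t\<^sub>0\<bar> \<le> \<rho>"
      and x: "\<exists>y\<in>ball y\<^sub>0 (\<rho> ^ 3). \<exists>t'\<in>{a..b}. \<bar>t - t'\<bar> < \<rho> ^ 6 \<and> dist x (X (\<omega> y, t', y)) < \<rho> ^ 6" for \<rho> t k x
  proof -
    obtain y t' where yt: "y \<in> ball y\<^sub>0 (\<rho> ^ 3)" "t' \<in> {a..b}" "\<bar>t - t'\<bar> < \<rho> ^ 6" "dist x (X (\<omega> y, t', y)) < \<rho> ^ 6"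
      using x by blast
    define h where "h = y - y\<^sub>0"
    define \<tau> where "\<tau> = t - t\<^sub>0"
    obtain e where e: "S t x = (c * lf h) *\<^sub>R p + \<tau> *\<^sub>R h + (\<tau>\<^sup>2 / 2) *\<^sub>R (M *v h) + e" "norm e \<le> K5 * \<rho> ^ 6"
      using expansion[OF \<rho> yt] unfolding h_def \<tau>_def by blast
    have h: "norm h \<le> \<rho> ^ 3" using yt(1) by (simp add: h_def dist_norm norm_minus_commute)
    have \<rho>1: "\<rho> \<le> 1" using \<rho>(2) r(2) by simp
    have \<tau>: "\<bar>\<tau>\<bar> \<le> \<rho>" using \<rho>(3) by (simp add: \<tau>_def)
    have pd: "\<rho> ^ n \<le> \<rho> ^ k" if "k \<le> n" for n k using that \<rho>(1) \<rho>1 by (intro power_decreasing) auto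
    have Mh: "norm (M *v h) \<le> KB * \<rho> ^ 3" using bM[of h] h KB(1) by (meson mult_left_mono order_trans zero_le_one)
    have \<tau>2: "\<tau>\<^sup>2 \<le> \<rho>\<^sup>2" using \<tau> by (metis abs_ge_zero power2_abs power_mono)
    show ?thesis
    proof (cases "k = i")
      case True
      define m2 where "m2 = M *v (M *v h)"
      have "M *v S t x = (c * lf h) *\<^sub>R (M *v p) + \<tau> *\<^sub>R (M *v h) + (\<tau>\<^sup>2 / 2) *\<^sub>R m2 + M *v e"
        unfolding e(1) m2_def by (simp add: matrix_vector_right_distrib matrix_vector_mult_scaleR)
      then have lM: "lf (M *v S t x) = c * lf h * \<kappa> + \<tau> * lf (M *v h) + (\<tau>\<^sup>2 / 2) * lf m2 + lf (M *v e)"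
        by (simp add: lf_add lf_scale \<kappa>_def)
      have lS: "lf (S t x) = \<tau> * lf h + (\<tau>\<^sup>2 / 2) * lf (M *v h) + lf e"
        unfolding e(1) by (simp add: lf_add lf_scale lf_p)
      have ck: "c * lf h * \<kappa> = 2 * lf h" using \<kappa> by (simp add: c_def)
      \<comment> \<open>Since \<open>lf p = 0\<close> and \<open>c * \<kappa> = 2\<close>, the terms
        in \<open>\<tau> * lf h\<close> and \<open>\<tau>^2 * lf (M *v h)\<close> cancel; what
        remains has order \<open>\<tau>^3 |h|\<close> or is error.\<close>
      have "g t k x = lf e - (\<tau> ^ 3 / 4) * lf m2 - (\<tau> / 2) * lf (M *v e)"
        unfolding g_def True lM lS ck \<tau>_def[symmetric] by (simp add: algebra_simps power2_eq_square power3_eq_cube)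
      then have "\<bar>g t k x\<bar> \<le> \<bar>lf e\<bar> + \<bar>(\<tau> ^ 3 / 4) * lf m2\<bar> + \<bar>(\<tau> / 2) * lf (M *v e)\<bar>" by linarith
      also have "\<bar>lf e\<bar> \<le> 2 * (K5 * \<rho> ^ 6)" using lf_bound[of e] e(2) by linarith
      also have "\<bar>(\<tau> ^ 3 / 4) * lf m2\<bar> \<le> (\<rho> ^ 3 / 4) * (2 * (KB * (KB * \<rho> ^ 3)))"
      proof -
        have "norm m2 \<le> KB * norm (M *v h)" unfolding m2_def by (rule bM)
        also have "\<dots> \<le> KB * (KB * \<rho> ^ 3)" using Mh KB(1) by (intro mult_left_mono) auto
        finally have "\<bar>lf m2\<bar> \<le> 2 * (KB * (KB * \<rho> ^ 3))" using lf_bound[of m2] by linarith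
        moreover have "\<bar>\<tau> ^ 3 / 4\<bar> \<le> \<rho> ^ 3 / 4" using \<tau> by (simp add: power_abs power_mono)
        ultimately show ?thesis unfolding abs_mult using \<rho>(1) by (intro mult_mono) auto
      qed
      also have "(\<rho> ^ 3 / 4) * (2 * (KB * (KB * \<rho> ^ 3))) \<le> KB * KB * \<rho> ^ 6"
      proof -
        have "(\<rho> ^ 3 / 4) * (2 * (KB * (KB * \<rho> ^ 3))) = (KB * KB * \<rho> ^ 6) / 2" by (simp add: power_add[symmetric])
        moreover have "KB * KB * \<rho> ^ 6 \<ge> 0" using KB(1) \<rho>(1) by simp
        ultimately show ?thesis by linarith
      qed
      also have "\<bar>(\<tau> / 2) * lf (M *v e)\<bar> \<le> KB * K5 * \<rho> ^ 6"
      proof -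
        have "norm (M *v e) \<le> KB * (K5 * \<rho> ^ 6)" using bM[of e] e(2) KB(1) by (meson mult_left_mono order_trans zero_le_one)
        then have "\<bar>lf (M *v e)\<bar> \<le> 2 * (KB * (K5 * \<rho> ^ 6))" using lf_bound[of "M *v e"] by linarith
        moreover have "\<bar>\<tau> / 2\<bar> \<le> 1 / 2" using \<tau> \<rho>1 by simp
        ultimately have "\<bar>\<tau> / 2\<bar> * \<bar>lf (M *v e)\<bar> \<le> 1 / 2 * (2 * (KB * (K5 * \<rho> ^ 6)))" by (intro mult_mono) auto
        then show ?thesis by (simp add: abs_mult)
      qed
      finally have "\<bar>g t k x\<bar> \<le> (2 * K5 + KB * KB + KB * K5) * \<rho> ^ 6" by (simp add: distrib_right)
      also have "\<dots> \<le> D * \<rho> ^ 6" unfolding D_def using K5 KB(1) \<rho>(1) by (intro mult_right_mono) auto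
      finally show ?thesis by (simp add: ex_def True)
    next
      case False
      have eb: "norm e \<le> K5 * \<rho> ^ 4"
        by (rule order_trans[OF e(2) mult_left_mono[OF pd]]) (use K5 in auto)
      have hb: "norm (\<tau> *\<^sub>R h) \<le> \<rho> ^ 4"
      proof -
        have "\<bar>\<tau>\<bar> * norm h \<le> \<rho> * \<rho> ^ 3" using \<tau> h \<rho>(1) by (intro mult_mono) auto
        then show ?thesis by (simp add: power_Suc[symmetric] del: power_Suc)
      qed
      have mb: "norm ((\<tau>\<^sup>2 / 2) *\<^sub>R (M *v h)) \<le> KB * \<rho> ^ 4"
      proof -
        have "\<rho>\<^sup>2 \<le> \<rho> ^ 1" by (rule pd) simp
        then have "\<tau>\<^sup>2 / 2 \<le> \<rho>" using \<tau>2 zero_le_power2[of \<tau>] unfolding power_one_right by linarith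
        then have "(\<tau>\<^sup>2 / 2) * norm (M *v h) \<le> \<rho> * (KB * \<rho> ^ 3)" using Mh \<rho>(1) by (intro mult_mono) auto
        also have "\<dots> = KB * \<rho> ^ 4" by (simp add: power_Suc[symmetric] del: power_Suc)
        finally show ?thesis by simp
      qed
      have rest: "\<bar>(\<tau> *\<^sub>R h + (\<tau>\<^sup>2 / 2) *\<^sub>R (M *v h) + e) $ k\<bar> \<le> (1 + KB + K5) * \<rho> ^ 4"
        using component_le_norm_cart[of "\<tau> *\<^sub>R h + (\<tau>\<^sup>2 / 2) *\<^sub>R (M *v h) + e" k]
          norm_triangle_ineq[of "\<tau> *\<^sub>R h + (\<tau>\<^sup>2 / 2) *\<^sub>R (M *v h)" e] norm_triangle_ineq[of "\<tau> *\<^sub>R h" "(\<tau>\<^sup>2 / 2) *\<^sub>R (M *v h)"]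
          eb hb mb by (simp only: distrib_right mult_1_left)
      have gk: "g t k x = c * lf h * p $ k + (\<tau> *\<^sub>R h + (\<tau>\<^sup>2 / 2) *\<^sub>R (M *v h) + e) $ k"
        using False unfolding g_def e(1) by simp
      show ?thesis
      proof (cases "k = j")
        case True
        have "\<bar>c * lf h * p $ k\<bar> \<le> \<bar>c\<bar> * (2 * \<rho> ^ 3)"
          unfolding True p_comp using lf_bound[of h] h by (simp add: abs_mult mult_left_mono)
        moreover have "(1 + KB + K5) * \<rho> ^ 4 \<le> (1 + KB + K5) * \<rho> ^ 3" using pd[of 3 4] K5 KB(1) by (intro mult_left_mono) auto
        ultimately have "\<bar>g t k x\<bar> \<le> (2 * \<bar>c\<bar> + (1 + KB + K5)) * \<rho> ^ 3" using rest gk by (simp add: distrib_right)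
        also have "\<dots> \<le> D * \<rho> ^ 3" unfolding D_def using K5 KB(1) \<rho>(1) by (intro mult_right_mono) auto
        finally show ?thesis using True ij(1) by (simp add: ex_def)
      next
        case kj: False
        have "\<bar>g t k x\<bar> \<le> (1 + KB + K5) * \<rho> ^ 4" using rest gk p_comp(3)[OF False kj] by simp
        also have "\<dots> \<le> D * \<rho> ^ 4" unfolding D_def using K5 KB(1) \<rho>(1) by (intro mult_right_mono) auto
        finally show ?thesis using False kj by (simp add: ex_def)
      qed
    qed
  qed
  define m where "m = CARD('m)"
  define K where "K = (2 * D + 2) ^ m + KB * KB * (2 * (real m + 1))"
  have "KB * KB * (2 * (real m + 1)) \<ge> 0" using KB(1) by simp
  then have K: "K > 0" "(2 * D + 2) ^ m \<le> K" "KB * KB * (2 * (real m + 1)) \<le> K"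
    unfolding K_def using D by (auto intro!: add_pos_nonneg)
  \<comment> \<open>The adapted coordinates control distances: the correction costs at most half of
    \<open>norm z\<close> by the choice of \<open>r\<close> and is absorbed, after which
    \<open>z $ i\<close> follows from \<open>lf z\<close> and \<open>z $ j\<close>.\<close>
  have expand: "dist x x' \<le> K * s"
    if t: "t \<in> {a..b}" "\<bar>t - t\<^sub>0\<bar> \<le> r" and s: "s \<ge> 0" and close: "\<And>k. \<bar>g t k x - g t k x'\<bar> \<le> s" for t x x' s
  proof -
    define z where "z = S t x - S t x'"
    have Sz: "z = matrix_inv A1 *v (matrix_inv (G t) *v (x - x'))"
      unfolding z_def S_def matrix_vector_mult_diff_distrib[symmetric] by simp
    have zk: "\<bar>z $ k\<bar> \<le> s" if "k \<noteq> i" for k using close[of k] that by (simp add: g_def z_def)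
    have "\<bar>lf z - (t - t\<^sub>0) / 2 * lf (M *v z)\<bar> \<le> s"
      using close[of i] by (simp add: g_def z_def lf_diff matrix_vector_mult_diff_distrib algebra_simps)
    moreover have "\<bar>(t - t\<^sub>0) / 2 * lf (M *v z)\<bar> \<le> 1 / 2 * norm z"
    proof -
      have "\<bar>lf (M *v z)\<bar> \<le> 2 * (KB * norm z)" using lf_bound[of "M *v z"] bM[of z] by linarith
      moreover have "\<bar>(t - t\<^sub>0) / 2\<bar> \<le> r / 2" using t(2) by simp
      ultimately have "\<bar>(t - t\<^sub>0) / 2\<bar> * \<bar>lf (M *v z)\<bar> \<le> r / 2 * (2 * (KB * norm z))" using r(1) by (intro mult_mono) auto
      also have "\<dots> = (r * KB) * norm z" by simp
      also have "\<dots> \<le> 1 / 2 * norm z" using rKB by (intro mult_right_mono) auto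
      finally show ?thesis by (simp add: abs_mult)
    qed
    ultimately have "\<bar>lf z\<bar> \<le> s + 1 / 2 * norm z" by linarith
    moreover have "\<bar>\<theta> * z $ j\<bar> \<le> 1 * s"
      unfolding abs_mult using ij zk[of j] by (intro mult_mono) auto
    ultimately have zi: "\<bar>z $ i\<bar> \<le> 2 * s + 1 / 2 * norm z" unfolding lf_def by linarith
    have "norm z \<le> (\<Sum>k\<in>UNIV. \<bar>z $ k\<bar>)" by (rule norm_le_l1_cart)
    also have "\<dots> = \<bar>z $ i\<bar> + (\<Sum>k\<in>UNIV - {i}. \<bar>z $ k\<bar>)" by (rule sum.remove) auto
    also have "(\<Sum>k\<in>UNIV - {i}. \<bar>z $ k\<bar>) \<le> (\<Sum>k\<in>UNIV - {i}. s)" using zk by (intro sum_mono) auto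
    also have "(\<Sum>k\<in>UNIV - {i}. s) = (real m - 1) * s"
      by (simp add: m_def card_Diff_singleton of_nat_diff Suc_leI)
    finally have "norm z \<le> 2 * s + 1 / 2 * norm z + (real m - 1) * s" using zi by linarith
    then have nz: "norm z \<le> 2 * (real m + 1) * s" by (simp add: algebra_simps)
    have "x - x' = G t *v (A1 *v z)"
      unfolding Sz using matrix_inv_works(1)[OF det1] matrix_inv_works(1)[OF detG[OF t(1)]]
      by (simp add: matrix_vector_mul_assoc matrix_mul_assoc[symmetric]) (simp add: matrix_mul_assoc)
    then have "dist x x' \<le> KB * (KB * norm z)"
      unfolding dist_norm using bG(1)[OF t(1), of "A1 *v z"] bA1[of z] KB(1)
      by (metis mult_left_mono order_trans zero_le_one)
    also have "\<dots> \<le> KB * (KB * (2 * (real m + 1) * s))" using nz KB(1) by (intro mult_left_mono) auto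
    also have "\<dots> = (KB * KB * (2 * (real m + 1))) * s" by simp
    also have "\<dots> \<le> K * s" using K(3) s by (rule mult_right_mono)
    finally show ?thesis .
  qed
  show ?thesis
  proof (rule that[OF r(1,2) K(1) tI])
    show "cball y\<^sub>0 r \<subseteq> Y" using yY by blast
    show "\<And>y. y \<in> cball y\<^sub>0 r \<Longrightarrow> \<omega> y \<in> W" by (rule \<omega>W)
    fix \<rho> t H
    assume \<rho>: "0 < \<rho>" "\<rho> \<le> r" "\<bar>t - t\<^sub>0\<bar> \<le> \<rho>"
      and Hs: "H \<subseteq> {x. \<exists>y\<in>ball y\<^sub>0 (\<rho> ^ 3). \<exists>t'\<in>{a..b}. \<bar>t - t'\<bar> < \<rho> ^ 6 \<and> dist x (X (\<omega> y, t', y)) < \<rho> ^ 6}"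
    have \<rho>1: "\<rho> \<le> 1" using \<rho>(2) r(2) by simp
    have "t \<in> {t\<^sub>0 - r..t\<^sub>0 + r}" using \<rho> by auto
    then have tab: "t \<in> {a..b}" "\<bar>t - t\<^sub>0\<bar> \<le> r" using subsetD[OF tI] \<rho> by simp_all
    have "\<exists>\<C>. finite \<C> \<and> \<Union>\<C> = H \<and> real (card \<C>) \<le> (\<Prod>k\<in>(UNIV :: 'm set). 2 * (D * \<rho> ^ ex k) / \<rho> ^ 6 + 2) \<and>
        (\<forall>c\<in>\<C>. \<forall>x\<in>c. \<forall>y\<in>c. \<forall>k\<in>(UNIV :: 'm set). \<bar>g t k x - g t k y\<bar> \<le> \<rho> ^ 6)"
    proof (rule grid_cover)
      fix k x assume "x \<in> H"
      then show "\<bar>g t k x\<bar> \<le> D * \<rho> ^ ex k" using Hs by (intro g_bound[OF \<rho>]) blast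
    qed (use \<rho>(1) D in auto)
    then obtain \<C> where \<C>: "finite \<C>" "\<Union>\<C> = H"
      "real (card \<C>) \<le> (\<Prod>k\<in>(UNIV :: 'm set). 2 * (D * \<rho> ^ ex k) / \<rho> ^ 6 + 2)"
      "\<forall>c\<in>\<C>. \<forall>x\<in>c. \<forall>y\<in>c. \<forall>k\<in>(UNIV :: 'm set). \<bar>g t k x - g t k y\<bar> \<le> \<rho> ^ 6" by (elim exE conjE)
    \<comment> \<open>One factor \<open>\<rho>^2\<close> per coordinate turns the counts
      \<open>\<rho>^(ex k - 6)\<close> into \<open>\<rho>^2\<close> for \<open>i\<close>,
      \<open>1 / \<rho>\<close> for \<open>j\<close> and \<open>1\<close> otherwise, with product
      \<open>\<rho>\<close>.\<close>
    have "real (card \<C>) * \<rho> ^ (2 * CARD('m)) \<le> (\<Prod>k\<in>(UNIV :: 'm set). 2 * (D * \<rho> ^ ex k) / \<rho> ^ 6 + 2) * (\<Prod>k\<in>(UNIV :: 'm set). \<rho>\<^sup>2)"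
      using \<C>(3) \<rho>(1) by (auto simp: power_mult intro!: mult_right_mono)
    also have "\<dots> = (\<Prod>k\<in>(UNIV :: 'm set). (2 * (D * \<rho> ^ ex k) / \<rho> ^ 6 + 2) * \<rho>\<^sup>2)" by (simp add: prod.distrib)
    also have "\<dots> \<le> (\<Prod>k\<in>(UNIV :: 'm set). (2 * D + 2) * ((if k = i then \<rho>\<^sup>2 else 1) * (if k = j then 1 / \<rho> else 1)))"
    proof (intro prod_mono conjI)
      fix k :: 'm
      have "\<rho> ^ 6 \<le> \<rho> ^ ex k" using \<rho>(1) \<rho>1 by (intro power_decreasing) (auto simp: ex_def)
      then have q: "1 \<le> \<rho> ^ ex k / \<rho> ^ 6" using \<rho>(1) by (simp add: pos_le_divide_eq)
      have "2 * (D * \<rho> ^ ex k) / \<rho> ^ 6 + 2 = 2 * D * (\<rho> ^ ex k / \<rho> ^ 6) + 2" by simp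
      also have "\<dots> \<le> (2 * D + 2) * (\<rho> ^ ex k / \<rho> ^ 6)" using q unfolding distrib_right by linarith
      finally have "2 * (D * \<rho> ^ ex k) / \<rho> ^ 6 + 2 \<le> (2 * D + 2) * (\<rho> ^ ex k / \<rho> ^ 6)" .
      then have "(2 * (D * \<rho> ^ ex k) / \<rho> ^ 6 + 2) * \<rho>\<^sup>2 \<le> (2 * D + 2) * (\<rho> ^ ex k / \<rho> ^ 6) * \<rho>\<^sup>2"
        by (rule mult_right_mono) simp
      also have "(2 * D + 2) * (\<rho> ^ ex k / \<rho> ^ 6) * \<rho>\<^sup>2 = (2 * D + 2) * ((if k = i then \<rho>\<^sup>2 else 1) * (if k = j then 1 / \<rho> else 1))"
        using \<rho>(1) ij(1) by (auto simp: ex_def field_simps eval_nat_numeral)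
      finally show "(2 * (D * \<rho> ^ ex k) / \<rho> ^ 6 + 2) * \<rho>\<^sup>2 \<le> \<dots>" .
      show "0 \<le> (2 * (D * \<rho> ^ ex k) / \<rho> ^ 6 + 2) * \<rho>\<^sup>2" using \<rho>(1) D by (intro mult_nonneg_nonneg add_nonneg_nonneg divide_nonneg_nonneg) auto
    qed
    also have "\<dots> = (2 * D + 2) ^ m * \<rho>"
      using \<rho>(1) by (simp add: prod.distrib m_def power2_eq_square)
    also have "\<dots> \<le> K * \<rho>" using K(2) \<rho>(1) by (intro mult_right_mono) auto
    finally have card: "real (card \<C>) * \<rho> ^ (2 * CARD('m)) \<le> K * \<rho>" .
    have diam: "dist x x' \<le> K * \<rho> ^ 6" if "cc \<in> \<C>" "x \<in> cc" "x' \<in> cc" for cc x x'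
      using \<C>(4) that \<rho>(1) by (intro expand[OF tab]) auto
    show "\<exists>\<C>. finite \<C> \<and> \<Union>\<C> = H \<and> real (card \<C>) * \<rho> ^ (2 * CARD('m)) \<le> K * \<rho> \<and>
        (\<forall>c\<in>\<C>. \<forall>x\<in>c. \<forall>x'\<in>c. dist x x' \<le> K * \<rho> ^ 6)"
      by (intro exI[of _ \<C>] conjI ballI \<C>(1,2) card) (rule diam)
  qed
qed

end

section \<open>Failure of the critical estimate\<close>

lemma emeasure_lborel_slices:
  fixes N :: "('a::euclidean_space \<times> real) set"
  assumes "N \<in> sets borel"
  shows "emeasure lborel N = (\<integral>\<^sup>+t. emeasure lborel {x. (x, t) \<in> N} \<partial>lborel)"
proof -
  have "N \<in> sets (lborel \<Otimes>\<^sub>M lborel)" using assms by (subst lborel_prod) simp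
  from lborel_pair.emeasure_pair_measure_alt2[OF this] show ?thesis
    by (simp add: lborel_prod vimage_def)
qed

lemma emeasure_slices_ge:
  fixes N :: "('a::euclidean_space \<times> real) set"
  assumes N: "N \<in> sets borel" and S: "S \<in> sets borel" and k: "\<And>t. t \<in> S \<Longrightarrow> k \<le> emeasure lborel {x. (x, t) \<in> N}"
  shows "k * emeasure lborel S \<le> emeasure lborel N"
proof -
  have "k * emeasure lborel S = (\<integral>\<^sup>+t. k * indicator S t \<partial>lborel)" using S by (simp add: nn_integral_cmult_indicator)
  also have "\<dots> \<le> (\<integral>\<^sup>+t. emeasure lborel {x. (x, t) \<in> N} \<partial>lborel)"
    using k by (intro nn_integral_mono) (auto simp: indicator_def)
  finally show ?thesis by (simp add: emeasure_lborel_slices[OF N])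
qed

lemma emeasure_slices_le:
  fixes N :: "('a::euclidean_space \<times> real) set"
  assumes N: "N \<in> sets borel" and S: "S \<in> sets borel" and k: "\<And>t. t \<in> S \<Longrightarrow> emeasure lborel {x. (x, t) \<in> N} \<le> k"
    and 0: "\<And>x t. (x, t) \<in> N \<Longrightarrow> t \<in> S"
  shows "emeasure lborel N \<le> k * emeasure lborel S"
proof -
  have "emeasure lborel {x. (x, t) \<in> N} \<le> k * indicator S t" for t
  proof (cases "t \<in> S")
    case False
    then have "{x. (x, t) \<in> N} = {}" using 0 by blast
    then show ?thesis by simp
  qed (use k in simp)
  then have "emeasure lborel N \<le> (\<integral>\<^sup>+t. k * indicator S t \<partial>lborel)"
    unfolding emeasure_lborel_slices[OF N] by (intro nn_integral_mono) auto
  also have "\<dots> = k * emeasure lborel S" using S by (simp add: nn_integral_cmult_indicator)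
  finally show ?thesis .
qed

lemma Lp_norm_le_imp:
  assumes le: "Lp_norm M p g \<le> ennreal A * Lp_norm M' p f" and J: "(\<integral>\<^sup>+x. f x ^ p \<partial>M') = ennreal j"
    and p: "p > 0" and A: "A \<ge> 0" and j: "j \<ge> 0"
  shows "(\<integral>\<^sup>+x. g x ^ p \<partial>M) \<le> ennreal (A ^ p * j)"
proof -
  let ?J = "\<integral>\<^sup>+x. g x ^ p \<partial>M"
  have rj: "0 \<le> root p j" using j by (rule real_root_ge_zero)
  have "Lp_norm M' p f = ennreal (root p j)" using j by (simp add: Lp_norm_def J)
  then have le': "Lp_norm M p g \<le> ennreal (A * root p j)" using le A rj by (simp add: ennreal_mult)
  \<comment> \<open>Infinity must be excluded first, because \<open>enn2real\<close> sends it to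
    \<open>0\<close>.\<close>
  have fin: "?J \<noteq> \<infinity>"
  proof
    assume "?J = \<infinity>"
    then have "Lp_norm M p g = \<infinity>" by (simp add: Lp_norm_def)
    then show False using le' by (simp add: top_unique)
  qed
  then have "ennreal (root p (enn2real ?J)) \<le> ennreal (A * root p j)"
    using le' by (simp add: Lp_norm_def Let_def)
  then have "root p (enn2real ?J) \<le> A * root p j"
    using A j p by (simp add: ennreal_le_iff real_root_ge_zero)
  then have "root p (enn2real ?J) ^ p \<le> (A * root p j) ^ p"
    using p by (intro power_mono) (auto simp: real_root_ge_zero)
  then have "enn2real ?J \<le> A ^ p * j"
    using p j by (simp add: power_mult_distrib)
  then show ?thesis using fin by (metis ennreal_enn2real ennreal_leI infinity_ennreal_def less_top)
qed

lemma emeasure_le_card_diam: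
  fixes H :: "'a::euclidean_space set"
  assumes "finite \<C>" "\<Union>\<C> = H" "\<And>c x y. c \<in> \<C> \<Longrightarrow> x \<in> c \<Longrightarrow> y \<in> c \<Longrightarrow> dist x y \<le> d" "d \<ge> 0"
  shows "emeasure lborel H \<le> ennreal (real (card \<C>) * (unit_ball_vol (real DIM('a)) * d ^ DIM('a)))"
proof -
  \<comment> \<open>Balls replace the pieces, which need not be measurable; for an empty piece the
    centre is arbitrary.\<close>
  define f where "f c = cball (SOME x. x \<in> c) d" for c :: "'a set"
  have "H \<subseteq> (\<Union>c\<in>\<C>. f c)"
  proof
    fix x assume "x \<in> H"
    then obtain c where c: "c \<in> \<C>" "x \<in> c" using assms(2) by blast
    then have "(SOME x. x \<in> c) \<in> c" by (metis someI)
    then show "x \<in> (\<Union>c\<in>\<C>. f c)" using c assms(3) unfolding f_def by auto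
  qed
  then have "emeasure lborel H \<le> emeasure lborel (\<Union>c\<in>\<C>. f c)"
    using assms(1) by (intro emeasure_mono) (auto simp: f_def)
  also have "\<dots> \<le> (\<Sum>c\<in>\<C>. emeasure lborel (f c))"
    using assms(1) by (intro emeasure_subadditive_finite) (auto simp: f_def)
  also have "\<dots> = (\<Sum>c\<in>\<C>. ennreal (unit_ball_vol (real DIM('a)) * d ^ DIM('a)))"
    using assms(4) by (simp add: f_def emeasure_cball)
  also have "\<dots> = ennreal (real (card \<C>) * (unit_ball_vol (real DIM('a)) * d ^ DIM('a)))"
    using assms(4) by (simp add: ennreal_mult ennreal_of_nat_eq_real_of_nat)
  finally show ?thesis .
qed

lemma ennreal_inverse_antimono: "a \<le> b \<Longrightarrow> inverse b \<le> inverse a" for a b :: ennreal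
proof (cases "b = top")
  case False
  assume ab: "a \<le> b"
  obtain y where y: "b = ennreal y" "0 \<le> y" using False by (cases b) auto
  obtain x where x: "a = ennreal x" "0 \<le> x" using ab y by (cases a) (auto simp: top_unique)
  show ?thesis
  proof (cases "x = 0")
    case False
    then have "0 < x" "x \<le> y" using x y ab by (auto simp: ennreal_le_iff)
    then show ?thesis unfolding x y by (simp add: inverse_ennreal ennreal_leI le_imp_inverse_le)
  qed (simp add: x)
qed simp

lemma mem_nbhd_kakeya_curve:
  "(x, t) \<in> nbhd \<delta> (kakeya_curve I X y w) \<longleftrightarrow> (\<exists>t'\<in>I. dist (X (w, t', y), t') (x, t) < \<delta>)"
  by (auto simp: nbhd_def kakeya_curve_def)

lemma open_nbhd: "open (nbhd \<delta> A)"
  unfolding nbhd_def by (intro open_UN) auto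

context slab
begin

text \<open>Tested on the indicator of the tubes over \<open>ball y\<^sub>0 (\<rho> ^ 3)\<close> cut
  to \<open>|t - t\<^sub>0| \<le> \<rho>\<close>, the estimate compares
  \<open>\<rho>^(n + 3m) = \<rho>^(4m+1)\<close> with
  \<open>\<delta>^(-\<epsilon> n) \<rho>^(4m+2)\<close>, up to constants.\<close>

lemma not_critical_estimate:
  assumes Y: "Y \<in> sets lebesgue"
    and X: "smooth Q X"
    and r: "0 < r" "r \<le> 1" and K: "0 < K" and tI: "{t\<^sub>0 - r..t\<^sub>0 + r} \<subseteq> {a..b}" and yY: "cball y\<^sub>0 r \<subseteq> Y"
    and \<omega>: "\<And>y. y \<in> cball y\<^sub>0 r \<Longrightarrow> \<omega> y \<in> W"
    and thin: "\<And>\<rho> t H. 0 < \<rho> \<Longrightarrow> \<rho> \<le> r \<Longrightarrow> \<bar>t - t\<^sub>0\<bar> \<le> \<rho> \<Longrightarrow>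
      H \<subseteq> {x. \<exists>y\<in>ball y\<^sub>0 (\<rho> ^ 3). \<exists>t'\<in>{a..b}. \<bar>t - t'\<bar> < \<rho> ^ 6 \<and> dist x (X (\<omega> y, t', y)) < \<rho> ^ 6} \<Longrightarrow>
      \<exists>\<C>. finite \<C> \<and> \<Union>\<C> = H \<and> real (card \<C>) * \<rho> ^ (2 * CARD('m)) \<le> K * \<rho> \<and>
        (\<forall>c\<in>\<C>. \<forall>x\<in>c. \<forall>x'\<in>c. dist x x' \<le> K * \<rho> ^ 6)"
  shows "\<not> critical_estimate (Suc CARD('m)) W {a..b} Y X"
proof
  define m where "m = CARD('m)"
  define n where "n = Suc m"
  have dimm: "DIM(real^'m) = m" by (simp add: m_def)
  assume "critical_estimate (Suc CARD('m)) W {a..b} Y X"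
  then have crit: "critical_estimate n W {a..b} Y X" by (simp add: n_def m_def)
  \<comment> \<open>With \<open>\<delta> = \<rho>^6\<close> the loss
    \<open>\<delta>^(-\<epsilon> n)\<close> is \<open>\<rho>^(-1/2)\<close>, only half of the
    gain.\<close>
  define \<epsilon> where "\<epsilon> = 1 / (12 * real n)"
  have n0: "n > 0" and \<epsilon>: "\<epsilon> > 0" by (auto simp: n_def \<epsilon>_def)
  obtain C where C: "C > 0" "\<And>\<delta> f. 0 < \<delta> \<Longrightarrow> \<delta> < 1 \<Longrightarrow> in_Lp lebesgue n f \<Longrightarrow>
        Lp_norm (lebesgue_on Y) n (kakeya_maximal W {a..b} X \<delta> f)
          \<le> ennreal (C * \<delta> powr (- \<epsilon>)) * Lp_norm lebesgue n (\<lambda>x. ennreal \<bar>f x\<bar>)"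
    using crit \<epsilon> unfolding critical_estimate_def by meson
  obtain K1 where K1: "K1 > 0" "\<And>q q'. q \<in> Q \<Longrightarrow> q' \<in> Q \<Longrightarrow> norm (X q - X q') \<le> K1 * norm (q - q')"
    by (rule smooth_Lipschitz[OF X], rule that)
  define \<beta> where "\<beta> = unit_ball_vol (real m)"
  have \<beta>: "\<beta> > 0" unfolding \<beta>_def by simp
  define c2 where "c2 = \<beta> * (2 + 2 * K1) ^ m * (b - a + 2)"
  have c2: "c2 > 0" unfolding c2_def using \<beta> K1(1) ab by simp
  define c3 where "c3 = 2 * \<beta> / c2"
  have c3: "c3 > 0" unfolding c3_def using \<beta> c2 by simp
  define c4 where "c4 = 2 * (K * (\<beta> * K ^ m))"
  have c4: "c4 > 0" unfolding c4_def using \<beta> K by simp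
  have main: "c3 ^ n * \<beta> \<le> C ^ n * c4 * sqrt \<rho>" if \<rho>: "0 < \<rho>" "\<rho> < r" for \<rho>
  proof -
    have \<rho>1: "\<rho> < 1" using \<rho> r by simp
    define \<delta> where "\<delta> = \<rho> ^ 6"
    have \<delta>: "0 < \<delta>" "\<delta> < 1" unfolding \<delta>_def using \<rho> \<rho>1 by (auto simp: power_less_one_iff)
    have "\<rho> ^ 3 \<le> \<rho> ^ 1" using \<rho> \<rho>1 by (intro power_decreasing) auto
    then have bY: "ball y\<^sub>0 (\<rho> ^ 3) \<subseteq> cball y\<^sub>0 r" using \<rho> by auto
    define N where "N y = nbhd \<delta> (kakeya_curve {a..b} X y (\<omega> y))" for y
    define Z :: "((real^'m) \<times> real) set" where "Z = {z. \<bar>snd z - t\<^sub>0\<bar> \<le> \<rho>}"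
    define E where "E = (\<Union>y\<in>ball y\<^sub>0 (\<rho> ^ 3). N y) \<inter> Z"
    have Nb: "N y \<in> sets borel" for y unfolding N_def using open_nbhd by (rule borel_open)
    have Zb: "Z \<in> sets borel"
      unfolding Z_def by (intro borel_closed closed_Collect_le continuous_intros)
    have Eb: "E \<in> sets borel"
    proof -
      have "(\<Union>y\<in>ball y\<^sub>0 (\<rho> ^ 3). N y) \<in> sets borel"
        by (intro borel_open open_UN) (auto simp: N_def open_nbhd)
      then show ?thesis unfolding E_def using Zb by (rule sets.Int)
    qed
    have memN: "(x, t) \<in> N y \<longleftrightarrow> (\<exists>t'\<in>{a..b}. dist (X (\<omega> y, t', y), t') (x, t) < \<delta>)" for x t y
      unfolding N_def by (rule mem_nbhd_kakeya_curve)
    have qy: "(\<omega> y, t, y) \<in> Q" if "y \<in> ball y\<^sub>0 (\<rho> ^ 3)" "t \<in> {a..b}" for y t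
      using that \<omega> yY bY by (auto simp: Q_eq)
    have parts: "dist u x < \<delta> \<and> \<bar>t - t'\<bar> < \<delta>" if "dist (u, t') (x, t) < \<delta>" for u x :: "real^'m" and t t' :: real
      using that dist_fst_le[of "(u, t')" "(x, t)"] dist_snd_le[of "(u, t')" "(x, t)"]
      by (auto simp: dist_real_def abs_minus_commute)
    \<comment> \<open>A time slice of a tube has diameter comparable to \<open>\<delta>\<close>
      because the curve is Lipschitz in time.\<close>
    have mN: "emeasure lborel (N y) \<le> ennreal (c2 * \<delta> ^ m)" if y: "y \<in> ball y\<^sub>0 (\<rho> ^ 3)" for y
    proof -
      have "emeasure lborel (N y) \<le> ennreal (\<beta> * ((2 + 2 * K1) * \<delta>) ^ m) * emeasure lborel {a - 1..b + 1}"
      proof (rule emeasure_slices_le[OF Nb])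
        fix x t assume "(x, t) \<in> N y"
        then obtain t' where "t' \<in> {a..b}" "\<bar>t - t'\<bar> < \<delta>" using memN parts by blast
        then show "t \<in> {a - 1..b + 1}" using \<delta>(2) by auto
      next
        fix t assume "t \<in> {a - 1..b + 1}"
        have "dist x x' \<le> (2 + 2 * K1) * \<delta>" if xx: "(x, t) \<in> N y" "(x', t) \<in> N y" for x x'
        proof -
          obtain s where s: "s \<in> {a..b}" "dist (X (\<omega> y, s, y)) x < \<delta>" "\<bar>t - s\<bar> < \<delta>" using xx(1) memN parts by blast
          obtain s' where s': "s' \<in> {a..b}" "dist (X (\<omega> y, s', y)) x' < \<delta>" "\<bar>t - s'\<bar> < \<delta>" using xx(2) memN parts by blast
          have "dist (X (\<omega> y, s, y)) (X (\<omega> y, s', y)) \<le> K1 * norm ((\<omega> y, s, y) - (\<omega> y, s', y))"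
            unfolding dist_norm by (rule K1(2)[OF qy[OF y s(1)] qy[OF y s'(1)]])
          also have "norm ((\<omega> y, s, y) - (\<omega> y, s', y)) = \<bar>s - s'\<bar>" by (simp add: norm_Pair)
          also have "K1 * \<bar>s - s'\<bar> \<le> K1 * (2 * \<delta>)" using s(3) s'(3) K1(1) by (intro mult_left_mono) auto
          finally have "dist (X (\<omega> y, s, y)) (X (\<omega> y, s', y)) \<le> K1 * (2 * \<delta>)" .
          then have "dist x x' \<le> 2 * \<delta> + K1 * (2 * \<delta>)"
            using s(2) s'(2) dist_triangle[of x x' "X (\<omega> y, s, y)"] dist_triangle[of "X (\<omega> y, s, y)" x' "X (\<omega> y, s', y)"]
            by (simp add: dist_commute)
          then show ?thesis by (simp add: algebra_simps)
        qed
        then have "emeasure lborel {x. (x, t) \<in> N y} \<le>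
          ennreal (real (card {{x. (x, t) \<in> N y}}) * (unit_ball_vol (real DIM(real^'m)) * ((2 + 2 * K1) * \<delta>) ^ DIM(real^'m)))"
          using \<delta>(1) K1(1) by (intro emeasure_le_card_diam) auto
        then show "emeasure lborel {x. (x, t) \<in> N y} \<le> ennreal (\<beta> * ((2 + 2 * K1) * \<delta>) ^ m)"
          unfolding dimm \<beta>_def by simp
      qed simp
      also have "emeasure lborel {a - 1..b + 1} = ennreal (b - a + 2)" using ab by simp
      also have "ennreal (\<beta> * ((2 + 2 * K1) * \<delta>) ^ m) * ennreal (b - a + 2) = ennreal (\<beta> * ((2 + 2 * K1) * \<delta>) ^ m * (b - a + 2))"
        using ab \<beta> K1(1) \<delta>(1) by (intro ennreal_mult[symmetric]) auto
      also have "\<beta> * ((2 + 2 * K1) * \<delta>) ^ m * (b - a + 2) = c2 * \<delta> ^ m"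
        unfolding c2_def power_mult_distrib by (simp only: mult_ac)
      finally show ?thesis .
    qed
    \<comment> \<open>For each time within \<open>\<rho>\<close> of \<open>t\<^sub>0\<close> the
      slice contains the ball of radius \<open>\<delta>\<close> about the point of the
      curve.\<close>
    have mNE: "ennreal (2 * \<beta> * \<delta> ^ m * \<rho>) \<le> emeasure lborel (N y \<inter> Z)" if y: "y \<in> ball y\<^sub>0 (\<rho> ^ 3)" for y
    proof -
      have "ennreal (\<beta> * \<delta> ^ m) * emeasure lborel {t\<^sub>0 - \<rho>..t\<^sub>0 + \<rho>} \<le> emeasure lborel (N y \<inter> Z)"
      proof (rule emeasure_slices_ge)
        show "N y \<inter> Z \<in> sets borel" using Nb Zb by auto
        fix t assume t: "t \<in> {t\<^sub>0 - \<rho>..t\<^sub>0 + \<rho>}"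
        then have tab: "t \<in> {a..b}" using tI \<rho> by auto
        have "ball (X (\<omega> y, t, y)) \<delta> \<subseteq> {x. (x, t) \<in> N y \<inter> Z}"
          using t tab by (auto simp: memN Z_def dist_Pair_Pair intro!: bexI[of _ t])
        moreover have "{x. (x, t) \<in> N y \<inter> Z} \<in> sets lborel"
          using Nb[of y] Zb by (auto intro!: measurable_sets_borel[of "\<lambda>x. (x, t)" borel "N y \<inter> Z", unfolded vimage_def])
        ultimately have "emeasure lborel (ball (X (\<omega> y, t, y)) \<delta>) \<le> emeasure lborel {x. (x, t) \<in> N y \<inter> Z}"
          by (rule emeasure_mono)
        then show "ennreal (\<beta> * \<delta> ^ m) \<le> emeasure lborel {x. (x, t) \<in> N y \<inter> Z}"
          using \<delta>(1) by (simp add: emeasure_ball dimm \<beta>_def m_def)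
      qed simp
      moreover have "emeasure lborel {t\<^sub>0 - \<rho>..t\<^sub>0 + \<rho>} = ennreal (2 * \<rho>)" using \<rho>(1) by simp
      moreover have "ennreal (\<beta> * \<delta> ^ m) * ennreal (2 * \<rho>) = ennreal (\<beta> * \<delta> ^ m * (2 * \<rho>))"
        using \<rho>(1) \<beta> \<delta>(1) by (intro ennreal_mult[symmetric]) auto
      moreover have "\<beta> * \<delta> ^ m * (2 * \<rho>) = 2 * \<beta> * \<delta> ^ m * \<rho>" by simp
      ultimately show ?thesis by simp
    qed
    \<comment> \<open>At most about \<open>\<rho>^(1 - 2m)\<close> pieces of diameter about
      \<open>\<rho>^6\<close> per slice, over a time interval of length
      \<open>2 * \<rho>\<close>.\<close>
    have mE: "emeasure lborel E \<le> ennreal (c4 * \<rho> ^ (4 * m + 2))"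
    proof -
      have "emeasure lborel E \<le> ennreal (K * (\<beta> * K ^ m) * \<rho> ^ (4 * m + 1)) * emeasure lborel {t\<^sub>0 - \<rho>..t\<^sub>0 + \<rho>}"
      proof (rule emeasure_slices_le[OF Eb])
        fix x t assume "(x, t) \<in> E"
        then show "t \<in> {t\<^sub>0 - \<rho>..t\<^sub>0 + \<rho>}" by (auto simp: E_def Z_def)
      next
        fix t assume t: "t \<in> {t\<^sub>0 - \<rho>..t\<^sub>0 + \<rho>}"
        then have t': "\<bar>t - t\<^sub>0\<bar> \<le> \<rho>" by auto
        have "{x. (x, t) \<in> E} \<subseteq> {x. \<exists>y\<in>ball y\<^sub>0 (\<rho> ^ 3). \<exists>t'\<in>{a..b}. \<bar>t - t'\<bar> < \<rho> ^ 6 \<and> dist x (X (\<omega> y, t', y)) < \<rho> ^ 6}"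
        proof
          fix x assume "x \<in> {x. (x, t) \<in> E}"
          then obtain y where y: "y \<in> ball y\<^sub>0 (\<rho> ^ 3)" "(x, t) \<in> N y" by (auto simp: E_def)
          then obtain s where "s \<in> {a..b}" "dist (X (\<omega> y, s, y)) x < \<delta>" "\<bar>t - s\<bar> < \<delta>" using memN parts by blast
          then show "x \<in> {x. \<exists>y\<in>ball y\<^sub>0 (\<rho> ^ 3). \<exists>t'\<in>{a..b}. \<bar>t - t'\<bar> < \<rho> ^ 6 \<and> dist x (X (\<omega> y, t', y)) < \<rho> ^ 6}"
            using y(1) unfolding \<delta>_def by (intro CollectI bexI[of _ y] bexI[of _ s]) (auto simp: dist_commute)
        qed
        from thin[OF \<rho>(1) less_imp_le[OF \<rho>(2)] t' this]
        obtain \<C> where \<C>: "finite \<C>" "\<Union>\<C> = {x. (x, t) \<in> E}" "real (card \<C>) * \<rho> ^ (2 * CARD('m)) \<le> K * \<rho>"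
          "\<forall>c\<in>\<C>. \<forall>x\<in>c. \<forall>x'\<in>c. dist x x' \<le> K * \<rho> ^ 6" by (elim exE conjE)
        have "emeasure lborel {x. (x, t) \<in> E} \<le>
          ennreal (real (card \<C>) * (unit_ball_vol (real DIM(real^'m)) * (K * \<rho> ^ 6) ^ DIM(real^'m)))"
          using \<C>(4) K \<rho>(1) by (intro emeasure_le_card_diam[OF \<C>(1,2)]) auto
        also have "\<dots> \<le> ennreal (K * (\<beta> * K ^ m) * \<rho> ^ (4 * m + 1))"
        proof (rule ennreal_leI)
          have "real (card \<C>) * (unit_ball_vol (real DIM(real^'m)) * (K * \<rho> ^ 6) ^ DIM(real^'m))
            = (real (card \<C>) * \<rho> ^ (2 * CARD('m))) * (\<beta> * K ^ m * \<rho> ^ (4 * m))"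
            unfolding dimm \<beta>_def[symmetric] m_def[symmetric]
            by (simp add: power_mult_distrib power_mult[symmetric] power_add[symmetric] mult_ac)
          also have "\<dots> \<le> (K * \<rho>) * (\<beta> * K ^ m * \<rho> ^ (4 * m))"
            using \<C>(3) \<beta> K \<rho>(1) by (intro mult_right_mono) auto
          also have "\<dots> = K * (\<beta> * K ^ m) * \<rho> ^ (4 * m + 1)" by (simp add: mult_ac)
          finally show "real (card \<C>) * (unit_ball_vol (real DIM(real^'m)) * (K * \<rho> ^ 6) ^ DIM(real^'m)) \<le> \<dots>" .
        qed
        finally show "emeasure lborel {x. (x, t) \<in> E} \<le> ennreal (K * (\<beta> * K ^ m) * \<rho> ^ (4 * m + 1))" .
      qed simp
      also have "emeasure lborel {t\<^sub>0 - \<rho>..t\<^sub>0 + \<rho>} = ennreal (2 * \<rho>)" using \<rho>(1) by simp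
      also have "ennreal (K * (\<beta> * K ^ m) * \<rho> ^ (4 * m + 1)) * ennreal (2 * \<rho>) = ennreal (K * (\<beta> * K ^ m) * \<rho> ^ (4 * m + 1) * (2 * \<rho>))"
        using \<rho>(1) \<beta> K by (intro ennreal_mult[symmetric]) auto
      also have "K * (\<beta> * K ^ m) * \<rho> ^ (4 * m + 1) * (2 * \<rho>) = c4 * \<rho> ^ (4 * m + 2)"
        by (simp add: c4_def power2_eq_square)
      finally show ?thesis .
    qed
    define f where "f = (indicator E :: _ \<Rightarrow> real)"
    have f_abs: "ennreal \<bar>f z\<bar> = indicator E z" for z by (simp add: f_def indicator_def)
    obtain j where j: "emeasure lborel E = ennreal j" "0 \<le> j" "j \<le> c4 * \<rho> ^ (4 * m + 2)"
    proof -
      have "emeasure lborel E < top" using mE by (simp add: le_less_trans)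
      then obtain j where j: "emeasure lborel E = ennreal j" "0 \<le> j" by (cases "emeasure lborel E") auto
      moreover have "j \<le> c4 * \<rho> ^ (4 * m + 2)"
        using mE c4 \<rho>(1) unfolding j by (simp add: ennreal_le_iff)
      ultimately show ?thesis using that by blast
    qed
    have ind_pow: "(indicator E z :: ennreal) ^ n = indicator E z" for z using n0 by (simp add: indicator_def)
    have Jf: "(\<integral>\<^sup>+x. ennreal \<bar>f x\<bar> ^ n \<partial>lebesgue) = ennreal j"
      unfolding f_abs ind_pow nn_integral_completion using Eb j(1) by simp
    have "in_Lp lebesgue n f"
    proof -
      have "E \<in> sets lebesgue" using Eb by simp
      then have "f \<in> borel_measurable lebesgue" unfolding f_def by simp
      moreover have "Lp_norm lebesgue n (\<lambda>x. ennreal \<bar>f x\<bar>) < \<infinity>" unfolding Lp_norm_def Jf by simp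
      ultimately show ?thesis unfolding in_Lp_def by blast
    qed
    from C(2)[OF \<delta> this]
    have "(\<integral>\<^sup>+y. kakeya_maximal W {a..b} X \<delta> f y ^ n \<partial>lebesgue_on Y) \<le> ennreal ((C * \<delta> powr (- \<epsilon>)) ^ n * j)"
      by (rule Lp_norm_le_imp[OF _ Jf n0 _ j(2)]) (use C(1) in simp)
    also have "\<dots> \<le> ennreal ((C * \<delta> powr (- \<epsilon>)) ^ n * (c4 * \<rho> ^ (4 * m + 2)))"
      using j(3) C(1) by (intro ennreal_leI mult_left_mono) auto
    finally have upper: "(\<integral>\<^sup>+y. kakeya_maximal W {a..b} X \<delta> f y ^ n \<partial>lebesgue_on Y) \<le> \<dots>" .
    \<comment> \<open>The part of the tube near \<open>t\<^sub>0\<close> lies in \<open>E\<close>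
      and fills a proportion of order \<open>\<rho>\<close> of it.\<close>
    have Kf: "ennreal (c3 * \<rho>) \<le> kakeya_maximal W {a..b} X \<delta> f y" if y: "y \<in> ball y\<^sub>0 (\<rho> ^ 3)" for y
    proof -
      have "(\<integral>\<^sup>+x\<in>N y. ennreal \<bar>f x\<bar> \<partial>lebesgue) = emeasure lborel (E \<inter> N y)"
        unfolding f_abs nn_integral_completion indicator_inter_arith[symmetric] using Eb Nb[of y] by simp
      moreover have "N y \<inter> Z \<subseteq> E \<inter> N y" using y by (auto simp: E_def)
      then have "emeasure lborel (N y \<inter> Z) \<le> emeasure lborel (E \<inter> N y)"
        using Eb Nb[of y] by (intro emeasure_mono) auto
      ultimately have num: "ennreal (2 * \<beta> * \<delta> ^ m * \<rho>) \<le> (\<integral>\<^sup>+x\<in>N y. ennreal \<bar>f x\<bar> \<partial>lebesgue)"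
        using mNE[OF y] by simp
      have den: "emeasure lebesgue (N y) \<le> ennreal (c2 * \<delta> ^ m)" using mN[OF y] Nb[of y] by simp
      have "ennreal (c3 * \<rho>) = ennreal (2 * \<beta> * \<delta> ^ m * \<rho>) / ennreal (c2 * \<delta> ^ m)"
        using c2 \<delta>(1) \<beta> \<rho>(1) by (simp add: divide_ennreal c3_def)
      also have "\<dots> \<le> (\<integral>\<^sup>+x\<in>N y. ennreal \<bar>f x\<bar> \<partial>lebesgue) / emeasure lebesgue (N y)"
        unfolding divide_ennreal_def using num den by (intro mult_mono ennreal_inverse_antimono) auto
      also have "\<dots> \<le> kakeya_maximal W {a..b} X \<delta> f y"
        unfolding kakeya_maximal_def N_def using \<omega>[of y] y bY by (intro SUP_upper2[of "\<omega> y"]) auto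
      finally show ?thesis .
    qed
    have "ennreal ((c3 * \<rho>) ^ n * (\<beta> * (\<rho> ^ 3) ^ m)) = ennreal ((c3 * \<rho>) ^ n) * emeasure lebesgue (ball y\<^sub>0 (\<rho> ^ 3))"
      using c3 \<rho>(1) \<beta> by (simp add: emeasure_ball dimm \<beta>_def m_def ennreal_mult)
    also have "emeasure lebesgue (ball y\<^sub>0 (\<rho> ^ 3)) = emeasure (lebesgue_on Y) (ball y\<^sub>0 (\<rho> ^ 3))"
      using Y yY bY by (subst emeasure_restrict_space) auto
    also have "ennreal ((c3 * \<rho>) ^ n) * \<dots> = (\<integral>\<^sup>+y. ennreal ((c3 * \<rho>) ^ n) * indicator (ball y\<^sub>0 (\<rho> ^ 3)) y \<partial>lebesgue_on Y)"
      using Y yY bY by (intro nn_integral_cmult_indicator[symmetric]) (auto simp: sets_restrict_space_iff)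
    also have "\<dots> \<le> (\<integral>\<^sup>+y. kakeya_maximal W {a..b} X \<delta> f y ^ n \<partial>lebesgue_on Y)"
    proof (rule nn_integral_mono)
      fix y
      have "ennreal ((c3 * \<rho>) ^ n) \<le> kakeya_maximal W {a..b} X \<delta> f y ^ n" if "y \<in> ball y\<^sub>0 (\<rho> ^ 3)"
        using power_mono[OF Kf[OF that], of n] c3 \<rho>(1) by (simp add: ennreal_power)
      then show "ennreal ((c3 * \<rho>) ^ n) * indicator (ball y\<^sub>0 (\<rho> ^ 3)) y \<le> kakeya_maximal W {a..b} X \<delta> f y ^ n"
        by (simp add: indicator_def)
    qed
    also note upper
    finally have "(c3 * \<rho>) ^ n * (\<beta> * (\<rho> ^ 3) ^ m) \<le> (C * \<delta> powr (- \<epsilon>)) ^ n * (c4 * \<rho> ^ (4 * m + 2))"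
      using C(1) c4 \<rho>(1) by (simp add: ennreal_le_iff)
    moreover have "(C * \<delta> powr (- \<epsilon>)) ^ n = C ^ n * \<rho> powr (- 1 / 2)"
    proof -
      have "\<delta> powr (- \<epsilon>) = \<rho> powr (6 * - \<epsilon>)"
        using \<rho>(1) by (simp add: \<delta>_def powr_powr flip: powr_numeral)
      then have "(\<delta> powr (- \<epsilon>)) ^ n = \<rho> powr (6 * - \<epsilon> * real n)" using \<rho>(1) by (simp add: powr_power mult_ac)
      also have "6 * - \<epsilon> * real n = - 1 / 2" using n0 by (simp add: \<epsilon>_def)
      finally show ?thesis by (simp add: power_mult_distrib)
    qed
    moreover have "(c3 * \<rho>) ^ n * (\<beta> * (\<rho> ^ 3) ^ m) = (c3 ^ n * \<beta>) * \<rho> ^ (4 * m + 1)"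
      by (simp add: n_def power_mult_distrib power_mult[symmetric] power_add[symmetric] mult_ac)
    moreover have "(C ^ n * \<rho> powr (- 1 / 2)) * (c4 * \<rho> ^ (4 * m + 2)) = (C ^ n * c4 * sqrt \<rho>) * \<rho> ^ (4 * m + 1)"
    proof -
      have "\<rho> powr (- 1 / 2) * \<rho> = \<rho> powr (- 1 / 2 + 1)" using \<rho>(1) by (subst powr_add) simp
      also have "\<dots> = sqrt \<rho>" using \<rho>(1) by (simp add: powr_half_sqrt)
      finally have "sqrt \<rho> = \<rho> powr (- 1 / 2) * \<rho>" by simp
      then show ?thesis by (simp add: mult_ac)
    qed
    ultimately have "(c3 ^ n * \<beta>) * \<rho> ^ (4 * m + 1) \<le> (C ^ n * c4 * sqrt \<rho>) * \<rho> ^ (4 * m + 1)" by (simp only:)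
    then show ?thesis using \<rho>(1) by (simp only: mult_le_cancel_right_pos zero_less_power)
  qed
  define A where "A = c3 ^ n * \<beta>"
  define B where "B = C ^ n * c4"
  have AB: "A > 0" "B > 0" unfolding A_def B_def using c3 \<beta> C(1) c4 by simp_all
  \<comment> \<open>Makes the right side of \<open>main\<close> at most half of the left
    side.\<close>
  define \<rho> where "\<rho> = min (r / 2) ((A / (2 * B))\<^sup>2)"
  have \<rho>: "0 < \<rho>" "\<rho> < r" unfolding \<rho>_def using r AB by auto
  have "sqrt \<rho> \<le> sqrt ((A / (2 * B))\<^sup>2)" unfolding \<rho>_def by (intro real_sqrt_le_mono) simp
  also have "\<dots> = A / (2 * B)" using AB by (simp add: real_sqrt_abs)
  finally have "B * sqrt \<rho> \<le> B * (A / (2 * B))" using AB by (intro mult_left_mono) auto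
  also have "\<dots> = A / 2" using AB by simp
  finally show False using main[OF \<rho>] AB unfolding A_def[symmetric] B_def[symmetric] by linarith
qed

end

section \<open>Conclusion\<close>

context smooth_domain
begin

lemma C_norm_mono: "smooth Q f \<Longrightarrow> r \<le> R \<Longrightarrow> C_norm Q r f \<le> C_norm Q R f"
  by (rule C_norm_le) (auto intro: C_norm_ge)

end

context pt_domain
begin

lemma hormander_subset: "hormander Q \<subseteq> C_infty Q"
  by (auto simp: hormander_def)

lemma topspace_hormander_topology: "topspace (hormander_topology Q) = hormander Q"
  using hormander_subset unfolding hormander_topology_def topspace_subtopology topspace_C_infty_topology by blast

lemma openin_hormander_topology_D:
  assumes "openin (hormander_topology Q) U" "X \<in> U"
  shows "\<exists>r \<epsilon>. \<epsilon> > 0 \<and> (\<forall>Z\<in>hormander Q. C_norm Q r (\<lambda>q. Z q - X q) < \<epsilon> \<longrightarrow> Z \<in> U)"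
proof -
  obtain V where V: "openin (C_infty_topology Q) V" "U = V \<inter> hormander Q"
    using assms(1) unfolding hormander_topology_def openin_subtopology by blast
  obtain r \<epsilon> where "\<epsilon> > 0" "\<forall>Z\<in>C_infty Q. C_norm Q r (\<lambda>q. Z q - X q) < \<epsilon> \<longrightarrow> Z \<in> V"
    using openin_C_infty_topology_D[OF V(1), of X] assms(2) V(2) by blast
  then show ?thesis using hormander_subset V(2) by blast
qed

lemma hormander_closure_of_eqI:
  assumes "S \<subseteq> hormander Q"
    and "\<And>X r \<epsilon>. X \<in> hormander Q \<Longrightarrow> \<epsilon> > 0 \<Longrightarrow> \<exists>Z\<in>S. C_norm Q r (\<lambda>q. Z q - X q) < \<epsilon>"
  shows "hormander_topology Q closure_of S = hormander Q"
proof
  show "hormander_topology Q closure_of S \<subseteq> hormander Q"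
    using closure_of_subset_topspace topspace_hormander_topology by metis
  show "hormander Q \<subseteq> hormander_topology Q closure_of S"
  proof
    fix X assume X: "X \<in> hormander Q"
    have meets: "\<exists>Z\<in>S. Z \<in> U" if U: "X \<in> U" "openin (hormander_topology Q) U" for U
    proof -
      obtain r \<epsilon> where e: "\<epsilon> > 0" "\<forall>Z\<in>hormander Q. C_norm Q r (\<lambda>q. Z q - X q) < \<epsilon> \<longrightarrow> Z \<in> U"
        using openin_hormander_topology_D[OF U(2,1)] by (elim exE conjE)
      obtain Z where "Z \<in> S" "C_norm Q r (\<lambda>q. Z q - X q) < \<epsilon>" using assms(2)[OF X e(1), of r] by (elim bexE)
      then show ?thesis using e(2) assms(1) by (intro bexI[of _ Z]) auto
    qed
    show "X \<in> hormander_topology Q closure_of S"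
      using X meets unfolding in_closure_of topspace_hormander_topology by blast
  qed
qed

lemma closedin_bourgain: "closedin (hormander_topology Q) (bourgain Q)"
proof -
  have "openin (C_infty_topology Q) (hormander Q - bourgain Q)"
    unfolding openin_C_infty_topology_iff
  proof (intro conjI ballI)
    show "hormander Q - bourgain Q \<subseteq> C_infty Q" using hormander_subset by blast
    fix X assume X: "X \<in> hormander Q - bourgain Q"
    obtain e1 where e1: "e1 > 0" "\<And>Z. Z \<in> C_infty Q \<Longrightarrow> C_norm Q 2 (\<lambda>q. Z q - X q) < e1 \<Longrightarrow> Z \<in> hormander Q"
      by (rule hormander_nbhd[of X]) (use X in auto)
    obtain e2 where e2: "e2 > 0" "\<And>Z. Z \<in> C_infty Q \<Longrightarrow> C_norm Q 3 (\<lambda>q. Z q - X q) < e2 \<Longrightarrow> Z \<notin> bourgain Q"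
      by (rule bourgain_nbhd[of X]) (use X in auto)
    have "Z \<in> hormander Q - bourgain Q" if Z: "Z \<in> C_infty Q" "C_norm Q 3 (\<lambda>q. Z q - X q) < min e1 e2" for Z
    proof -
      have "smooth Q (\<lambda>q. Z q - X q)" using Z(1) X hormander_subset by (intro smooth_diff) (auto simp: C_infty_iff)
      then have "C_norm Q 2 (\<lambda>q. Z q - X q) \<le> C_norm Q 3 (\<lambda>q. Z q - X q)" by (rule C_norm_mono) simp
      then show ?thesis using e1(2)[OF Z(1)] e2(2)[OF Z(1)] Z(2) by auto
    qed
    then show "\<exists>r \<epsilon>. \<epsilon> > 0 \<and> (\<forall>Z\<in>C_infty Q. C_norm Q r (\<lambda>q. Z q - X q) < \<epsilon> \<longrightarrow> Z \<in> hormander Q - bourgain Q)"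
      using e1(1) e2(1) by (intro exI[of _ 3] exI[of _ "min e1 e2"]) auto
  qed
  then have "openin (hormander_topology Q) (hormander Q - bourgain Q)"
    unfolding hormander_topology_def openin_subtopology by blast
  moreover have "bourgain Q \<subseteq> hormander Q" by (auto simp: bourgain_def)
  ultimately show ?thesis by (simp add: closedin_def topspace_hormander_topology)
qed

text \<open>Closeness of order \<open>max r 2\<close> keeps the perturbed map inside the open set of
  Hoermander maps while meeting the requested order \<open>r\<close>.\<close>

lemma near_non_bourgain:
  assumes card: "CARD('m) \<ge> 2" and X: "X \<in> hormander Q" and \<epsilon>: "\<epsilon> > 0"
  shows "\<exists>Z\<in>hormander Q - bourgain Q. C_norm Q r (\<lambda>q. Z q - X q) < \<epsilon>"
proof (cases "X \<in> bourgain Q")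
  case False
  then show ?thesis using X C_norm_zero_less[OF \<epsilon>] by blast
next
  case True
  obtain e1 where e1: "e1 > 0" "\<And>Z. Z \<in> C_infty Q \<Longrightarrow> C_norm Q 2 (\<lambda>q. Z q - X q) < e1 \<Longrightarrow> Z \<in> hormander Q"
    by (rule hormander_nbhd[OF X]) auto
  have "min \<epsilon> e1 > 0" using \<epsilon> e1(1) by simp
  from not_bourgain_dense[OF True this card, of "max r 2"]
  obtain Z where Z: "Z \<in> C_infty Q" "C_norm Q (max r 2) (\<lambda>q. Z q - X q) < min \<epsilon> e1" "Z \<notin> bourgain Q" by blast
  have s: "smooth Q (\<lambda>q. Z q - X q)" using Z(1) X hormander_subset by (intro smooth_diff) (auto simp: C_infty_iff)
  have "C_norm Q 2 (\<lambda>q. Z q - X q) < e1" "C_norm Q r (\<lambda>q. Z q - X q) < \<epsilon>"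
    using C_norm_mono[OF s, of 2 "max r 2"] C_norm_mono[OF s, of r "max r 2"] Z(2) by auto
  then show ?thesis using e1(2) Z by blast
qed

lemma interior_of_bourgain:
  assumes card: "CARD('m) \<ge> 2"
  shows "hormander_topology Q interior_of (hormander_topology Q closure_of bourgain Q) = {}"
proof -
  have "X \<notin> U" if U: "openin (hormander_topology Q) U" "U \<subseteq> bourgain Q" for X U
  proof
    assume XU: "X \<in> U"
    then have X: "X \<in> hormander Q" using U(2) by (auto simp: bourgain_def)
    obtain r \<epsilon> where e: "\<epsilon> > 0" "\<forall>Z\<in>hormander Q. C_norm Q r (\<lambda>q. Z q - X q) < \<epsilon> \<longrightarrow> Z \<in> U"
      using openin_hormander_topology_D[OF U(1) XU] by (elim exE conjE)
    then show False using near_non_bourgain[OF card X e(1), of r] U(2) by blast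
  qed
  then show ?thesis
    unfolding closure_of_closedin[OF closedin_bourgain] interior_of_def by blast
qed

end

context slab
begin

definition lifting_maps :: "real^'m \<Rightarrow> ('m pt \<Rightarrow> real^'m) set" where
  "lifting_maps y\<^sub>0 = {X \<in> hormander Q. \<exists>M h c B. h > 0 \<and> (\<forall>w\<in>W. \<forall>y\<in>Y.
     (\<forall>t\<in>{a..b}. X (w, t, y) = (\<Sum>j\<le>M. t ^ j *\<^sub>R c j w y) + (h * t ^ Suc M) *\<^sub>R (y - y\<^sub>0)) \<and>
     (\<forall>j. norm (c j w y) \<le> B))}"

text \<open>Two perturbations of size \<open>e\<close>: first the polynomial approximation, which
  fixes \<open>M\<close>, then a small multiple of \<open>t^(M+1) (y - y\<^sub>0)\<close>, one
  degree above everything present, so that it is exactly the top coefficient.\<close>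

lemma lifting_maps_dense:
  assumes X: "X \<in> hormander Q" and \<epsilon>: "\<epsilon> > 0"
  shows "\<exists>Z\<in>lifting_maps y\<^sub>0. C_norm Q r (\<lambda>q. Z q - X q) < \<epsilon>"
proof -
  define R where "R = max r 2"
  have sX: "smooth Q X" by (rule hormanderD(1)[OF X])
  obtain e1 where e1: "e1 > 0" "\<And>Z. Z \<in> C_infty Q \<Longrightarrow> C_norm Q 2 (\<lambda>q. Z q - X q) < e1 \<Longrightarrow> Z \<in> hormander Q"
    by (rule hormander_nbhd[OF X]) auto
  define e where "e = min \<epsilon> e1 / 2"
  have e: "e > 0" unfolding e_def using \<epsilon> e1(1) by simp
  obtain n where n: "C_norm Q R (\<lambda>q. approx n R X q - X q) < e" by (rule approx_converges[OF sX e])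
  define Z1 where "Z1 = restrict (approx n R X) Q"
  have sZ1: "smooth Q Z1" unfolding Z1_def
    using smooth_cong[of Q "restrict (approx n R X) Q" "approx n R X"] smooth_approx[OF sX, of n R] by simp
  then have Z1: "Z1 \<in> C_infty Q" by (simp add: C_infty_iff Z1_def)
  have nZ1: "C_norm Q R (\<lambda>q. Z1 q - X q) < e"
  proof -
    have "C_norm Q R (\<lambda>q. Z1 q - X q) = C_norm Q R (\<lambda>q. approx n R X q - X q)"
      by (rule C_norm_cong) (simp add: Z1_def)
    then show ?thesis using n by simp
  qed
  obtain M where M: "polynomial_in_t M (approx n R X)" using polynomial_in_t_approx[OF sX, of n R] by (rule exE)
  define hf where "hf q = (fst (snd q)) ^ Suc M *\<^sub>R (snd (snd q) - y\<^sub>0)" for q :: "'m pt"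
  have shf: "smooth Q hf" unfolding hf_def
    by (intro smooth_scaleR smooth_power smooth_diff smooth_const smooth_bounded_linear
        bounded_linear_compose[OF bounded_linear_fst bounded_linear_snd] bounded_linear_compose[OF bounded_linear_snd bounded_linear_snd])
  obtain s where s: "s > 0" "restrict (\<lambda>q. Z1 q + s *\<^sub>R hf q) Q \<in> C_infty Q"
    "C_norm Q R (\<lambda>q. restrict (\<lambda>q. Z1 q + s *\<^sub>R hf q) Q q - Z1 q) < e"
    by (rule small_perturbation[OF Z1 shf e])
  define Z where "Z = restrict (\<lambda>q. Z1 q + s *\<^sub>R hf q) Q"
  have Z: "Z \<in> C_infty Q" "C_norm Q R (\<lambda>q. Z q - Z1 q) < e" using s by (auto simp: Z_def)
  then have sZ: "smooth Q Z" by (simp add: C_infty_iff)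
  have close: "C_norm Q R (\<lambda>q. Z q - X q) < 2 * e"
    using C_norm_triangle[OF sZ sZ1 sX, of R] Z(2) nZ1 by linarith
  have mono: "C_norm Q k (\<lambda>q. Z q - X q) < 2 * e" if "k \<le> R" for k
    using C_norm_mono[OF smooth_diff[OF sZ sX] that] close by linarith
  have "Z \<in> hormander Q" using mono[of 2] by (intro e1(2) Z(1)) (simp add: R_def e_def)
  moreover obtain c B where c: "\<forall>w\<in>W. \<forall>y\<in>Y. (\<forall>t\<in>{a..b}. approx n R X (w, t, y) = (\<Sum>j\<le>M. t ^ j *\<^sub>R c j w y)) \<and> (\<forall>j. norm (c j w y) \<le> B)"
    using M unfolding polynomial_in_t_def by (elim exE)
  moreover have "Z (w, t, y) = approx n R X (w, t, y) + (s * t ^ Suc M) *\<^sub>R (y - y\<^sub>0)" if "w \<in> W" "y \<in> Y" "t \<in> {a..b}" for w t y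
    using that by (simp add: Z_def Z1_def hf_def Q_eq)
  ultimately have "Z \<in> lifting_maps y\<^sub>0"
    unfolding lifting_maps_def using s(1)
    by (intro CollectI conjI exI[of _ M] exI[of _ s] exI[of _ c] exI[of _ B]) auto
  moreover have "C_norm Q r (\<lambda>q. Z q - X q) < \<epsilon>" using mono[of r] by (simp add: R_def e_def)
  ultimately show ?thesis by blast
qed

lemma hausdorff_dim_kakeya_set:
  assumes kak: "\<And>N. N \<ge> 1 \<Longrightarrow> linear_kakeya_conjecture N"
    and Y: "Y = cball y\<^sub>0 \<sigma>" "\<sigma> > 0" and X: "X \<in> lifting_maps y\<^sub>0" and K: "kakeya_set W {a..b} Y X K"
  shows "hausdorff_dim dist K = ereal (real (Suc CARD('m)))"
proof (rule antisym)
  have "compact K" using K by (simp add: kakeya_set_def)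
  then show "hausdorff_dim dist K \<le> ereal (real (Suc CARD('m)))"
    using hausdorff_dim_bounded_le[OF compact_imp_bounded, of K] by simp
  obtain M h c B where h: "h > 0" and c: "\<forall>w\<in>W. \<forall>y\<in>Y.
     (\<forall>t\<in>{a..b}. X (w, t, y) = (\<Sum>j\<le>M. t ^ j *\<^sub>R c j w y) + (h * t ^ Suc M) *\<^sub>R (y - y\<^sub>0)) \<and>
     (\<forall>j. norm (c j w y) \<le> B)"
    using X unfolding lifting_maps_def by blast
  \<comment> \<open>An enumeration of the index type, needed to place vectors into the blocks of a
    sequence in \<open>\<real>^N\<close>.\<close>
  obtain e :: "'m \<Rightarrow> nat" where e: "bij_betw e UNIV {..<CARD('m)}"
    using ex_bij_betw_finite_nat[of "UNIV :: 'm set"] by (auto simp: atLeast0LessThan)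
  interpret polynomial_lift e M "CARD('m)" by unfold_locales (simp_all add: e)
  show "ereal (real (Suc CARD('m))) \<le> hausdorff_dim dist K"
  proof (rule hausdorff_dim_lower_bound[OF kak h Y(2) ab])
    show "N \<ge> 1" by (simp add: N_def)
    show "norm (c j w y) \<le> B" if "w \<in> W" "y \<in> cball y\<^sub>0 \<sigma>" for j w y using c that Y(1) by blast
    show "compact K" by fact
    fix y assume "y \<in> cball y\<^sub>0 \<sigma>"
    then have y: "y \<in> Y" using Y(1) by simp
    then obtain w where w: "w \<in> W" "kakeya_curve {a..b} X y w \<subseteq> K" using K unfolding kakeya_set_def by blast
    have "((\<Sum>j\<le>M. t ^ j *\<^sub>R c j w y) + (h * t ^ Suc M) *\<^sub>R (y - y\<^sub>0), t) \<in> K" if t: "t \<in> {a..b}" for t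
    proof -
      have "(X (w, t, y), t) \<in> K" using w(2) t unfolding kakeya_curve_def by blast
      then show ?thesis using c w(1) y t by auto
    qed
    then show "\<exists>w\<in>W. \<forall>t\<in>{a..b}. ((\<Sum>j\<le>M. t ^ j *\<^sub>R c j w y) + (h * t ^ Suc M) *\<^sub>R (y - y\<^sub>0), t) \<in> K"
      using w(1) by blast
  qed
qed

end

theorem theorem1p2:
  fixes n :: nat
    and W Y :: "(real ^ 'm::finite) set" and I :: "real set"
    and w\<^sub>0 y\<^sub>0 :: "real ^ 'm" and \<rho> \<sigma> a b :: real
    and Q :: "'m pt set"
  assumes linear_kakeya: "\<forall>N\<ge>1. linear_kakeya_conjecture N"
    and n: "n \<ge> 3" "CARD('m) = n - 1"
    and W: "W = cball w\<^sub>0 \<rho>" "\<rho> > 0"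
    and Y: "Y = cball y\<^sub>0 \<sigma>" "\<sigma> > 0"
    and I: "I = {a..b}" "a < b"
    and Q: "Q = W \<times> I \<times> Y"
  shows "\<exists>P \<subseteq> hormander Q.
      hormander_topology Q closure_of P = hormander Q \<and>
      (\<forall>X\<in>P. \<forall>K. kakeya_set W I Y X K \<longrightarrow> hausdorff_dim dist K = ereal (real n)) \<and>
      closedin (hormander_topology Q) (bourgain Q) \<and>
      hormander_topology Q interior_of (hormander_topology Q closure_of bourgain Q) = {} \<and>
      hormander_topology Q closure_of (P - bourgain Q) = hormander Q \<and>
      (\<forall>X \<in> P - bourgain Q.
         (\<forall>K. kakeya_set W I Y X K \<longrightarrow> hausdorff_dim dist K = ereal (real n)) \<and>
         \<not> critical_estimate n W I Y X)"
proof -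
  have n_eq: "n = Suc CARD('m)" and card: "CARD('m) \<ge> 2" using n by auto
  interpret slab Q W Y a b
  proof
    show "convex Q" unfolding Q W Y I by (intro convex_Times convex_cball convex_real_interval)
    show "compact Q" unfolding Q W Y I by (intro compact_Times compact_cball compact_Icc)
    show "interior Q \<noteq> {}" unfolding Q W Y I interior_Times using W(2) Y(2) I(2) by auto
  qed (use Q I in auto)
  define P where "P = lifting_maps y\<^sub>0"
  have sub: "P \<subseteq> hormander Q" by (auto simp: P_def lifting_maps_def)
  have dense: "\<exists>Z\<in>P. C_norm Q r (\<lambda>q. Z q - X q) < \<epsilon>" if "X \<in> hormander Q" "\<epsilon> > 0" for X r \<epsilon>
    unfolding P_def using that by (rule lifting_maps_dense)
  have dim: "hausdorff_dim dist K = ereal (real n)" if "X \<in> P" "kakeya_set W I Y X K" for X K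
    unfolding n_eq using that linear_kakeya unfolding P_def I(1) by (intro hausdorff_dim_kakeya_set[OF _ Y]) auto
  have dense': "hormander_topology Q closure_of (P - bourgain Q) = hormander Q"
  proof (rule hormander_closure_of_eqI)
    show "P - bourgain Q \<subseteq> hormander Q" using sub by blast
    fix X r and \<epsilon> :: real assume X: "X \<in> hormander Q" and \<epsilon>: "\<epsilon> > 0"
    \<comment> \<open>Two dense sets need not meet. First leave \<open>bourgain Q\<close>; its
      complement is open, so a lifting map close enough to \<open>X'\<close> stays outside.\<close>
    obtain X' where X': "X' \<in> hormander Q - bourgain Q" "C_norm Q r (\<lambda>q. X' q - X q) < \<epsilon> / 2"
      using near_non_bourgain[OF card X, of "\<epsilon> / 2" r] \<epsilon> by auto
    obtain e where e: "e > 0" "\<And>Z. Z \<in> C_infty Q \<Longrightarrow> C_norm Q 3 (\<lambda>q. Z q - X' q) < e \<Longrightarrow> Z \<notin> bourgain Q"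
      by (rule bourgain_nbhd[of X']) (use X' in auto)
    define R where "R = max r 3"
    obtain Z where Z: "Z \<in> P" "C_norm Q R (\<lambda>q. Z q - X' q) < min (\<epsilon> / 2) e"
      using dense[of X' "min (\<epsilon> / 2) e" R] X'(1) \<epsilon> e(1) by auto
    have H: "Z \<in> hormander Q" using Z(1) sub by blast
    have sm: "smooth Q Z" "smooth Q X'" "smooth Q X" using H X X' by (auto intro: hormanderD)
    have mono: "C_norm Q k (\<lambda>q. Z q - X' q) < min (\<epsilon> / 2) e" if "k \<le> R" for k
      using C_norm_mono[OF smooth_diff[OF sm(1,2)] that] Z(2) by linarith
    have "Z \<notin> bourgain Q" using mono[of 3] H hormander_subset by (intro e(2)) (auto simp: R_def)
    moreover have "C_norm Q r (\<lambda>q. Z q - X q) < \<epsilon>"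
      using C_norm_triangle[OF sm, of r] mono[of r] X'(2) by (simp add: R_def)
    ultimately show "\<exists>Z\<in>P - bourgain Q. C_norm Q r (\<lambda>q. Z q - X q) < \<epsilon>" using Z(1) by blast
  qed
  have nc: "\<not> critical_estimate n W I Y X" if X: "X \<in> P - bourgain Q" for X
  proof -
    have XH: "X \<in> hormander Q" "X \<notin> bourgain Q" using X sub by auto
    have Ym: "Y \<in> sets lebesgue" unfolding Y by simp
    show ?thesis
      unfolding n_eq I(1)
      by (rule thin_slices[OF XH]) (rule not_critical_estimate[OF Ym hormanderD(1)[OF XH(1)]])
  qed
  show ?thesis
    using sub hormander_closure_of_eqI[OF sub dense] dim closedin_bourgain interior_of_bourgain[OF card] dense' nc
    by (intro exI[of _ P]) auto
qed

end
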